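(* Let $N\ge 0$ be an integer. For every $q\in W\cap H^N_{0,\mathbb{C}}$, $$\kappa_n(q)=\frac{1}{2\pi n}\left(\langle q,\sin 2\pi n x\rangle+\frac{1}{n^{N+1}}\,\ell^2_n\right),\qquad n\ge 1,$$ uniformly on bounded subsets of $W\cap H^N_{0,\mathbb{C}}$.
   Context: $\mathbb{T}=\mathbb{R}/\mathbb{Z}$. For $N\in\mathbb{Z}_{\ge 0}$, $H^N_{0,\mathbb{C}}$ is the space of complex-valued 1-periodic functions $p(x)=\sum_{n\ne 0}\hat p_n e^{2\pi i n x}$ with $\|p\|_N=(\sum_{n\neq 0}|n|^{2N}|\hat p_n|^2)^{1/2}<\infty$, and $H^N_0$ is its subspace of real-valued functions; $L^2_0=H^0_0$. $\langle f,g\rangle=\int_0^1 f(x)\overline{g(x)}\,dx$. For $q\in H^0_{0,\mathbb{C}}$, let $L(q)=-d_x^2+q$ and let $y_1(x,\lambda),y_2(x,\lambda)$ be the solutions of $-y''+qy=\lambda y$ with $y_1(0)=1,\ y_1'(0)=0,\ y_2(0)=0,\ y_2'(0)=1$. The Dirichlet eigenvalues of $L(q)$ on $[0,1]$ (zeros of $\lambda\mapsto y_2(1,\lambda)$) are listed with algebraic multiplicities as $\mu_1,\mu_2,\dots$ in lexicographic order ($a\preceq b$ iff $\mathrm{Re}\,a<\mathrm{Re}\,b$, or $\mathrm{Re}\,a=\mathrm{Re}\,b$ and $\mathrm{Im}\,a\le \mathrm{Im}\,b$). $W$ denotes an open neighbourhood of $L^2_0$ in $H^0_{0,\mathbb{C}}$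 (such a neighbourhood exists) on which all Dirichlet eigenvalues $\mu_n$, $n\ge1$, are simple and real analytic functions of $q$, and on which $$\kappa_n:=-\log\big((-1)^n y_1(1,\mu_n)\big),\qquad n\ge 1,$$ ($\log$ the principal branch) define real analytic functions of $q$. (For real $q$ one has $(-1)^ny_1(1,\mu_n)>0$.) Notation: $\ell^2_n$ stands for the $n$-th component of some sequence in $\ell^2(\mathbb{N},\mathbb{C})$. "Uniformly on bounded subsets" means that the $\ell^2$-norm of this sequence is bounded by a constant depending only on $N$ and the bounded subset. *)

theory Defs
  imports "HOL-Complex_Analysis.Complex_Analysis"
begin

section \<open>The spaces of periodic functions\<close>

definition l2_inner :: "(real \<Rightarrow> complex) \<Rightarrow> (real \<Rightarrow> complex) \<Rightarrow> complex" where
  "l2_inner f g = (LINT x|lebesgue_on {0..1}. f x * cnj (g x))"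

definition fourier_coeff :: "(real \<Rightarrow> complex) \<Rightarrow> int \<Rightarrow> complex" where
  "fourier_coeff p n = l2_inner p (\<lambda>x. exp (2 * of_real pi * \<i> * of_int n * of_real x))"

text \<open>The elements of the spaces are functions, not classes modulo equality almost everywhere;
  accordingly the norms below are seminorms on functions. Notions that are stated through these
  norms (open sets, differentiability) are automatically invariant under changes on null sets.\<close>

definition HC :: "nat \<Rightarrow> (real \<Rightarrow> complex) set" where
  "HC N = {p. (\<forall>x. p (x + 1) = p x)
            \<and> p \<in> borel_measurable lebesgue
            \<and> integrable (lebesgue_on {0..1}) (\<lambda>x. (cmod (p x))\<^sup>2)
            \<and> fourier_coeff p 0 = 0
            \<and> (\<lambda>n::int. \<bar>real_of_int n\<bar> ^ (2 * N) * (cmod (fourier_coeff p n))\<^sup>2)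
                 summable_on {n. n \<noteq> 0}}"

definition HR :: "nat \<Rightarrow> (real \<Rightarrow> complex) set" where
  "HR N = {p \<in> HC N. \<forall>x. p x \<in> \<real>}"

definition Hnorm :: "nat \<Rightarrow> (real \<Rightarrow> complex) \<Rightarrow> real" where
  "Hnorm N p =
     sqrt (\<Sum>\<^sub>\<infinity>n\<in>{n::int. n \<noteq> 0}. \<bar>real_of_int n\<bar> ^ (2 * N) * (cmod (fourier_coeff p n))\<^sup>2)"

definition Hbounded :: "nat \<Rightarrow> (real \<Rightarrow> complex) set \<Rightarrow> bool" where
  "Hbounded N B \<longleftrightarrow> (\<exists>M. \<forall>q\<in>B. Hnorm N q \<le> M)"

definition open_in_H0 :: "(real \<Rightarrow> complex) set \<Rightarrow> bool" where
  "open_in_H0 W \<longleftrightarrow> W \<subseteq> HC 0 \<and>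
     (\<forall>q\<in>W. \<exists>\<epsilon>>0. \<forall>p\<in>HC 0. Hnorm 0 (\<lambda>x. p x - q x) < \<epsilon> \<longrightarrow> p \<in> W)"

section \<open>Analytic functions on open subsets of the space of square integrable functions\<close>

definition has_H0_derivative ::
  "((real \<Rightarrow> complex) \<Rightarrow> complex) \<Rightarrow> ((real \<Rightarrow> complex) \<Rightarrow> complex) \<Rightarrow> (real \<Rightarrow> complex) \<Rightarrow> bool" where
  "has_H0_derivative F D q \<longleftrightarrow>
     (\<forall>h\<in>HC 0. \<forall>k\<in>HC 0. D (\<lambda>x. h x + k x) = D h + D k)
   \<and> (\<forall>c::complex. \<forall>h\<in>HC 0. D (\<lambda>x. c * h x) = c * D h)
   \<and> (\<exists>K. \<forall>h\<in>HC 0. cmod (D h) \<le> K * Hnorm 0 h)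
   \<and> (\<forall>\<epsilon>>0. \<exists>\<delta>>0. \<forall>h\<in>HC 0. Hnorm 0 h < \<delta> \<longrightarrow>
        cmod (F (\<lambda>x. q x + h x) - F q - D h) \<le> \<epsilon> * Hnorm 0 h)"

text \<open>On an open subset of a complex Banach space, a function is analytic iff it is continuously
  Frechet differentiable over the complex numbers.\<close>

definition analytic_on_H0 :: "((real \<Rightarrow> complex) \<Rightarrow> complex) \<Rightarrow> (real \<Rightarrow> complex) set \<Rightarrow> bool" where
  "analytic_on_H0 F W \<longleftrightarrow> (\<exists>D.
     (\<forall>q\<in>W. has_H0_derivative F (D q) q)
   \<and> (\<forall>q\<in>W. \<forall>\<epsilon>>0. \<exists>\<delta>>0. \<forall>p\<in>W. Hnorm 0 (\<lambda>x. p x - q x) < \<delta> \<longrightarrow>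
        (\<forall>h\<in>HC 0. cmod (D p h - D q h) \<le> \<epsilon> * Hnorm 0 h)))"

text \<open>A function on a subset of the complexified space is called real analytic if it is analytic
  there and takes real values at the real-valued elements.\<close>

definition real_analytic_on_H0 :: "((real \<Rightarrow> complex) \<Rightarrow> complex) \<Rightarrow> (real \<Rightarrow> complex) set \<Rightarrow> bool" where
  "real_analytic_on_H0 F W \<longleftrightarrow> analytic_on_H0 F W \<and> (\<forall>q \<in> W \<inter> HR 0. F q \<in> \<real>)"

section \<open>Fundamental solutions and Dirichlet eigenvalues\<close>

text \<open>Since the potential is merely square integrable, solutions are understood in the sense of
  Caratheodory: the derivative of the solution is absolutely continuous, with density
  \<open>y''\<close>, and the equation holds almost everywhere.\<close>

definition schroedinger_solution ::
  "(real \<Rightarrow> complex) \<Rightarrow> complex \<Rightarrow> (real \<Rightarrow> complex) \<Rightarrow> (real \<Rightarrow> complex) \<Rightarrow> bool" where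
  "schroedinger_solution q \<nu> y y' \<longleftrightarrow>
     (\<forall>x\<in>{0..1}. (y has_vector_derivative y' x) (at x within {0..1}))
   \<and> (\<exists>y''. y'' absolutely_integrable_on {0..1}
          \<and> (\<forall>x\<in>{0..1}. y' x = y' 0 + integral {0..x} y'')
          \<and> (AE x in lebesgue_on {0..1}. - y'' x + q x * y x = \<nu> * y x))"

text \<open>Only the values on \<open>{0..1}\<close> are meaningful; there the solution is unique.\<close>

definition y1 :: "(real \<Rightarrow> complex) \<Rightarrow> real \<Rightarrow> complex \<Rightarrow> complex" where
  "y1 q x \<nu> = (SOME y. \<exists>y'. schroedinger_solution q \<nu> y y' \<and> y 0 = 1 \<and> y' 0 = 0) x"

definition y2 :: "(real \<Rightarrow> complex) \<Rightarrow> real \<Rightarrow> complex \<Rightarrow> complex" where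
  "y2 q x \<nu> = (SOME y. \<exists>y'. schroedinger_solution q \<nu> y y' \<and> y 0 = 0 \<and> y' 0 = 1) x"

definition lex_le :: "complex \<Rightarrow> complex \<Rightarrow> bool" where
  "lex_le a b \<longleftrightarrow> Re a < Re b \<or> (Re a = Re b \<and> Im a \<le> Im b)"

text \<open>\<open>\<mu>\<close> lists the zeros of \<open>y2 q 1\<close>, each one as often as its multiplicity, in
  lexicographic order. The enumeration starts at 1; the entry with index 0 is irrelevant.\<close>

definition dirichlet_listing :: "(real \<Rightarrow> complex) \<Rightarrow> (nat \<Rightarrow> complex) \<Rightarrow> bool" where
  "dirichlet_listing q \<mu> \<longleftrightarrow>
     (\<forall>m n. 1 \<le> m \<and> m \<le> n \<longrightarrow> lex_le (\<mu> m) (\<mu> n))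
   \<and> (\<forall>n\<ge>1. y2 q 1 (\<mu> n) = 0)
   \<and> (\<forall>\<nu>. y2 q 1 \<nu> = 0 \<longrightarrow>
        finite {n. 1 \<le> n \<and> \<mu> n = \<nu>} \<and> int (card {n. 1 \<le> n \<and> \<mu> n = \<nu>}) = zorder (y2 q 1) \<nu>)"

definition dirichlet_ev :: "nat \<Rightarrow> (real \<Rightarrow> complex) \<Rightarrow> complex" where
  "dirichlet_ev n q = (SOME \<mu>. dirichlet_listing q \<mu>) n"

definition kappa :: "nat \<Rightarrow> (real \<Rightarrow> complex) \<Rightarrow> complex" where
  "kappa n q = - Ln ((-1) ^ n * y1 q 1 (dirichlet_ev n q))"

definition admissible_nbhd :: "(real \<Rightarrow> complex) set \<Rightarrow> bool" where
  "admissible_nbhd W \<longleftrightarrow>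
     open_in_H0 W \<and> HR 0 \<subseteq> W
   \<and> (\<forall>n\<ge>1. \<forall>q\<in>W. zorder (y2 q 1) (dirichlet_ev n q) = 1)
   \<and> (\<forall>n\<ge>1. real_analytic_on_H0 (dirichlet_ev n) W)
   \<and> (\<forall>n\<ge>1. real_analytic_on_H0 (kappa n) W)"

section \<open>Square summable sequences indexed by the positive integers\<close>

definition ell2 :: "(nat \<Rightarrow> complex) set" where
  "ell2 = {a. (\<lambda>n. (cmod (a n))\<^sup>2) summable_on {1..}}"

definition ell2_norm :: "(nat \<Rightarrow> complex) \<Rightarrow> real" where
  "ell2_norm a = sqrt (\<Sum>\<^sub>\<infinity>n\<in>{1..}. (cmod (a n))\<^sup>2)"

end

theory Submission
  imports Defs
begin

text \<open>At a Dirichlet eigenvalue \<open>\<mu>\<^sub>n\<close> the solution \<open>y\<^sub>2\<close> is a Floquet solution with multiplier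
  \<open>(-1)\<^sup>n exp \<kappa>\<^sub>n\<close>, because the Wronskian turns \<open>1 / y\<^sub>1(1)\<close> into \<open>y\<^sub>2'(1)\<close>. Dividing by its
  exponential factor leaves a periodic function whose Fourier coefficients \<open>H\<^sub>k\<close> satisfy
  \<open>D\<^sub>k H\<^sub>k = \<Sum>\<^sub>j q\<^sub>k\<^sub>-\<^sub>j H\<^sub>j\<close> with \<open>D\<^sub>k\<close> of size \<open>k (k + n)\<close> except at the resonant indices
  \<open>0\<close> and \<open>-n\<close>, where \<open>D\<^sub>0 - D\<^sub>-\<^sub>n = 4 \<pi> \<i> n \<kappa>\<^sub>n\<close>. Eliminating the nonresonant
  coefficients leaves two equations for \<open>H\<^sub>0\<close> and \<open>H\<^sub>-\<^sub>n\<close>. Since \<open>y\<^sub>2(0) = 0\<close>, the \<open>H\<^sub>k\<close> sum to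
  zero, so \<open>H\<^sub>-\<^sub>n / H\<^sub>0 = -1 + O(1/n)\<close>, and subtracting the two equations gives
  \<open>4 \<pi> \<i> n \<kappa>\<^sub>n = q\<^sub>-\<^sub>n - q\<^sub>n\<close> up to weighted convolutions of Fourier coefficients of \<open>q\<close>, which are
  \<open>\<ell>\<^sup>2\<close> with the required weight. A Rouche count localises \<open>\<mu>\<^sub>n\<close> uniformly on bounded sets; the
  finitely many small \<open>n\<close> are bounded directly.\<close>

section \<open>Solutions of the Schroedinger equation\<close>

text \<open>The diagonal entries of the reduced system are each only O(1/n), too large for the
  claimed remainder. They enter only through their difference, which a reflection symmetry makes
  O(|\<kappa>|); for large n it is absorbed by the left side 4 \<pi> \<i> n \<kappa>, so that n
  |\<kappa>| is controlled by the off-diagonal entries. These start with the coefficients of q at n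
  and -n, so the O(1/n) error of the ratio of resonant coefficients costs nothing. The quadratic
  terms receive the power N by distributing the weight over the two factors of the convolution, and
  the last power from n / |j (j + n)| \<le> 1/|j| + 1/|j + n|; what remains is a convolution of an
  l1 with an l2 sequence. Uniformity is a separate obstacle: bounded sets are measured by Fourier
  coefficients, the estimates for solutions by the L1 norm. The first has to dominate the second,
  which amounts to completeness of the exponentials. Dividing by exp ((\<kappa> + \<i> \<pi> n) x),
  and not by exp (\<kappa> x) alone, removes the sign (-1)^n as well; both parities then lead to
  integer frequencies, with resonances at 0 and -n.\<close>

lemma absolutely_integrable_mult_continuous:
  fixes f g :: "real \<Rightarrow> complex"
  assumes f: "f absolutely_integrable_on {a..b}" and g: "continuous_on {a..b} g"
  shows "(\<lambda>x. f x * g x) absolutely_integrable_on {a..b}"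
proof -
  have "(\<lambda>x. g x * f x) absolutely_integrable_on {a..b}"
    by (rule absolutely_integrable_bounded_measurable_product[OF bilinear_times _ _ _ f])
      (auto intro!: continuous_imp_measurable_on_sets_lebesgue g compact_imp_bounded compact_continuous_image)
  then show ?thesis by (simp add: mult.commute)
qed

lemma integral_diff_subinterval:
  fixes f :: "real \<Rightarrow> 'a::banach"
  assumes "f integrable_on {a..b}" "a \<le> c" "c \<le> d" "d \<le> b"
  shows "integral {a..d} f - integral {a..c} f = integral {c..d} f"
proof -
  have "f integrable_on {a..d}" using assms integrable_on_subinterval[OF assms(1)] by auto
  from Henstock_Kurzweil_Integration.integral_combine[OF assms(2,3) this] show ?thesis
    by (simp add: algebra_simps)
qed

text \<open>The two sides agree up to an additive function of subintervals that is
  \<open>o\<close> of the length, hence has derivative zero; no Fubini argument is needed.\<close>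

lemma integration_by_parts_absolutely_integrable:
  fixes f F g g' :: "real \<Rightarrow> complex"
  assumes f: "f absolutely_integrable_on {a..b}"
    and F: "\<And>x. x \<in> {a..b} \<Longrightarrow> F x = F a + integral {a..x} f"
    and g: "\<And>x. x \<in> {a..b} \<Longrightarrow> (g has_vector_derivative g' x) (at x within {a..b})"
    and g': "continuous_on {a..b} g'"
    and x: "x \<in> {a..b}"
  shows "integral {a..x} (\<lambda>t. f t * g t + F t * g' t) = F x * g x - F a * g a"
proof -
  define \<Phi> where "\<Phi> = (\<lambda>x. integral {a..x} (\<lambda>t. norm (f t)))"
  define h where "h = (\<lambda>t. f t * g t + F t * g' t)"
  define E where "E = (\<lambda>x. F x * g x - integral {a..x} h)"
  have fint: "f integrable_on {a..b}" and nfint: "(\<lambda>t. norm (f t)) integrable_on {a..b}"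
    using f unfolding absolutely_integrable_on_def by auto
  have gcont: "continuous_on {a..b} g"
    using g by (meson has_vector_derivative_continuous continuous_on_eq_continuous_within)
  have Fcont: "continuous_on {a..b} F"
    by (rule continuous_on_eq[of _ "\<lambda>x. F a + integral {a..x} f"])
      (auto intro!: continuous_intros indefinite_integral_continuous_1 fint simp: F[symmetric])
  have \<Phi>cont: "continuous_on {a..b} \<Phi>"
    unfolding \<Phi>_def by (intro indefinite_integral_continuous_1 nfint)
  have fg: "(\<lambda>t. f t * g t) absolutely_integrable_on {a..b}"
    by (rule absolutely_integrable_mult_continuous[OF f gcont])
  have Fg': "(\<lambda>t. F t * g' t) absolutely_integrable_on {a..b}"
    by (rule absolutely_integrable_mult_continuous[OF absolutely_integrable_continuous_real[OF Fcont] g'])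
  have hint: "h integrable_on {a..b}"
    unfolding h_def using fg Fg' by (intro integrable_add) (auto simp: absolutely_integrable_on_def)
  obtain L where L: "\<And>t. t \<in> {a..b} \<Longrightarrow> norm (g' t) \<le> L" "L > 0"
  proof -
    have "bounded (g' ` {a..b})" by (intro compact_imp_bounded compact_continuous_image g') auto
    then obtain L where L: "0 < L" "\<forall>y\<in>g' ` {a..b}. norm y \<le> L" unfolding bounded_pos by blast
    show ?thesis by (rule that[of L]) (use L in auto)
  qed
  have Lip: "norm (g y - g x) \<le> L * (y - x)" if "x \<in> {a..b}" "y \<in> {a..b}" "x \<le> y" for x y
  proof -
    have "(g' has_integral (g y - g x)) {x..y}"
      by (rule fundamental_theorem_of_calculus[OF that(3)])
        (use that in \<open>auto intro!: has_vector_derivative_within_subset[OF g]\<close>)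
    then have "norm (g y - g x) \<le> L * measure lborel (cbox x y)"
      by (intro has_integral_bound[of L g' "g y - g x" x y]) (use L that in \<open>auto\<close>)
    then show ?thesis using that by simp
  qed
  have \<Phi>d: "\<Phi> y - \<Phi> x = integral {x..y} (\<lambda>t. norm (f t))" if "x \<in> {a..b}" "y \<in> {a..b}" "x \<le> y" for x y
    unfolding \<Phi>_def using that by (intro integral_diff_subinterval[OF nfint]) auto
  have Fd: "F y - F x = integral {x..y} f" if "x \<in> {a..b}" "y \<in> {a..b}" "x \<le> y" for x y
    using integral_diff_subinterval[OF fint, of x y] that by (simp add: F[of x] F[of y])
  have Fb: "norm (F y - F x) \<le> \<Phi> y - \<Phi> x" if "x \<in> {a..b}" "y \<in> {a..b}" "x \<le> y" for x y
    unfolding Fd[OF that] \<Phi>d[OF that]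
    by (intro integral_norm_bound_integral)
      (use that in \<open>simp_all add: integrable_on_subinterval[OF fint] integrable_on_subinterval[OF nfint]\<close>)
  \<comment> \<open>With \<open>g\<close> frozen at \<open>y\<close> and \<open>F\<close> frozen at
    \<open>x\<close>, the integral of \<open>h\<close> over the subinterval would be exactly
    \<open>F y * g y - F x * g x\<close>. The freezing error is of the order of the length times the
    increment of \<open>\<Phi>\<close>.\<close>
  have key: "norm (E y - E x) \<le> 2 * L * (y - x) * (\<Phi> y - \<Phi> x)"
    if xy: "x \<in> {a..b}" "y \<in> {a..b}" "x \<le> y" for x y
  proof -
    have sub: "{x..y} \<subseteq> {a..b}" using xy by auto
    have i1: "f integrable_on {x..y}" "(\<lambda>t. norm (f t)) integrable_on {x..y}" "h integrable_on {x..y}"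
      using integrable_on_subinterval[OF fint sub] integrable_on_subinterval[OF nfint sub]
        integrable_on_subinterval[OF hint sub] by auto
    have ig': "(g' has_integral (g y - g x)) {x..y}"
      by (rule fundamental_theorem_of_calculus[OF xy(3)])
        (use xy in \<open>auto intro!: has_vector_derivative_within_subset[OF g]\<close>)
    have fgi: "((\<lambda>t. f t * g y) has_integral ((F y - F x) * g y)) {x..y}"
      using has_integral_mult_left[OF integrable_integral[OF i1(1)], of "g y"] Fd[OF xy] by simp
    have Fgi: "((\<lambda>t. F x * g' t) has_integral (F x * (g y - g x))) {x..y}"
      using has_integral_mult_right[OF ig'] .
    have "(F y - F x) * g y + F x * (g y - g x) - integral {x..y} h = E y - E x"
      unfolding E_def using integral_diff_subinterval[OF hint, of x y] xy by (auto simp: algebra_simps)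
    moreover have "((\<lambda>t. f t * g y + F x * g' t - h t) has_integral
        ((F y - F x) * g y + F x * (g y - g x) - integral {x..y} h)) {x..y}"
      by (intro has_integral_diff has_integral_add fgi Fgi integrable_integral i1)
    moreover have "(\<lambda>t. f t * g y + F x * g' t - h t) = (\<lambda>t. f t * (g y - g t) + (F x - F t) * g' t)"
      by (auto simp: h_def algebra_simps)
    ultimately have Ei: "((\<lambda>t. f t * (g y - g t) + (F x - F t) * g' t) has_integral (E y - E x)) {x..y}"
      by simp
    have "norm (E y - E x) \<le> integral {x..y} (\<lambda>t. L * (y - x) * norm (f t) + L * (\<Phi> y - \<Phi> x))"
      unfolding integral_unique[OF Ei, symmetric]
    proof (rule integral_norm_bound_integral)
      show "(\<lambda>t. f t * (g y - g t) + (F x - F t) * g' t) integrable_on {x..y}" using Ei by blast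
      show "(\<lambda>t. L * (y - x) * norm (f t) + L * (\<Phi> y - \<Phi> x)) integrable_on {x..y}"
        by (intro integrable_add integrable_on_mult_right i1) auto
      fix t assume t: "t \<in> {x..y}"
      have t': "t \<in> {a..b}" using t sub by auto
      have "norm (g y - g t) \<le> L * (y - x)"
        using order_trans[OF Lip[of t y] mult_left_mono[of "y - t" "y - x" L]] t t' xy L(2) by auto
      moreover have "norm (F x - F t) \<le> \<Phi> y - \<Phi> x"
        using Fb[of x t] t t' xy order_trans[OF norm_ge_zero Fb[of t y]] by (auto simp: norm_minus_commute)
      moreover have "norm (g' t) \<le> L" using L t' by auto
      ultimately have "norm (f t) * norm (g y - g t) + norm (F x - F t) * norm (g' t)
         \<le> norm (f t) * (L * (y - x)) + (\<Phi> y - \<Phi> x) * L"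
        using order_trans[OF norm_ge_zero Fb[OF xy]] by (intro add_mono mult_mono) auto
      then show "norm (f t * (g y - g t) + (F x - F t) * g' t) \<le> L * (y - x) * norm (f t) + L * (\<Phi> y - \<Phi> x)"
        by (intro order_trans[OF norm_triangle_ineq]) (simp add: norm_mult mult_ac)
    qed
    also have "\<dots> = 2 * L * (y - x) * (\<Phi> y - \<Phi> x)"
      using i1 xy by (subst integral_add) (auto simp: \<Phi>d[OF xy] intro!: integrable_on_mult_right)
    finally show ?thesis .
  qed
  have der: "(E has_derivative (\<lambda>h. 0)) (at x within {a..b})" if xab: "x \<in> {a..b}" for x
    unfolding has_derivative_within_alt
  proof (intro conjI allI impI bounded_linear_zero)
    fix e :: real assume "e > 0"
    then have "e / (2 * L) > 0" using L by simp
    then obtain d where d: "d > 0" "\<And>y. y \<in> {a..b} \<Longrightarrow> dist y x < d \<Longrightarrow> dist (\<Phi> y) (\<Phi> x) < e / (2 * L)"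
      using \<Phi>cont[unfolded continuous_on_iff, rule_format, OF xab] by blast
    show "\<exists>d>0. \<forall>y\<in>{a..b}. norm (y - x) < d \<longrightarrow> norm (E y - E x - 0) \<le> e * norm (y - x)"
    proof (intro exI[of _ d] conjI ballI impI)
      fix y assume y: "y \<in> {a..b}" "norm (y - x) < d"
      have D: "\<bar>\<Phi> y - \<Phi> x\<bar> \<le> e / (2 * L)" using d(2)[of y] y by (auto simp: dist_norm)
      have "norm (E y - E x) \<le> 2 * L * \<bar>y - x\<bar> * \<bar>\<Phi> y - \<Phi> x\<bar>"
      proof (cases "x \<le> y")
        case True
        have "norm (E y - E x) \<le> 2 * L * (y - x) * (\<Phi> y - \<Phi> x)" using key[OF that y(1) True] .
        also have "\<dots> \<le> 2 * L * \<bar>y - x\<bar> * \<bar>\<Phi> y - \<Phi> x\<bar>"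
          using True L(2) order_trans[OF norm_ge_zero Fb[OF that y(1) True]] by (intro mult_mono) auto
        finally show ?thesis .
      next
        case False
        have "norm (E x - E y) \<le> 2 * L * (x - y) * (\<Phi> x - \<Phi> y)" using key[OF y(1) that] False by simp
        also have "\<dots> \<le> 2 * L * \<bar>y - x\<bar> * \<bar>\<Phi> y - \<Phi> x\<bar>"
          using False L(2) order_trans[OF norm_ge_zero Fb[OF y(1) that]] by (intro mult_mono) auto
        finally show ?thesis by (simp add: norm_minus_commute)
      qed
      also have "\<dots> \<le> 2 * L * \<bar>y - x\<bar> * (e / (2 * L))"
        using D L(2) by (intro mult_left_mono) auto
      also have "\<dots> = e * norm (y - x)" using L(2) by (simp add: field_simps)
      finally show "norm (E y - E x - 0) \<le> e * norm (y - x)" by simp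
    qed (use d in auto)
  qed
  have "E x = E a"
  proof -
    have "\<exists>c. \<forall>x\<in>{a..b}. E x = c"
      by (rule has_derivative_zero_constant[of "{a..b}" E]) (use der in auto)
    then obtain c where "\<And>x. x \<in> {a..b} \<Longrightarrow> E x = c" by blast
    from this[of x] this[of a] show ?thesis using x by simp
  qed
  then show ?thesis by (simp add: E_def h_def algebra_simps)
qed

lemma integral_AE_eq:
  fixes f g :: "real \<Rightarrow> complex"
  assumes "AE x in lebesgue_on {a..b}. f x = g x" "S \<subseteq> {a..b}"
  shows "integral S f = integral S g"
proof -
  obtain N where N: "{x \<in> {a..b}. f x \<noteq> g x} \<subseteq> N" "N \<in> null_sets (lebesgue_on {a..b})"
    using assms(1) by (auto simp: eventually_ae_filter)
  have "negligible N"
    using N(2) by (simp add: negligible_iff_null_sets null_sets_restrict_space)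
  moreover have "g x = f x" if "x \<in> S - N" for x using N(1) assms(2) that by fastforce
  ultimately show ?thesis by (rule integral_spike)
qed

section \<open>Volterra integral equations\<close>

lemma volterra_growth_bound:
  fixes y p :: "real \<Rightarrow> complex"
  assumes p: "p absolutely_integrable_on {0..1}" and y: "continuous_on {0..1} y"
    and \<theta>: "\<theta> \<ge> 0" "\<theta> * integral {0..1} (\<lambda>t. norm (p t)) \<le> 1/2"
    and ineq: "\<And>x. x \<in> {0..1} \<Longrightarrow> norm (y x) \<le> A * exp (L * x)
       + \<theta> * integral {0..x} (\<lambda>t. exp (L * (x - t)) * (norm (p t) * norm (y t)))"
    and x: "x \<in> {0..1}"
  shows "norm (y x) \<le> 2 * A * exp (L * x)"
proof -
  define w where "w = (\<lambda>x. norm (y x) * exp (- (L * x)))"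
  have "continuous_on {0..1} w" unfolding w_def by (intro continuous_intros y)
  then obtain u where u: "u \<in> {0..1}" "\<And>t. t \<in> {0..1} \<Longrightarrow> w t \<le> w u"
    using continuous_attains_sup[of "{0..1::real}" w] by auto
  \<comment> \<open>A weighted maximum replaces Gronwall's inequality: the hypothesis at the
    maximiser \<open>u\<close> gives \<open>M \<le> A + M / 2\<close>, because
    \<open>\<theta>\<close> times the L1 norm of \<open>p\<close> is at most 1/2.\<close>
  define M where "M = w u"
  have yw: "norm (y t) \<le> M * exp (L * t)" if "t \<in> {0..1}" for t
  proof -
    have "norm (y t) = w t * exp (L * t)" by (simp add: w_def mult.assoc exp_add[symmetric])
    also have "\<dots> \<le> M * exp (L * t)" using u(2)[OF that] by (simp add: M_def)
    finally show ?thesis .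
  qed
  have M0: "M \<ge> 0" by (simp add: M_def w_def)
  have np: "(\<lambda>t. norm (p t)) integrable_on {0..1}" using p by (simp add: absolutely_integrable_on_def)
  have np': "(\<lambda>t. norm (p t)) integrable_on {0..u}" using u by (intro integrable_on_subinterval[OF np]) auto
  have py: "(\<lambda>t. p t * (y t * of_real (exp (L * (u - t))))) absolutely_integrable_on {0..1}"
    by (intro absolutely_integrable_mult_continuous p continuous_intros y)
  then have "(\<lambda>t. norm (p t * (y t * of_real (exp (L * (u - t)))))) integrable_on {0..1}"
    by (simp add: absolutely_integrable_on_def)
  then have int: "(\<lambda>t. exp (L * (u - t)) * (norm (p t) * norm (y t))) integrable_on {0..1}"
    by (simp add: norm_mult mult_ac)
  then have int': "(\<lambda>t. exp (L * (u - t)) * (norm (p t) * norm (y t))) integrable_on {0..u}"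
    using u by (intro integrable_on_subinterval[OF int]) auto
  have "integral {0..u} (\<lambda>t. exp (L * (u - t)) * (norm (p t) * norm (y t)))
     \<le> integral {0..u} (\<lambda>t. M * exp (L * u) * norm (p t))"
  proof (rule integral_le[OF int'])
    show "(\<lambda>t. M * exp (L * u) * norm (p t)) integrable_on {0..u}"
      using np' by (intro integrable_on_mult_right)
    fix t assume "t \<in> {0..u}"
    then have "exp (L * (u - t)) * (norm (p t) * norm (y t)) \<le> exp (L * (u - t)) * (norm (p t) * (M * exp (L * t)))"
      using u by (intro mult_left_mono yw) auto
    also have "\<dots> = M * (exp (L * (u - t)) * exp (L * t)) * norm (p t)" by (simp only: mult_ac)
    also have "exp (L * (u - t)) * exp (L * t) = exp (L * u)"
      by (simp add: exp_add[symmetric] algebra_simps)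
    finally show "exp (L * (u - t)) * (norm (p t) * norm (y t)) \<le> M * exp (L * u) * norm (p t)" .
  qed
  also have "\<dots> = M * exp (L * u) * integral {0..u} (\<lambda>t. norm (p t))" by simp
  also have "\<dots> \<le> M * exp (L * u) * integral {0..1} (\<lambda>t. norm (p t))"
    using M0 u np np' by (intro mult_left_mono integral_subset_le) auto
  finally have "\<theta> * integral {0..u} (\<lambda>t. exp (L * (u - t)) * (norm (p t) * norm (y t)))
      \<le> \<theta> * (M * exp (L * u) * integral {0..1} (\<lambda>t. norm (p t)))"
    using \<theta>(1) by (rule mult_left_mono)
  also have "\<dots> = M * exp (L * u) * (\<theta> * integral {0..1} (\<lambda>t. norm (p t)))" by simp
  also have "\<dots> \<le> M * exp (L * u) * (1/2)" using M0 \<theta> by (intro mult_left_mono) auto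
  finally have "norm (y u) \<le> (A + M / 2) * exp (L * u)" using ineq[OF u(1)] by (simp add: algebra_simps)
  then have "M \<le> (A + M / 2) * exp (L * u) * exp (- (L * u))"
    unfolding M_def w_def by (intro mult_right_mono) auto
  also have "\<dots> = A + M / 2" by (simp add: mult.assoc exp_add[symmetric])
  finally have "M \<le> 2 * A" by simp
  then have "M * exp (L * x) \<le> 2 * A * exp (L * x)" by (intro mult_right_mono) auto
  with yw[OF x] show ?thesis by linarith
qed

lemma le_exp_div:
  fixes s K :: real
  assumes "K > 0" shows "s \<le> exp (K * s) / K"
proof -
  have "s * K \<le> exp (K * s)" using exp_ge_add_one_self[of "K * s"] by (subst mult.commute) linarith
  then show ?thesis using assms by (simp add: le_divide_eq)
qed

lemma continuous_on_kernel_integral: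
  fixes p g :: "real \<Rightarrow> complex"
  assumes p: "p absolutely_integrable_on {0..1}" and g: "continuous_on {0..1} g"
  shows "continuous_on {0..1} (\<lambda>x. integral {0..x} (\<lambda>t. of_real (x - t) * (p t * g t)))"
proof -
  have i: "(\<lambda>t. p t * g t) absolutely_integrable_on {0..1}"
    by (rule absolutely_integrable_mult_continuous[OF p g])
  have i1: "(\<lambda>t. p t * g t) integrable_on {0..1}" using i by (simp add: absolutely_integrable_on_def)
  have "(\<lambda>t. (p t * g t) * of_real t) absolutely_integrable_on {0..1}"
    by (intro absolutely_integrable_mult_continuous i continuous_intros)
  then have i2: "(\<lambda>t. of_real t * (p t * g t)) integrable_on {0..1}"
    by (simp add: absolutely_integrable_on_def mult_ac)
  have "continuous_on {0..1} (\<lambda>x. of_real x * integral {0..x} (\<lambda>t. p t * g t)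
      - integral {0..x} (\<lambda>t. of_real t * (p t * g t)))"
    by (intro continuous_intros indefinite_integral_continuous_1 i1 i2)
  moreover have "integral {0..x} (\<lambda>t. of_real (x - t) * (p t * g t))
      = of_real x * integral {0..x} (\<lambda>t. p t * g t) - integral {0..x} (\<lambda>t. of_real t * (p t * g t))"
    if "x \<in> {0..1}" for x
  proof -
    have "integral {0..x} (\<lambda>t. of_real (x - t) * (p t * g t))
      = integral {0..x} (\<lambda>t. of_real x * (p t * g t) - of_real t * (p t * g t))"
      by (simp add: left_diff_distrib)
    also have "\<dots> = integral {0..x} (\<lambda>t. of_real x * (p t * g t)) - integral {0..x} (\<lambda>t. of_real t * (p t * g t))"
      using that by (intro integral_diff integrable_on_mult_right integrable_on_subinterval[OF i1]
          integrable_on_subinterval[OF i2]) auto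
    finally show ?thesis by simp
  qed
  ultimately show ?thesis by (rule continuous_on_eq[OF _ sym])
qed

text \<open>After the substitution \<open>y x = exp (K * x) * w x\<close> the Volterra operator
  itself is a contraction, without passing to iterates: the kernel \<open>x - t\<close> is at most
  \<open>exp (K * (x - t)) / K\<close>, so the Lipschitz constant is \<open>I / K\<close>.\<close>

lemma volterra_exists:
  fixes p :: "real \<Rightarrow> complex"
  assumes p: "p absolutely_integrable_on {0..1}"
  obtains y where "continuous_on {0..1} y"
    "\<And>x. x \<in> {0..1} \<Longrightarrow> y x = c0 + c1 * of_real x + integral {0..x} (\<lambda>t. of_real (x - t) * (p t * y t))"
proof -
  define I where "I = integral {0..1} (\<lambda>t. norm (p t))"
  have I0: "I \<ge> 0" using p by (auto simp: I_def absolutely_integrable_on_def intro!: integral_nonneg)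
  define K where "K = 2 * (1 + I)"
  have K: "K > 0" "I / K \<le> 1/2" using I0 by (auto simp: K_def field_simps)
  \<comment> \<open>Clamping the argument extends functions from the unit interval to the line, so
    that the complete space of bounded continuous functions on the reals can be used.\<close>
  define cl where "cl = (\<lambda>x::real. min 1 (max 0 x))"
  have cl: "cl x \<in> {0..1}" "x \<in> {0..1} \<Longrightarrow> cl x = x" for x by (auto simp: cl_def)
  have clc: "continuous_on UNIV cl" unfolding cl_def by (intro continuous_intros)
  define T where "T = (\<lambda>w x. of_real (exp (- (K * x))) * (c0 + c1 * of_real x
     + integral {0..x} (\<lambda>t. of_real (x - t) * (p t * (of_real (exp (K * t)) * w t)))) :: complex)"
  have Tc: "continuous_on {0..1} (T w)" if "continuous_on {0..1} w" for w
    unfolding T_def by (intro continuous_intros continuous_on_kernel_integral p that)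
  define TT where "TT = (\<lambda>w :: real \<Rightarrow>\<^sub>C complex. Bcontfun (\<lambda>x. T (apply_bcontfun w) (cl x)))"
  have TTa: "apply_bcontfun (TT w) = (\<lambda>x. T (apply_bcontfun w) (cl x))" for w
  proof -
    have c: "continuous_on {0..1} (T (apply_bcontfun w))" by (intro Tc) auto
    have "bounded (T (apply_bcontfun w) ` {0..1})" by (intro compact_imp_bounded compact_continuous_image c) auto
    then obtain B where B: "\<forall>y\<in>T (apply_bcontfun w) ` {0..1}. norm y \<le> B" unfolding bounded_iff by blast
    have "continuous_on UNIV (\<lambda>x. T (apply_bcontfun w) (cl x))"
      by (rule continuous_on_compose2[OF c clc]) (use cl(1) in blast)
    moreover have "norm (T (apply_bcontfun w) (cl x)) \<le> B" for x using B cl(1)[of x] by blast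
    ultimately have "(\<lambda>x. T (apply_bcontfun w) (cl x)) \<in> bcontfun"
      by (rule bcontfun_normI)
    then show ?thesis by (simp add: TT_def Bcontfun_inverse)
  qed
  have lip: "dist (TT v) (TT w) \<le> 1/2 * dist v w" for v w
  proof (rule dist_bound)
    fix x0
    define x where "x = cl x0"
    have x: "x \<in> {0..1}" using cl by (simp add: x_def)
    let ?g = "\<lambda>w t. of_real (x - t) * (p t * (of_real (exp (K * t)) * apply_bcontfun w t))"
    have gi: "?g w integrable_on {0..x}" for w
    proof -
      have "(\<lambda>t. p t * (of_real (x - t) * (of_real (exp (K * t)) * apply_bcontfun w t))) absolutely_integrable_on {0..1}"
        by (intro absolutely_integrable_mult_continuous p continuous_intros) auto
      then have "?g w integrable_on {0..1}" by (simp add: absolutely_integrable_on_def mult_ac)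
      then show ?thesis by (rule integrable_on_subinterval) (use x in auto)
    qed
    have np: "(\<lambda>t. norm (p t)) integrable_on {0..1}" using p by (simp add: absolutely_integrable_on_def)
    have np': "(\<lambda>t. norm (p t)) integrable_on {0..x}" using x by (intro integrable_on_subinterval[OF np]) auto
    have "integral {0..x} (?g v) - integral {0..x} (?g w) = integral {0..x} (\<lambda>t. ?g v t - ?g w t)"
      by (rule integral_diff[symmetric]) (rule gi)+
    then have "dist (apply_bcontfun (TT v) x0) (apply_bcontfun (TT w) x0)
       = exp (- (K * x)) * norm (integral {0..x} (\<lambda>t. ?g v t - ?g w t))"
      by (simp add: TTa x_def[symmetric] T_def dist_norm right_diff_distrib[symmetric] norm_mult del: of_real_exp)
    also have "\<dots> \<le> exp (- (K * x)) * integral {0..x} (\<lambda>t. exp (K * x) / K * dist v w * norm (p t))"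
    proof (intro mult_left_mono integral_norm_bound_integral)
      show "(\<lambda>t. ?g v t - ?g w t) integrable_on {0..x}" by (intro integrable_diff gi)
      show "(\<lambda>t. exp (K * x) / K * dist v w * norm (p t)) integrable_on {0..x}"
        by (intro integrable_on_mult_right np')
      fix t assume t: "t \<in> {0..x}"
      have "?g v t - ?g w t = of_real (x - t) * (p t * (of_real (exp (K * t)) * (apply_bcontfun v t - apply_bcontfun w t)))"
        by (simp add: algebra_simps)
      then have "norm (?g v t - ?g w t) = (x - t) * (norm (p t) * (exp (K * t) * dist (apply_bcontfun v t) (apply_bcontfun w t)))"
        using t by (simp add: norm_mult dist_norm del: of_real_diff of_real_exp)
      also have "\<dots> \<le> (exp (K * (x - t)) / K) * (norm (p t) * (exp (K * t) * dist v w))"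
        using t K by (intro mult_mono le_exp_div dist_bounded) auto
      also have "\<dots> = exp (K * x) / K * dist v w * norm (p t)"
        by (simp add: mult_ac exp_diff right_diff_distrib)
      finally show "norm (?g v t - ?g w t) \<le> exp (K * x) / K * dist v w * norm (p t)" .
    qed auto
    also have "\<dots> = dist v w / K * integral {0..x} (\<lambda>t. norm (p t))"
      by (simp add: exp_minus field_simps)
    also have "\<dots> \<le> dist v w / K * I"
      unfolding I_def using K x np np' by (intro mult_left_mono integral_subset_le) auto
    also have "\<dots> = I / K * dist v w" by simp
    also have "\<dots> \<le> 1/2 * dist v w" using K by (intro mult_right_mono) auto
    finally show "dist (apply_bcontfun (TT v) x0) (apply_bcontfun (TT w) x0) \<le> 1/2 * dist v w" .
  qed
  obtain w where w: "TT w = w" using banach_fix_type[of "1/2" TT] lip by auto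
  define y where "y = (\<lambda>x. of_real (exp (K * x)) * apply_bcontfun w x)"
  show ?thesis
  proof (rule that)
    show "continuous_on {0..1} y" unfolding y_def by (intro continuous_intros) auto
    fix x :: real assume "x \<in> {0..1}"
    then have "apply_bcontfun w x = T (apply_bcontfun w) x" using TTa[of w] w cl(2)[of x] by (metis)
    then have "y x = of_real (exp (K * x)) * T (apply_bcontfun w) x" by (simp add: y_def)
    also have "\<dots> = c0 + c1 * of_real x + integral {0..x} (\<lambda>t. of_real (x - t) * (p t * y t))"
      unfolding T_def y_def by (simp add: mult.assoc[symmetric] flip: of_real_mult exp_add)
    finally show "y x = c0 + c1 * of_real x + integral {0..x} (\<lambda>t. of_real (x - t) * (p t * y t))" .
  qed
qed

section \<open>The differential equation and its Volterra form\<close>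

lemma absolutely_integrable_on_shift:
  fixes q :: "real \<Rightarrow> complex"
  assumes "q absolutely_integrable_on {0..1}"
  shows "(\<lambda>t. q t - \<nu>) absolutely_integrable_on {0..1}"
  using assms by (intro set_integral_diff) auto

lemma schroedinger_solutionD:
  assumes q: "q absolutely_integrable_on {0..1}" and sol: "schroedinger_solution q \<nu> y y'"
  shows "\<And>x. x \<in> {0..1} \<Longrightarrow> (y has_vector_derivative y' x) (at x within {0..1})"
    and "continuous_on {0..1} y" and "continuous_on {0..1} y'"
    and "(\<lambda>t. (q t - \<nu>) * y t) absolutely_integrable_on {0..1}"
    and "\<And>x. x \<in> {0..1} \<Longrightarrow> y' x = y' 0 + integral {0..x} (\<lambda>t. (q t - \<nu>) * y t)"
proof -
  show der: "\<And>x. x \<in> {0..1} \<Longrightarrow> (y has_vector_derivative y' x) (at x within {0..1})"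
    using sol by (auto simp: schroedinger_solution_def)
  then show yc: "continuous_on {0..1} y"
    by (meson has_vector_derivative_continuous continuous_on_eq_continuous_within)
  obtain y'' where y'': "y'' absolutely_integrable_on {0..1}"
    "\<And>x. x \<in> {0..1} \<Longrightarrow> y' x = y' 0 + integral {0..x} y''"
    "AE x in lebesgue_on {0..1}. - y'' x + q x * y x = \<nu> * y x"
    using sol unfolding schroedinger_solution_def by blast
  show int: "(\<lambda>t. (q t - \<nu>) * y t) absolutely_integrable_on {0..1}"
    by (intro absolutely_integrable_mult_continuous absolutely_integrable_on_shift q yc)
  have ae: "AE x in lebesgue_on {0..1}. y'' x = (q x - \<nu>) * y x"
    using y''(3) by eventually_elim (simp add: algebra_simps)
  show y': "y' x = y' 0 + integral {0..x} (\<lambda>t. (q t - \<nu>) * y t)" if "x \<in> {0..1}" for x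
    using y''(2)[OF that] integral_AE_eq[OF ae, of "{0..x}"] that by auto
  show "continuous_on {0..1} y'"
    by (rule continuous_on_eq[OF _ y'[symmetric]])
      (use int in \<open>auto intro!: continuous_intros indefinite_integral_continuous_1 simp: absolutely_integrable_on_def\<close>)
qed

text \<open>With \<open>w = 0\<close> this is the Volterra equation with kernel \<open>x - t\<close>; with \<open>w = \<nu>\<close> the
  free operator is inverted exactly and only \<open>q\<close> remains under the integral.\<close>

lemma schroedinger_solution_variation_of_constants:
  fixes S C :: "real \<Rightarrow> complex"
  assumes q: "q absolutely_integrable_on {0..1}" and sol: "schroedinger_solution q \<nu> y y'"
    and S: "\<And>s. (S has_vector_derivative C s) (at s)" and C: "\<And>s. (C has_vector_derivative - w * S s) (at s)"
    and S0: "S 0 = 0" "C 0 = 1" and x: "x \<in> {0..1}"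
  shows "y x = y 0 * C x + y' 0 * S x + integral {0..x} (\<lambda>t. S (x - t) * ((q t - \<nu> + w) * y t))"
proof -
  note D = schroedinger_solutionD[OF q sol]
  have Sc: "continuous_on A S" for A
    using S by (meson has_vector_derivative_continuous continuous_at_imp_continuous_on)
  have Cc: "continuous_on A C" for A
    using C by (meson has_vector_derivative_continuous continuous_at_imp_continuous_on)
  have shift: "((\<lambda>t. x - t) has_vector_derivative -1) (at t within {0..1})" for t :: real
    by (auto intro!: derivative_eq_intros)
  have gS: "((\<lambda>t. S (x - t)) has_vector_derivative - C (x - t)) (at t within {0..1})" for t
    using vector_diff_chain_within[OF shift[of t], of S "C (x - t)"] S[of "x - t"]
    by (auto simp: o_def intro: has_vector_derivative_at_within)
  have gC: "((\<lambda>t. C (x - t)) has_vector_derivative w * S (x - t)) (at t within {0..1})" for t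
    using vector_diff_chain_within[OF shift[of t], of C "- w * S (x - t)"] C[of "x - t"]
    by (auto simp: o_def intro: has_vector_derivative_at_within)
  have Sxc: "continuous_on A (\<lambda>t. S (x - t))" and Cxc: "continuous_on A (\<lambda>t. C (x - t))" for A
    by (rule continuous_on_compose2[OF Sc[of UNIV]] continuous_on_compose2[OF Cc[of UNIV]],
        auto intro!: continuous_intros)+
  \<comment> \<open>Two integrations by parts move the derivatives from \<open>y\<close> to the
    kernel; in the sum of \<open>I1\<close> and \<open>I2\<close> the terms with
    \<open>y' t * C (x - t)\<close> cancel.\<close>
  have I1: "integral {0..x} (\<lambda>t. (q t - \<nu>) * y t * S (x - t) + y' t * (- C (x - t))) = y' x * S (x - x) - y' 0 * S (x - 0)"
    by (rule integration_by_parts_absolutely_integrable[OF D(4) D(5) gS _ x])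
      (auto intro!: continuous_intros Cxc)
  have y'i: "y' absolutely_integrable_on {0..1}" by (rule absolutely_integrable_continuous_real[OF D(3)])
  have ftc: "y x = y 0 + integral {0..x} y'" if "x \<in> {0..1}" for x
  proof -
    have "(y' has_integral y x - y 0) {0..x}"
      by (rule fundamental_theorem_of_calculus)
        (use that in \<open>auto intro!: has_vector_derivative_within_subset[OF D(1)]\<close>)
    then show ?thesis by (simp add: integral_unique)
  qed
  have I2: "integral {0..x} (\<lambda>t. y' t * C (x - t) + y t * (w * S (x - t))) = y x * C (x - x) - y 0 * C (x - 0)"
  proof (rule integration_by_parts_absolutely_integrable[where F = y and g = "\<lambda>t. C (x - t)" and g' = "\<lambda>t. w * S (x - t)"])
    show "continuous_on {0..1} (\<lambda>t. w * S (x - t))" by (intro continuous_intros Sxc)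
  qed (rule y'i ftc gC x | assumption)+
  have sub: "f integrable_on {0..x}" if "f absolutely_integrable_on {0..1}" for f :: "real \<Rightarrow> complex"
    by (rule integrable_on_subinterval[of f "{0..1}"]) (use that x in \<open>auto simp: absolutely_integrable_on_def\<close>)
  have i: "(\<lambda>t. (q t - \<nu>) * y t * S (x - t)) absolutely_integrable_on {0..1}"
    "(\<lambda>t. y' t * (- C (x - t))) absolutely_integrable_on {0..1}"
    "(\<lambda>t. y' t * C (x - t)) absolutely_integrable_on {0..1}"
    "(\<lambda>t. y t * (w * S (x - t))) absolutely_integrable_on {0..1}"
    by (intro absolutely_integrable_mult_continuous D(4) y'i absolutely_integrable_continuous_real D(2)
        continuous_intros Sxc Cxc)+
  have "integral {0..x} (\<lambda>t. ((q t - \<nu>) * y t * S (x - t) + y' t * (- C (x - t)))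
      + (y' t * C (x - t) + y t * (w * S (x - t)))) = (y' x * S (x - x) - y' 0 * S (x - 0)) + (y x * C (x - x) - y 0 * C (x - 0))"
    unfolding I1[symmetric] I2[symmetric] by (intro integral_add integrable_add sub i)
  moreover have "(\<lambda>t. ((q t - \<nu>) * y t * S (x - t) + y' t * (- C (x - t)))
      + (y' t * C (x - t) + y t * (w * S (x - t)))) = (\<lambda>t. S (x - t) * ((q t - \<nu> + w) * y t))"
    by (auto simp: algebra_simps)
  ultimately show ?thesis by (simp add: S0 algebra_simps)
qed

lemma schroedinger_solution_volterra:
  assumes q: "q absolutely_integrable_on {0..1}" and sol: "schroedinger_solution q \<nu> y y'"
    and x: "x \<in> {0..1}"
  shows "y x = y 0 + y' 0 * of_real x + integral {0..x} (\<lambda>t. of_real (x - t) * ((q t - \<nu>) * y t))"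
proof -
  have "(complex_of_real has_vector_derivative 1) (at s)" for s
    unfolding has_vector_derivative_def
    by (auto intro!: derivative_eq_intros simp: scaleR_conv_of_real)
  then show ?thesis
    using schroedinger_solution_variation_of_constants[OF q sol, of of_real "\<lambda>_. 1" 0 x] x by simp
qed

text \<open>Integrating by parts against \<open>x - t\<close> turns the equation into
  \<open>y\<close> being the primitive of \<open>c1 + F\<close>. Since \<open>F\<close>, itself a
  primitive of an integrable function, is continuous, \<open>y\<close> is differentiable everywhere
  and not only almost everywhere.\<close>

lemma schroedinger_solutionI:
  fixes q :: "real \<Rightarrow> complex"
  assumes q: "q absolutely_integrable_on {0..1}" and y: "continuous_on {0..1} y"
    and eq: "\<And>x. x \<in> {0..1} \<Longrightarrow> y x = c0 + c1 * of_real x + integral {0..x} (\<lambda>t. of_real (x - t) * ((q t - \<nu>) * y t))"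
  shows "schroedinger_solution q \<nu> y (\<lambda>x. c1 + integral {0..x} (\<lambda>t. (q t - \<nu>) * y t))"
proof -
  define f where "f = (\<lambda>t. (q t - \<nu>) * y t)"
  define F where "F = (\<lambda>x. integral {0..x} f)"
  have f: "f absolutely_integrable_on {0..1}"
    unfolding f_def by (intro absolutely_integrable_mult_continuous absolutely_integrable_on_shift q y)
  then have fi: "f integrable_on {0..1}" by (simp add: absolutely_integrable_on_def)
  have Fc: "continuous_on {0..1} F" unfolding F_def by (intro indefinite_integral_continuous_1 fi)
  have "y x = c0 + integral {0..x} (\<lambda>t. c1 + F t)" if x: "x \<in> {0..1}" for x
  proof -
    have "integral {0..x} (\<lambda>t. f t * of_real (x - t) + F t * (-1)) = F x * of_real (x - x) - F 0 * of_real (x - 0)"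
      by (rule integration_by_parts_absolutely_integrable[OF f, of F "\<lambda>t. of_real (x - t)" "\<lambda>_. -1" x])
        (use x in \<open>auto simp: F_def intro!: derivative_eq_intros\<close>)
    then have 1: "integral {0..x} (\<lambda>t. f t * of_real (x - t) + F t * (-1)) = 0" by (simp add: F_def)
    have "(\<lambda>t. f t * of_real (x - t)) absolutely_integrable_on {0..1}"
      by (intro absolutely_integrable_mult_continuous f continuous_intros)
    then have "(\<lambda>t. f t * of_real (x - t)) integrable_on {0..1}" by (simp add: absolutely_integrable_on_def)
    then have i1: "(\<lambda>t. f t * of_real (x - t)) integrable_on {0..x}"
      by (rule integrable_on_subinterval) (use x in auto)
    have i2: "F integrable_on {0..x}"
      using x by (intro integrable_continuous_real continuous_on_subset[OF Fc]) auto
    have "integral {0..x} (\<lambda>t. f t * of_real (x - t)) - integral {0..x} F = 0"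
      using 1 i1 i2 by (simp add: integral_diff del: of_real_diff)
    moreover have "integral {0..x} (\<lambda>t. c1 + F t) = c1 * of_real x + integral {0..x} F"
      using i2 x by (subst integral_add) (auto simp: scaleR_conv_of_real)
    ultimately show ?thesis using eq[OF x] by (simp add: f_def mult_ac del: of_real_diff)
  qed
  note yF = this
  have "(y has_vector_derivative (c1 + F x)) (at x within {0..1})" if "x \<in> {0..1}" for x
  proof -
    have "((\<lambda>u. integral {0..u} (\<lambda>t. c1 + F t)) has_vector_derivative (c1 + F x)) (at x within {0..1})"
      by (rule integral_has_vector_derivative[OF _ that]) (intro continuous_intros Fc)
    then have "((\<lambda>u. c0 + integral {0..u} (\<lambda>t. c1 + F t)) has_vector_derivative (c1 + F x)) (at x within {0..1})"
      by (auto intro!: derivative_eq_intros)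
    then show ?thesis by (rule has_vector_derivative_transform[OF that yF, rotated -1])
  qed
  moreover have "AE x in lebesgue_on {0..1}. - f x + q x * y x = \<nu> * y x"
    by (simp add: f_def algebra_simps)
  ultimately show ?thesis
    unfolding schroedinger_solution_def f_def[symmetric] using f
    by (auto simp: F_def[symmetric] intro!: exI[of _ f]) (auto simp: F_def)
qed

lemma schroedinger_solution_exists:
  assumes q: "q absolutely_integrable_on {0..1}"
  shows "\<exists>y y'. schroedinger_solution q \<nu> y y' \<and> y 0 = c0 \<and> y' 0 = c1"
proof -
  obtain y where y: "continuous_on {0..1} y"
    "\<And>x. x \<in> {0..1} \<Longrightarrow> y x = c0 + c1 * of_real x + integral {0..x} (\<lambda>t. of_real (x - t) * ((q t - \<nu>) * y t))"
    using volterra_exists[OF absolutely_integrable_on_shift[OF q]] by blast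
  show ?thesis
    using schroedinger_solutionI[OF q y] y(2)[of 0]
    by (intro exI[of _ y] exI[of _ "\<lambda>x. c1 + integral {0..x} (\<lambda>t. (q t - \<nu>) * y t)"]) auto
qed

section \<open>A priori bounds for solutions\<close>

definition L1_norm :: "(real \<Rightarrow> complex) \<Rightarrow> real" where
  "L1_norm q = integral {0..1} (\<lambda>t. norm (q t))"

lemma L1_norm_nonneg: "q absolutely_integrable_on {0..1} \<Longrightarrow> 0 \<le> L1_norm q"
  unfolding L1_norm_def by (rule integral_nonneg) (auto simp: absolutely_integrable_on_def)

lemma L1_norm_shift_le:
  assumes "q absolutely_integrable_on {0..1}"
  shows "L1_norm (\<lambda>t. q t - \<nu>) \<le> L1_norm q + norm \<nu>"
proof -
  have q: "(\<lambda>t. norm (q t)) integrable_on {0..1}" using assms by (simp add: absolutely_integrable_on_def)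
  have "L1_norm (\<lambda>t. q t - \<nu>) \<le> integral {0..1} (\<lambda>t. norm (q t) + norm \<nu>)"
    unfolding L1_norm_def
    using absolutely_integrable_on_shift[OF assms, of \<nu>] q
    by (intro integral_le integrable_add norm_triangle_ineq4) (auto simp: absolutely_integrable_on_def)
  also have "\<dots> = L1_norm q + norm \<nu>"
    unfolding L1_norm_def using q by (subst integral_add) auto
  finally show ?thesis .
qed

text \<open>The growth bound is applied with \<open>\<theta> = 1 / K\<close> and \<open>L = K\<close>, because \<open>s \<le> exp (K s) / K\<close>.\<close>

lemma volterra_sup_bound:
  fixes y p :: "real \<Rightarrow> complex"
  assumes p: "p absolutely_integrable_on {0..1}" "L1_norm p \<le> R" and y: "continuous_on {0..1} y"
    and A: "A \<ge> 0" and ineq: "\<And>x. x \<in> {0..1} \<Longrightarrow> norm (y x) \<le> A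
       + integral {0..x} (\<lambda>t. (x - t) * (norm (p t) * norm (y t)))"
    and x: "x \<in> {0..1}"
  shows "norm (y x) \<le> 2 * A * exp (2 * (1 + R))"
proof -
  define K where "K = 2 * (1 + R)"
  have R: "R \<ge> 0" using L1_norm_nonneg[OF p(1)] p(2) by simp
  then have K: "K > 0" by (simp add: K_def)
  have "norm (y x) \<le> 2 * A * exp (K * x)"
  proof (rule volterra_growth_bound[OF p(1) y _ _ _ x])
    show "1 / K \<ge> 0" using K by simp
    show "1 / K * integral {0..1} (\<lambda>t. norm (p t)) \<le> 1/2"
      using p(2) R by (simp add: K_def L1_norm_def divide_simps)
    fix x :: real assume x: "x \<in> {0..1}"
    have c: "(\<lambda>t. p t * (y t * of_real (g t))) absolutely_integrable_on {0..1}"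
      if "continuous_on {0..1} g" for g :: "real \<Rightarrow> real"
      by (intro absolutely_integrable_mult_continuous p continuous_intros y that)
    have i: "(\<lambda>t. g t * (norm (p t) * norm (y t))) integrable_on {0..x}"
      if g: "continuous_on {0..1} g" "\<And>t. t \<in> {0..x} \<Longrightarrow> 0 \<le> g t" for g :: "real \<Rightarrow> real"
    proof -
      have "(\<lambda>t. norm (p t * (y t * of_real (g t)))) integrable_on {0..1}"
        using c[OF g(1)] by (simp add: absolutely_integrable_on_def)
      then have "(\<lambda>t. norm (p t * (y t * of_real (g t)))) integrable_on {0..x}"
        by (rule integrable_on_subinterval) (use x in auto)
      moreover have "norm (p t * (y t * of_real (g t))) = g t * (norm (p t) * norm (y t))" if "t \<in> {0..x}" for t
        using g(2)[OF that] by (simp add: norm_mult)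
      ultimately show ?thesis by (rule integrable_eq)
    qed
    have "norm (y x) \<le> A + integral {0..x} (\<lambda>t. (x - t) * (norm (p t) * norm (y t)))" using ineq x by blast
    also have "integral {0..x} (\<lambda>t. (x - t) * (norm (p t) * norm (y t)))
        \<le> integral {0..x} (\<lambda>t. exp (K * (x - t)) / K * (norm (p t) * norm (y t)))"
      using K by (intro integral_le i mult_right_mono le_exp_div) (auto intro!: continuous_intros)
    also have "\<dots> = 1 / K * integral {0..x} (\<lambda>t. exp (K * (x - t)) * (norm (p t) * norm (y t)))" by simp
    also have "A \<le> A * exp (K * x)" using A K x by (simp add: mult_le_cancel_left1)
    finally show "norm (y x) \<le> A * exp (K * x) + 1 / K * integral {0..x} (\<lambda>t. exp (K * (x - t)) * (norm (p t) * norm (y t)))"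
      by simp
  qed
  also have "\<dots> \<le> 2 * A * exp K" using A x K by (intro mult_left_mono) (auto simp: mult_le_cancel_left1)
  finally show ?thesis by (simp add: K_def)
qed

lemma integral_mult_kernel_le:
  fixes p y k :: "real \<Rightarrow> complex"
  assumes p: "p absolutely_integrable_on {0..1}" and y: "continuous_on {0..1} y" and k: "continuous_on {0..1} k"
    and b: "continuous_on {0..1} b" "\<And>t. t \<in> {0..x} \<Longrightarrow> norm (k t) \<le> b t" and x: "x \<in> {0..1}"
  shows "norm (integral {0..x} (\<lambda>t. k t * (p t * y t))) \<le> integral {0..x} (\<lambda>t. b t * (norm (p t) * norm (y t)))"
proof (rule integral_norm_bound_integral)
  have "(\<lambda>t. p t * (y t * k t)) absolutely_integrable_on {0..1}"
    by (intro absolutely_integrable_mult_continuous p continuous_intros y k)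
  then have "(\<lambda>t. k t * (p t * y t)) integrable_on {0..1}" by (simp add: absolutely_integrable_on_def mult_ac)
  then show "(\<lambda>t. k t * (p t * y t)) integrable_on {0..x}"
    by (rule integrable_on_subinterval) (use x in auto)
  have "(\<lambda>t. norm (p t * (y t * of_real (b t)))) integrable_on {0..1}"
    using absolutely_integrable_mult_continuous[OF p continuous_on_mult[OF y continuous_on_of_real[OF b(1)]]]
    by (simp add: absolutely_integrable_on_def)
  then have "(\<lambda>t. norm (p t * (y t * of_real (b t)))) integrable_on {0..x}"
    by (rule integrable_on_subinterval) (use x in auto)
  moreover have "norm (p t * (y t * of_real (b t))) = b t * (norm (p t) * norm (y t))" if "t \<in> {0..x}" for t
    using order_trans[OF norm_ge_zero b(2)[OF that]] by (simp add: norm_mult)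
  ultimately show "(\<lambda>t. b t * (norm (p t) * norm (y t))) integrable_on {0..x}" by (rule integrable_eq)
  show "norm (k t * (p t * y t)) \<le> b t * (norm (p t) * norm (y t))" if "t \<in> {0..x}" for t
    using b(2)[OF that] by (simp add: norm_mult mult_right_mono)
qed

lemma schroedinger_solution_bound:
  assumes q: "q absolutely_integrable_on {0..1}" and sol: "schroedinger_solution q \<nu> y y'"
    and R: "L1_norm q + norm \<nu> \<le> R" and x: "x \<in> {0..1}"
  shows "norm (y x) \<le> 2 * (norm (y 0) + norm (y' 0)) * exp (2 * (1 + R))"
proof (rule volterra_sup_bound[OF absolutely_integrable_on_shift[OF q] _ schroedinger_solutionD(2)[OF q sol] _ _ x])
  show "L1_norm (\<lambda>t. q t - \<nu>) \<le> R" using L1_norm_shift_le[OF q, of \<nu>] R by simp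
  fix x :: real assume x: "x \<in> {0..1}"
  have "norm (y x) \<le> norm (y 0 + y' 0 * of_real x) + norm (integral {0..x} (\<lambda>t. of_real (x - t) * ((q t - \<nu>) * y t)))"
    using schroedinger_solution_volterra[OF q sol x] norm_triangle_ineq by metis
  also have "norm (y 0 + y' 0 * of_real x) \<le> norm (y 0) + norm (y' 0)"
    using x by (intro order_trans[OF norm_triangle_ineq] add_left_mono) (auto simp: norm_mult mult_left_le)
  also have "norm (integral {0..x} (\<lambda>t. of_real (x - t) * ((q t - \<nu>) * y t)))
     \<le> integral {0..x} (\<lambda>t. (x - t) * (norm (q t - \<nu>) * norm (y t)))"
    by (rule integral_mult_kernel_le[OF absolutely_integrable_on_shift[OF q] schroedinger_solutionD(2)[OF q sol] _ _ _ x])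
      (auto intro!: continuous_intros simp flip: of_real_diff)
  finally show "norm (y x) \<le> (norm (y 0) + norm (y' 0)) + integral {0..x} (\<lambda>t. (x - t) * (norm (q t - \<nu>) * norm (y t)))"
    by simp
qed auto

lemma schroedinger_solution_derivative_bound:
  assumes q: "q absolutely_integrable_on {0..1}" and sol: "schroedinger_solution q \<nu> y y'"
    and R: "L1_norm q + norm \<nu> \<le> R" and x: "x \<in> {0..1}"
    and B: "\<And>x. x \<in> {0..1} \<Longrightarrow> norm (y x) \<le> B"
  shows "norm (y' x) \<le> norm (y' 0) + R * B"
proof -
  note D = schroedinger_solutionD[OF q sol]
  have p: "(\<lambda>t. q t - \<nu>) absolutely_integrable_on {0..1}" by (rule absolutely_integrable_on_shift[OF q])
  have np: "(\<lambda>t. norm (q t - \<nu>)) integrable_on {0..1}" using p by (simp add: absolutely_integrable_on_def)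
  have B0: "B \<ge> 0" using B[of 0] order_trans[OF norm_ge_zero] by auto
  have "norm (integral {0..x} (\<lambda>t. (q t - \<nu>) * y t)) \<le> integral {0..x} (\<lambda>t. B * norm (q t - \<nu>))"
  proof (rule integral_norm_bound_integral)
    show "(\<lambda>t. (q t - \<nu>) * y t) integrable_on {0..x}"
      by (rule integrable_on_subinterval[of _ "{0..1}"]) (use D(4) x in \<open>auto simp: absolutely_integrable_on_def\<close>)
    have "(\<lambda>t. B * norm (q t - \<nu>)) integrable_on {0..1}" by (intro integrable_on_mult_right np)
    then show "(\<lambda>t. B * norm (q t - \<nu>)) integrable_on {0..x}"
      by (rule integrable_on_subinterval) (use x in auto)
    fix t assume "t \<in> {0..x}"
    then show "norm ((q t - \<nu>) * y t) \<le> B * norm (q t - \<nu>)"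
      using B[of t] x by (auto simp: norm_mult mult.commute intro: mult_right_mono)
  qed
  also have "\<dots> = B * integral {0..x} (\<lambda>t. norm (q t - \<nu>))" by simp
  also have "\<dots> \<le> B * L1_norm (\<lambda>t. q t - \<nu>)"
    unfolding L1_norm_def using B0 x
    by (intro mult_left_mono integral_subset_le np integrable_on_subinterval[OF np]) auto
  also have "\<dots> \<le> B * R" using L1_norm_shift_le[OF q, of \<nu>] R B0 by (intro mult_left_mono) auto
  finally have *: "norm (integral {0..x} (\<lambda>t. (q t - \<nu>) * y t)) \<le> B * R" .
  have "norm (y' x) = norm (y' 0 + integral {0..x} (\<lambda>t. (q t - \<nu>) * y t))" by (metis D(5)[OF x])
  also have "\<dots> \<le> norm (y' 0) + R * B"
    using * norm_triangle_ineq[of "y' 0" "integral {0..x} (\<lambda>t. (q t - \<nu>) * y t)"] by (simp add: mult.commute)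
  finally show ?thesis .
qed

text \<open>With equal initial data, \<open>y - v\<close> solves the Volterra equation belonging to
  \<open>\<nu>\<close> with the extra source \<open>(\<mu> - \<nu>) * v\<close>. This is Lipschitz
  dependence on the spectral parameter.\<close>

lemma schroedinger_solution_diff_bound:
  assumes q: "q absolutely_integrable_on {0..1}"
    and sol: "schroedinger_solution q \<nu> y y'" and sol2: "schroedinger_solution q \<mu> v v'"
    and init: "y 0 = v 0" "y' 0 = v' 0"
    and R: "L1_norm q + norm \<nu> \<le> R" and x: "x \<in> {0..1}"
    and B: "\<And>x. x \<in> {0..1} \<Longrightarrow> norm (v x) \<le> B"
  shows "norm (y x - v x) \<le> 2 * (norm (\<mu> - \<nu>) * B) * exp (2 * (1 + R))"
proof (rule volterra_sup_bound[OF absolutely_integrable_on_shift[OF q] _ _ _ _ x])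
  note D = schroedinger_solutionD[OF q sol] and D2 = schroedinger_solutionD[OF q sol2]
  show "L1_norm (\<lambda>t. q t - \<nu>) \<le> R" using L1_norm_shift_le[OF q, of \<nu>] R by simp
  show dc: "continuous_on {0..1} (\<lambda>x. y x - v x)" by (intro continuous_intros D D2)
  have B0: "B \<ge> 0" using B[of 0] order_trans[OF norm_ge_zero] by auto
  then show "norm (\<mu> - \<nu>) * B \<ge> 0" by simp
  fix x :: real assume x: "x \<in> {0..1}"
  have int: "(\<lambda>t. of_real (x - t) * (f t * g t)) integrable_on {0..x}"
    if "f absolutely_integrable_on {0..1}" "continuous_on {0..1} g" for f g :: "real \<Rightarrow> complex"
  proof -
    have "(\<lambda>t. f t * (g t * of_real (x - t))) absolutely_integrable_on {0..1}"
      by (intro absolutely_integrable_mult_continuous that continuous_intros)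
    then have "(\<lambda>t. of_real (x - t) * (f t * g t)) integrable_on {0..1}"
      by (simp add: absolutely_integrable_on_def mult_ac)
    then show ?thesis by (rule integrable_on_subinterval) (use x in auto)
  qed
  have i3: "(\<lambda>t. of_real (x - t) * ((q t - \<nu>) * (y t - v t))) integrable_on {0..x}"
    by (intro int absolutely_integrable_on_shift q dc)
  have i4: "(\<lambda>t. of_real (x - t) * ((\<mu> - \<nu>) * v t)) integrable_on {0..x}"
    by (intro int D2 absolutely_integrable_continuous_real continuous_intros)
  have "y x - v x = integral {0..x} (\<lambda>t. of_real (x - t) * ((q t - \<nu>) * y t))
      - integral {0..x} (\<lambda>t. of_real (x - t) * ((q t - \<mu>) * v t))"
    using schroedinger_solution_volterra[OF q sol x] schroedinger_solution_volterra[OF q sol2 x] init by simp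
  also have "\<dots> = integral {0..x} (\<lambda>t. of_real (x - t) * ((q t - \<nu>) * y t) - of_real (x - t) * ((q t - \<mu>) * v t))"
    by (intro integral_diff[symmetric] int absolutely_integrable_on_shift q D D2)
  also have "\<dots> = integral {0..x} (\<lambda>t. of_real (x - t) * ((q t - \<nu>) * (y t - v t)) + of_real (x - t) * ((\<mu> - \<nu>) * v t))"
    by (rule integral_cong) (simp add: algebra_simps)
  also have "\<dots> = integral {0..x} (\<lambda>t. of_real (x - t) * ((q t - \<nu>) * (y t - v t))) + integral {0..x} (\<lambda>t. of_real (x - t) * ((\<mu> - \<nu>) * v t))"
    by (rule integral_add[OF i3 i4])
  finally have "norm (y x - v x) \<le> norm (integral {0..x} (\<lambda>t. of_real (x - t) * ((q t - \<nu>) * (y t - v t))))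
      + norm (integral {0..x} (\<lambda>t. of_real (x - t) * ((\<mu> - \<nu>) * v t)))"
    by (simp only: norm_triangle_ineq)
  also have "norm (integral {0..x} (\<lambda>t. of_real (x - t) * ((q t - \<nu>) * (y t - v t))))
     \<le> integral {0..x} (\<lambda>t. (x - t) * (norm (q t - \<nu>) * norm (y t - v t)))"
    by (rule integral_mult_kernel_le[OF absolutely_integrable_on_shift[OF q] dc _ _ _ x])
      (auto intro!: continuous_intros simp flip: of_real_diff)
  also have "norm (integral {0..x} (\<lambda>t. of_real (x - t) * ((\<mu> - \<nu>) * v t))) \<le> integral {0..x} (\<lambda>t. norm (\<mu> - \<nu>) * B)"
  proof (rule integral_norm_bound_integral[OF i4])
    fix t assume t: "t \<in> {0..x}"
    have "norm (of_real (x - t) * ((\<mu> - \<nu>) * v t)) = (x - t) * (norm (\<mu> - \<nu>) * norm (v t))"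
      using t by (simp add: norm_mult del: of_real_diff)
    also have "\<dots> \<le> 1 * (norm (\<mu> - \<nu>) * B)" using t x B[of t] by (intro mult_mono) auto
    finally show "norm (of_real (x - t) * ((\<mu> - \<nu>) * v t)) \<le> norm (\<mu> - \<nu>) * B" by simp
  qed auto
  also have "integral {0..x} (\<lambda>t. norm (\<mu> - \<nu>) * B) \<le> norm (\<mu> - \<nu>) * B"
    using mult_left_mono[OF mult_left_le_one_le[OF B0, of x] norm_ge_zero[of "\<mu> - \<nu>"]] x by (simp add: mult_ac)
  finally show "norm (y x - v x) \<le> norm (\<mu> - \<nu>) * B + integral {0..x} (\<lambda>t. (x - t) * (norm (q t - \<nu>) * norm (y t - v t)))"
    by simp
qed

section \<open>Wronskians and analyticity in the spectral parameter\<close>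

lemma schroedinger_solution_wronskian:
  assumes q: "q absolutely_integrable_on {0..1}"
    and u: "schroedinger_solution q \<nu> u u'" and v: "schroedinger_solution q \<mu> v v'"
  shows "u 1 * v' 1 - u' 1 * v 1 = u 0 * v' 0 - u' 0 * v 0 + (\<nu> - \<mu>) * integral {0..1} (\<lambda>t. u t * v t)"
proof -
  note U = schroedinger_solutionD[OF q u] and V = schroedinger_solutionD[OF q v]
  have 1: "integral {0..1} (\<lambda>t. (q t - \<mu>) * v t * u t + v' t * u' t) = v' 1 * u 1 - v' 0 * u 0"
    by (rule integration_by_parts_absolutely_integrable[where F = v' and g = u and g' = u' and b = 1]) (rule U V | simp)+
  have 2: "integral {0..1} (\<lambda>t. (q t - \<nu>) * u t * v t + u' t * v' t) = u' 1 * v 1 - u' 0 * v 0"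
    by (rule integration_by_parts_absolutely_integrable[where F = u' and g = v and g' = v' and b = 1]) (rule U V | simp)+
  have i: "(\<lambda>t. (q t - \<mu>) * v t * u t + v' t * u' t) integrable_on {0..1}"
    "(\<lambda>t. (q t - \<nu>) * u t * v t + u' t * v' t) integrable_on {0..1}"
    using absolutely_integrable_mult_continuous[OF V(4) U(2)] absolutely_integrable_mult_continuous[OF U(4) V(2)]
      integrable_continuous_real[OF continuous_on_mult[OF V(3) U(3)]] integrable_continuous_real[OF continuous_on_mult[OF U(3) V(3)]]
    by (simp_all add: integrable_add absolutely_integrable_on_def)
  have "(v' 1 * u 1 - v' 0 * u 0) - (u' 1 * v 1 - u' 0 * v 0)
     = integral {0..1} (\<lambda>t. ((q t - \<mu>) * v t * u t + v' t * u' t) - ((q t - \<nu>) * u t * v t + u' t * v' t))"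
    unfolding 1[symmetric] 2[symmetric] by (rule integral_diff[symmetric, OF i])
  also have "\<dots> = integral {0..1} (\<lambda>t. (\<nu> - \<mu>) * (u t * v t))"
    by (rule integral_cong) (simp add: algebra_simps)
  also have "\<dots> = (\<nu> - \<mu>) * integral {0..1} (\<lambda>t. u t * v t)" by simp
  finally show ?thesis by (simp add: algebra_simps)
qed

text \<open>\<open>y1\<close> and \<open>y2\<close> fix only the solution itself, so a derivative
  belonging to that particular choice has to be selected afterwards.\<close>

definition y1' :: "(real \<Rightarrow> complex) \<Rightarrow> complex \<Rightarrow> real \<Rightarrow> complex" where
  "y1' q \<nu> = (SOME y'. schroedinger_solution q \<nu> (\<lambda>x. y1 q x \<nu>) y' \<and> y' 0 = 0)"

definition y2' :: "(real \<Rightarrow> complex) \<Rightarrow> complex \<Rightarrow> real \<Rightarrow> complex" where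
  "y2' q \<nu> = (SOME y'. schroedinger_solution q \<nu> (\<lambda>x. y2 q x \<nu>) y' \<and> y' 0 = 1)"

context
  fixes q :: "real \<Rightarrow> complex"
  assumes q: "q absolutely_integrable_on {0..1}"
begin

lemma y1_solution: "schroedinger_solution q \<nu> (\<lambda>x. y1 q x \<nu>) (y1' q \<nu>)" "y1 q 0 \<nu> = 1" "y1' q \<nu> 0 = 0"
proof -
  have eq: "(\<lambda>x. y1 q x \<nu>) = (SOME y. \<exists>y'. schroedinger_solution q \<nu> y y' \<and> y 0 = 1 \<and> y' 0 = 0)"
    by (simp add: y1_def fun_eq_iff)
  have ex: "\<exists>y'. schroedinger_solution q \<nu> (\<lambda>x. y1 q x \<nu>) y' \<and> y1 q 0 \<nu> = 1 \<and> y' 0 = 0"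
    using someI_ex[OF schroedinger_solution_exists[OF q, of \<nu> 1 0]] unfolding eq[symmetric] by simp
  then have "\<exists>y'. schroedinger_solution q \<nu> (\<lambda>x. y1 q x \<nu>) y' \<and> y' 0 = 0" by blast
  from someI_ex[OF this]
  show "schroedinger_solution q \<nu> (\<lambda>x. y1 q x \<nu>) (y1' q \<nu>)" "y1' q \<nu> 0 = 0"
    unfolding y1'_def by auto
  show "y1 q 0 \<nu> = 1" using ex by blast
qed

lemma y2_solution: "schroedinger_solution q \<nu> (\<lambda>x. y2 q x \<nu>) (y2' q \<nu>)" "y2 q 0 \<nu> = 0" "y2' q \<nu> 0 = 1"
proof -
  have eq: "(\<lambda>x. y2 q x \<nu>) = (SOME y. \<exists>y'. schroedinger_solution q \<nu> y y' \<and> y 0 = 0 \<and> y' 0 = 1)"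
    by (simp add: y2_def fun_eq_iff)
  have ex: "\<exists>y'. schroedinger_solution q \<nu> (\<lambda>x. y2 q x \<nu>) y' \<and> y2 q 0 \<nu> = 0 \<and> y' 0 = 1"
    using someI_ex[OF schroedinger_solution_exists[OF q, of \<nu> 0 1]] unfolding eq[symmetric] by simp
  then have "\<exists>y'. schroedinger_solution q \<nu> (\<lambda>x. y2 q x \<nu>) y' \<and> y' 0 = 1" by blast
  from someI_ex[OF this]
  show "schroedinger_solution q \<nu> (\<lambda>x. y2 q x \<nu>) (y2' q \<nu>)" "y2' q \<nu> 0 = 1"
    unfolding y2'_def by auto
  show "y2 q 0 \<nu> = 0" using ex by blast
qed

lemma wronskian_fundamental: "y1 q 1 \<nu> * y2' q \<nu> 1 - y1' q \<nu> 1 * y2 q 1 \<nu> = 1"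
  using schroedinger_solution_wronskian[OF q y1_solution(1)[of \<nu>] y2_solution(1)[of \<nu>]]
  by (simp add: y1_solution y2_solution)

text \<open>The Wronskian identities of \<open>y2\<close> at \<open>\<mu>\<close> against
  \<open>y1\<close> and \<open>y2\<close> at \<open>\<nu>\<close> are combined so that
  \<open>y2'\<close> at \<open>\<mu>\<close> drops out. The factor \<open>\<mu> - \<nu>\<close> is
  exact, which leaves only a continuity statement for differentiability.\<close>

lemma y2_difference:
  "y2 q 1 \<mu> - y2 q 1 \<nu>
    = (\<mu> - \<nu>) * integral {0..1} (\<lambda>t. y2 q t \<mu> * (y2 q t \<nu> * y1 q 1 \<nu> - y1 q t \<nu> * y2 q 1 \<nu>))"
proof -
  note S = y1_solution y2_solution
  have c: "continuous_on {0..1} (\<lambda>t. y1 q t \<nu>)" "continuous_on {0..1} (\<lambda>t. y2 q t \<nu>)" for \<nu>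
    using schroedinger_solutionD(2)[OF q S(1)] schroedinger_solutionD(2)[OF q S(4)] by auto
  have W1: "y2 q 1 \<mu> * y1' q \<nu> 1 - y2' q \<mu> 1 * y1 q 1 \<nu> = -1 + (\<mu> - \<nu>) * integral {0..1} (\<lambda>t. y2 q t \<mu> * y1 q t \<nu>)"
    using schroedinger_solution_wronskian[OF q S(4)[of \<mu>] S(1)[of \<nu>]] by (simp add: S)
  have W2: "y2 q 1 \<mu> * y2' q \<nu> 1 - y2' q \<mu> 1 * y2 q 1 \<nu> = (\<mu> - \<nu>) * integral {0..1} (\<lambda>t. y2 q t \<mu> * y2 q t \<nu>)"
    using schroedinger_solution_wronskian[OF q S(4)[of \<mu>] S(4)[of \<nu>]] by (simp add: S)
  have "integral {0..1} (\<lambda>t. y2 q t \<mu> * (y2 q t \<nu> * y1 q 1 \<nu> - y1 q t \<nu> * y2 q 1 \<nu>))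
    = integral {0..1} (\<lambda>t. y2 q t \<mu> * y2 q t \<nu> * y1 q 1 \<nu> - y2 q t \<mu> * y1 q t \<nu> * y2 q 1 \<nu>)"
    by (rule integral_cong) (simp add: algebra_simps)
  also have "\<dots> = integral {0..1} (\<lambda>t. y2 q t \<mu> * y2 q t \<nu> * y1 q 1 \<nu>) - integral {0..1} (\<lambda>t. y2 q t \<mu> * y1 q t \<nu> * y2 q 1 \<nu>)"
    by (intro integral_diff integrable_continuous_real continuous_intros c)
  also have "\<dots> = integral {0..1} (\<lambda>t. y2 q t \<mu> * y2 q t \<nu>) * y1 q 1 \<nu> - integral {0..1} (\<lambda>t. y2 q t \<mu> * y1 q t \<nu>) * y2 q 1 \<nu>"
    by simp
  finally have "(\<mu> - \<nu>) * integral {0..1} (\<lambda>t. y2 q t \<mu> * (y2 q t \<nu> * y1 q 1 \<nu> - y1 q t \<nu> * y2 q 1 \<nu>))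
    = ((\<mu> - \<nu>) * integral {0..1} (\<lambda>t. y2 q t \<mu> * y2 q t \<nu>)) * y1 q 1 \<nu>
      - ((\<mu> - \<nu>) * integral {0..1} (\<lambda>t. y2 q t \<mu> * y1 q t \<nu>)) * y2 q 1 \<nu>"
    by (simp only: right_diff_distrib mult.assoc)
  also have "\<dots> = (y2 q 1 \<mu> * y2' q \<nu> 1 - y2' q \<mu> 1 * y2 q 1 \<nu>) * y1 q 1 \<nu>
      - (y2 q 1 \<mu> * y1' q \<nu> 1 - y2' q \<mu> 1 * y1 q 1 \<nu> + 1) * y2 q 1 \<nu>"
    unfolding W1 W2 by simp
  also have "\<dots> = y2 q 1 \<mu> * (y1 q 1 \<nu> * y2' q \<nu> 1 - y1' q \<nu> 1 * y2 q 1 \<nu>) - y2 q 1 \<nu>"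
    by (simp add: algebra_simps)
  finally show ?thesis by (simp add: wronskian_fundamental)
qed

lemma y2_has_field_derivative:
  "((\<lambda>\<mu>. y2 q 1 \<mu>) has_field_derivative
      integral {0..1} (\<lambda>t. y2 q t \<nu> * (y2 q t \<nu> * y1 q 1 \<nu> - y1 q t \<nu> * y2 q 1 \<nu>))) (at \<nu>)"
proof -
  define G where "G = (\<lambda>t. y2 q t \<nu> * y1 q 1 \<nu> - y1 q t \<nu> * y2 q 1 \<nu>)"
  note S = y1_solution y2_solution
  have c: "continuous_on {0..1} (\<lambda>t. y1 q t \<nu>)" "continuous_on {0..1} (\<lambda>t. y2 q t \<nu>)" for \<nu>
    using schroedinger_solutionD(2)[OF q S(1)] schroedinger_solutionD(2)[OF q S(4)] by auto
  have Gc: "continuous_on {0..1} G" unfolding G_def by (intro continuous_intros c)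
  obtain b where b: "b > 0" "\<forall>z\<in>G ` {0..1}. norm z \<le> b"
    using compact_imp_bounded[OF compact_continuous_image[OF Gc compact_Icc]] unfolding bounded_pos by blast
  define R where "R = L1_norm q + norm \<nu>"
  define B where "B = 2 * exp (2 * (1 + R))"
  have B: "norm (y2 q t \<nu>) \<le> B" if "t \<in> {0..1}" for t
    using schroedinger_solution_bound[OF q S(4)[of \<nu>] order_refl that] by (simp add: S B_def R_def)
  have diff: "norm (y2 q t \<mu> - y2 q t \<nu>) \<le> norm (\<mu> - \<nu>) * (2 * B * exp (2 * (2 + R)))"
    if "t \<in> {0..1}" "norm (\<mu> - \<nu>) \<le> 1" for t \<mu>
  proof -
    have "norm \<mu> \<le> norm \<nu> + 1" using norm_triangle_sub[of \<mu> \<nu>] that by simp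
    then have R: "L1_norm q + norm \<mu> \<le> 1 + R" by (simp add: R_def)
    have "norm (y2 q t \<mu> - y2 q t \<nu>) \<le> 2 * (norm (\<nu> - \<mu>) * B) * exp (2 * (1 + (1 + R)))"
      by (rule schroedinger_solution_diff_bound[OF q S(4) S(4) _ _ R that(1) B]) (simp_all add: S)
    then show ?thesis by (simp add: norm_minus_commute mult_ac add_ac)
  qed
  \<comment> \<open>By \<open>y2_difference\<close> this integral equals the difference quotient at
    \<open>\<nu>\<close>.\<close>
  have lim: "((\<lambda>\<mu>. integral {0..1} (\<lambda>t. y2 q t \<mu> * G t)) \<longlongrightarrow> integral {0..1} (\<lambda>t. y2 q t \<nu> * G t)) (at \<nu>)"
  proof (rule Lim_null_comparison[THEN LIM_zero_cancel])
    show "\<forall>\<^sub>F \<mu> in at \<nu>. norm (integral {0..1} (\<lambda>t. y2 q t \<mu> * G t) - integral {0..1} (\<lambda>t. y2 q t \<nu> * G t))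
        \<le> norm (\<mu> - \<nu>) * (2 * B * exp (2 * (2 + R)) * b)"
    proof -
      have "\<forall>\<^sub>F \<mu> in at \<nu>. norm (\<mu> - \<nu>) < 1"
        unfolding eventually_at by (rule exI[of _ 1]) (auto simp: dist_norm)
      then show ?thesis
      proof eventually_elim
        case (elim \<mu>)
        have "integral {0..1} (\<lambda>t. y2 q t \<mu> * G t) - integral {0..1} (\<lambda>t. y2 q t \<nu> * G t)
          = integral {0..1} (\<lambda>t. y2 q t \<mu> * G t - y2 q t \<nu> * G t)"
          by (intro integral_diff[symmetric] integrable_continuous_real continuous_intros c Gc)
        also have "norm \<dots> \<le> integral {0..1::real} (\<lambda>t. norm (\<mu> - \<nu>) * (2 * B * exp (2 * (2 + R)) * b))"
        proof (rule integral_norm_bound_integral)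
          show "(\<lambda>t. y2 q t \<mu> * G t - y2 q t \<nu> * G t) integrable_on {0..1}"
            by (intro integrable_continuous_real continuous_intros c Gc)
          fix t :: real assume t: "t \<in> {0..1}"
          have "norm (y2 q t \<mu> * G t - y2 q t \<nu> * G t) = norm (y2 q t \<mu> - y2 q t \<nu>) * norm (G t)"
            by (simp add: norm_mult flip: left_diff_distrib)
          also have "\<dots> \<le> norm (\<mu> - \<nu>) * (2 * B * exp (2 * (2 + R))) * b"
            using diff[OF t, of \<mu>] b t elim by (intro mult_mono) (auto simp: B_def)
          finally show "norm (y2 q t \<mu> * G t - y2 q t \<nu> * G t) \<le> norm (\<mu> - \<nu>) * (2 * B * exp (2 * (2 + R)) * b)"
            by (simp add: mult_ac)
        qed auto
        finally show ?case by simp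
      qed
    qed
    have "((\<lambda>\<mu>. norm (\<mu> - \<nu>) * (2 * B * exp (2 * (2 + R)) * b)) \<longlongrightarrow> norm (\<nu> - \<nu>) * (2 * B * exp (2 * (2 + R)) * b)) (at \<nu>)"
      by (intro tendsto_intros)
    then show "((\<lambda>\<mu>. norm (\<mu> - \<nu>) * (2 * B * exp (2 * (2 + R)) * b)) \<longlongrightarrow> 0) (at \<nu>)" by simp
  qed
  have "integral {0..1} (\<lambda>t. y2 q t \<nu> * (y2 q t \<nu> * y1 q 1 \<nu> - y1 q t \<nu> * y2 q 1 \<nu>))
      = integral {0..1} (\<lambda>t. y2 q t \<nu> * G t)" by (simp add: G_def)
  then show ?thesis
    unfolding has_field_derivative_iff
    by (simp only:) (rule Lim_transform_eventually[OF lim],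
      auto simp: eventually_at_filter y2_difference[of _ \<nu>] G_def)
qed

lemma y2_holomorphic: "(\<lambda>\<nu>. y2 q 1 \<nu>) holomorphic_on A"
  using y2_has_field_derivative by (meson holomorphic_onI field_differentiable_at_within field_differentiable_def)

section \<open>Asymptotics for large spectral parameter\<close>

lemma cmod_sin_le_exp': "cmod (sin z) \<le> exp \<bar>Im z\<bar>" and cmod_cos_le_exp': "cmod (cos z) \<le> exp \<bar>Im z\<bar>"
  using cmod_sin_le_exp[of 1 z] cmod_cos_le_exp[of 1 z] by auto

text \<open>Variation of constants with \<open>w = z^2\<close> leaves only \<open>q\<close>, with a
  factor 1/z, under the integral. The growth bound with \<open>\<theta> = 1 / norm z\<close> and
  \<open>L = \<bar>Im z\<bar>\<close> controls \<open>y\<close>, and inserting this control into the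
  integral once more gives the error term.\<close>

lemma schroedinger_solution_free_asymptotics:
  assumes sol: "schroedinger_solution q (z\<^sup>2) y y'" and z: "z \<noteq> 0" "2 * L1_norm q \<le> norm z"
    and A: "\<And>x. x \<in> {0..1} \<Longrightarrow> norm (y 0 * cos (z * of_real x) + y' 0 * (sin (z * of_real x) / z)) \<le> A * exp (\<bar>Im z\<bar> * x)"
    and x: "x \<in> {0..1}"
  shows "norm (y x - (y 0 * cos (z * of_real x) + y' 0 * (sin (z * of_real x) / z)))
     \<le> 2 * L1_norm q * A * exp (\<bar>Im z\<bar> * x) / norm z"
proof -
  define L where "L = \<bar>Im z\<bar>"
  define f where "f = (\<lambda>x. y 0 * cos (z * of_real x) + y' 0 * (sin (z * of_real x) / z))"
  note D = schroedinger_solutionD[OF q sol]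
  have S: "((\<lambda>s. sin (z * of_real s) / z) has_vector_derivative cos (z * of_real s)) (at s)"
    "((\<lambda>s. cos (z * of_real s)) has_vector_derivative - (z\<^sup>2) * (sin (z * of_real s) / z)) (at s)" for s
  proof -
    have "((\<lambda>w. sin (z * w) / z) has_field_derivative cos (z * of_real s)) (at (of_real s))"
      using z by (auto intro!: derivative_eq_intros)
    from has_vector_derivative_real_field[OF this]
    show "((\<lambda>s. sin (z * of_real s) / z) has_vector_derivative cos (z * of_real s)) (at s)" by simp
    have "((\<lambda>w. cos (z * w)) has_field_derivative - (z\<^sup>2) * (sin (z * of_real s) / z)) (at (of_real s))"
      using z by (auto intro!: derivative_eq_intros simp: power2_eq_square)
    from has_vector_derivative_real_field[OF this]
    show "((\<lambda>s. cos (z * of_real s)) has_vector_derivative - (z\<^sup>2) * (sin (z * of_real s) / z)) (at s)" by simp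
  qed
  have voc: "y x = f x + integral {0..x} (\<lambda>t. sin (z * of_real (x - t)) / z * (q t * y t))" if "x \<in> {0..1}" for x
    using schroedinger_solution_variation_of_constants[OF q sol S _ _ that] by (simp add: f_def)
  have ker: "norm (integral {0..x} (\<lambda>t. sin (z * of_real (x - t)) / z * (q t * y t)))
     \<le> 1 / norm z * integral {0..x} (\<lambda>t. exp (L * (x - t)) * (norm (q t) * norm (y t)))" if x: "x \<in> {0..1}" for x
  proof -
    have "norm (integral {0..x} (\<lambda>t. sin (z * of_real (x - t)) / z * (q t * y t)))
       \<le> integral {0..x} (\<lambda>t. exp (L * (x - t)) / norm z * (norm (q t) * norm (y t)))"
    proof (rule integral_mult_kernel_le[OF q D(2) _ _ _ x])
      fix t assume t: "t \<in> {0..x}"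
      have "norm (sin (z * of_real (x - t))) \<le> exp (L * (x - t))"
        using cmod_sin_le_exp'[of "z * of_real (x - t)"] t by (simp add: L_def abs_mult)
      then show "norm (sin (z * of_real (x - t)) / z) \<le> exp (L * (x - t)) / norm z"
        using z by (simp add: norm_divide divide_right_mono)
    qed (use z in \<open>auto intro!: continuous_intros\<close>)
    then show ?thesis by simp
  qed
  have bound: "norm (y x) \<le> 2 * A * exp (L * x)" if "x \<in> {0..1}" for x
  proof (rule volterra_growth_bound[OF q D(2) _ _ _ that, of "1 / norm z"])
    show "1 / norm z * integral {0..1} (\<lambda>t. norm (q t)) \<le> 1 / 2"
      using z by (simp add: L1_norm_def field_simps)
    fix x :: real assume x: "x \<in> {0..1}"
    show "norm (y x) \<le> A * exp (L * x) + 1 / norm z * integral {0..x} (\<lambda>t. exp (L * (x - t)) * (norm (q t) * norm (y t)))"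
    proof -
      have "norm (f x) \<le> A * exp (L * x)" using A[OF x] by (simp only: f_def L_def)
      moreover have "norm (y x) \<le> norm (f x) + norm (integral {0..x} (\<lambda>t. sin (z * of_real (x - t)) / z * (q t * y t)))"
        unfolding voc[OF x] by (rule norm_triangle_ineq)
      ultimately show ?thesis using ker[OF x] by linarith
    qed
  qed auto
  have nq: "(\<lambda>t. norm (q t)) integrable_on {0..1}" using q by (simp add: absolutely_integrable_on_def)
  have nq': "(\<lambda>t. norm (q t)) integrable_on {0..x}" by (rule integrable_on_subinterval[OF nq]) (use x in auto)
  have A0: "A \<ge> 0" using order_trans[OF norm_ge_zero A[of 0]] by simp
  have "norm (y x - f x) \<le> 1 / norm z * integral {0..x} (\<lambda>t. exp (L * (x - t)) * (norm (q t) * norm (y t)))"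
    using voc[OF x] ker[OF x] by simp
  also have "integral {0..x} (\<lambda>t. exp (L * (x - t)) * (norm (q t) * norm (y t))) \<le> integral {0..x} (\<lambda>t. 2 * A * exp (L * x) * norm (q t))"
  proof (rule integral_le)
    have "(\<lambda>t. norm (q t * (y t * of_real (exp (L * (x - t)))))) integrable_on {0..1}"
      using absolutely_integrable_mult_continuous[OF q continuous_on_mult[OF D(2) continuous_on_of_real], of "\<lambda>t. exp (L * (x - t))"]
      by (simp add: absolutely_integrable_on_def continuous_intros)
    then have "(\<lambda>t. exp (L * (x - t)) * (norm (q t) * norm (y t))) integrable_on {0..1}" by (simp add: norm_mult mult_ac)
    then show "(\<lambda>t. exp (L * (x - t)) * (norm (q t) * norm (y t))) integrable_on {0..x}"
      by (rule integrable_on_subinterval) (use x in auto)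
    show "(\<lambda>t. 2 * A * exp (L * x) * norm (q t)) integrable_on {0..x}" by (intro integrable_on_mult_right nq')
    fix t assume t: "t \<in> {0..x}"
    have "exp (L * (x - t)) * (norm (q t) * norm (y t)) \<le> exp (L * (x - t)) * (norm (q t) * (2 * A * exp (L * t)))"
      using bound[of t] t x by (intro mult_left_mono) auto
    also have "\<dots> = 2 * A * (exp (L * (x - t)) * exp (L * t)) * norm (q t)" by (simp only: mult_ac)
    also have "exp (L * (x - t)) * exp (L * t) = exp (L * x)" by (simp add: exp_add[symmetric] algebra_simps)
    finally show "exp (L * (x - t)) * (norm (q t) * norm (y t)) \<le> 2 * A * exp (L * x) * norm (q t)" .
  qed
  also have "integral {0..x} (\<lambda>t. 2 * A * exp (L * x) * norm (q t)) = 2 * A * exp (L * x) * integral {0..x} (\<lambda>t. norm (q t))" by simp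
  also have "integral {0..x} (\<lambda>t. norm (q t)) \<le> L1_norm q"
    unfolding L1_norm_def using x by (intro integral_subset_le nq nq') auto
  finally have "norm (y x - f x) \<le> 1 / norm z * (2 * A * exp (L * x) * L1_norm q)"
    using A0 by (simp add: mult_left_mono divide_right_mono)
  then show ?thesis by (simp add: f_def L_def mult_ac)
qed

lemma y1_asymptotics:
  assumes z: "z \<noteq> 0" "2 * L1_norm q \<le> norm z"
  shows "norm (y1 q 1 (z\<^sup>2) - cos z) \<le> 2 * L1_norm q * exp \<bar>Im z\<bar> / norm z"
proof -
  have "norm (y1 q 1 (z\<^sup>2) - (y1 q 0 (z\<^sup>2) * cos (z * of_real 1) + y1' q (z\<^sup>2) 0 * (sin (z * of_real 1) / z)))
    \<le> 2 * L1_norm q * 1 * exp (\<bar>Im z\<bar> * 1) / norm z"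
  proof (rule schroedinger_solution_free_asymptotics[OF y1_solution(1) z])
    fix x :: real assume "x \<in> {0..1}"
    then show "norm (y1 q 0 (z\<^sup>2) * cos (z * of_real x) + y1' q (z\<^sup>2) 0 * (sin (z * of_real x) / z)) \<le> 1 * exp (\<bar>Im z\<bar> * x)"
      using cmod_cos_le_exp'[of "z * of_real x"] by (simp add: y1_solution abs_mult)
  qed auto
  then show ?thesis by (simp add: y1_solution)
qed

lemma y2_asymptotics:
  assumes z: "z \<noteq> 0" "2 * L1_norm q \<le> norm z"
  shows "norm (y2 q 1 (z\<^sup>2) - sin z / z) \<le> 2 * L1_norm q * exp \<bar>Im z\<bar> / (norm z)\<^sup>2"
proof -
  have "norm (y2 q 1 (z\<^sup>2) - (y2 q 0 (z\<^sup>2) * cos (z * of_real 1) + y2' q (z\<^sup>2) 0 * (sin (z * of_real 1) / z)))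
    \<le> 2 * L1_norm q * (1 / norm z) * exp (\<bar>Im z\<bar> * 1) / norm z"
  proof (rule schroedinger_solution_free_asymptotics[OF y2_solution(1) z])
    fix x :: real assume "x \<in> {0..1}"
    then show "norm (y2 q 0 (z\<^sup>2) * cos (z * of_real x) + y2' q (z\<^sup>2) 0 * (sin (z * of_real x) / z)) \<le> 1 / norm z * exp (\<bar>Im z\<bar> * x)"
      using cmod_sin_le_exp'[of "z * of_real x"] by (simp add: y2_solution abs_mult norm_divide divide_right_mono)
  qed auto
  then show ?thesis by (simp add: y2_solution power2_eq_square)
qed

end

section \<open>Fourier coefficients\<close>

definition fexp :: "int \<Rightarrow> real \<Rightarrow> complex" where
  "fexp k x = exp (2 * of_real pi * \<i> * of_int k * of_real x)"

lemma fexp_add: "fexp (j + k) x = fexp j x * fexp k x"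
  by (simp add: fexp_def exp_add[symmetric] algebra_simps)

lemma fexp_0 [simp]: "fexp 0 x = 1" "fexp k 0 = 1"
  by (simp_all add: fexp_def)

lemma fexp_arg_diff: "fexp k (x - y) = fexp k x * fexp (- k) y"
  by (simp add: fexp_def exp_add[symmetric] algebra_simps)

lemma fexp_cis: "fexp k x = cis (2 * pi * of_int k * x)"
  by (simp add: fexp_def cis_conv_exp mult_ac)

lemma norm_fexp [simp]: "norm (fexp k x) = 1"
  by (simp add: fexp_cis)

lemma cnj_fexp: "cnj (fexp k x) = fexp (- k) x"
  by (simp add: fexp_cis cis_cnj)

lemma fexp_int [simp]: "fexp k 1 = 1"
  using cis_multiple_2pi[of "of_int k"] by (simp add: fexp_cis mult_ac)

lemma continuous_on_fexp [continuous_intros]: "continuous_on A (fexp k)"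
  unfolding fexp_def by (intro continuous_intros)

lemma fexp_has_vector_derivative:
  "(fexp k has_vector_derivative (2 * of_real pi * \<i> * of_int k) * fexp k x) (at x within A)"
proof -
  have "((\<lambda>w. exp (2 * of_real pi * \<i> * of_int k * w)) has_field_derivative
      (2 * of_real pi * \<i> * of_int k) * fexp k x) (at (of_real x))"
    by (auto intro!: derivative_eq_intros simp: fexp_def)
  from has_vector_derivative_real_field[OF this] show ?thesis
    by (simp add: fexp_def[abs_def] has_vector_derivative_at_within)
qed

lemma integral_fexp: "integral {0..1} (fexp k) = (if k = 0 then 1 else 0)"
proof (cases "k = 0")
  case True
  then have "fexp k = (\<lambda>x. 1)" by (simp add: fun_eq_iff)
  then show ?thesis using True by simp
next
  case False
  define c where "c = 2 * of_real pi * \<i> * of_int k"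
  have "((\<lambda>x. c * fexp k x) has_integral fexp k 1 - fexp k 0) {0..1}"
    unfolding c_def by (intro fundamental_theorem_of_calculus fexp_has_vector_derivative) simp
  then have "c * integral {0..1} (fexp k) = 0" by (simp add: integral_unique flip: integral_mult_right)
  then show ?thesis using False by (simp add: c_def)
qed

section \<open>Fourier coefficients and Bessel's inequality\<close>

lemma integrable_lebesgue_on_iff:
  fixes f :: "real \<Rightarrow> 'a::euclidean_space"
  shows "integrable (lebesgue_on {a..b}) f \<longleftrightarrow> f absolutely_integrable_on {a..b}"
  by (simp add: integrable_restrict_space set_integrable_def)

lemma lebesgue_on_integral_eq:
  fixes f :: "real \<Rightarrow> 'a::euclidean_space"
  assumes "f absolutely_integrable_on {a..b}"
  shows "(LINT x|lebesgue_on {a..b}. f x) = integral {a..b} f"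
  using assms by (intro lebesgue_integral_eq_integral) (auto simp: integrable_lebesgue_on_iff)

lemma absolutely_integrable_mult_fexp:
  "q absolutely_integrable_on {0..1} \<Longrightarrow> (\<lambda>x. q x * fexp k x) absolutely_integrable_on {0..1}"
  by (intro absolutely_integrable_mult_continuous continuous_intros)

lemma fourier_coeff_eq:
  assumes "q absolutely_integrable_on {0..1}"
  shows "fourier_coeff q k = integral {0..1} (\<lambda>x. q x * fexp (- k) x)"
proof -
  have "fourier_coeff q k = (LINT x|lebesgue_on {0..1}. q x * fexp (- k) x)"
    by (simp add: fourier_coeff_def l2_inner_def fexp_def[symmetric] cnj_fexp)
  also have "\<dots> = integral {0..1} (\<lambda>x. q x * fexp (- k) x)"
    by (intro lebesgue_on_integral_eq absolutely_integrable_mult_fexp assms)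
  finally show ?thesis .
qed

lemma fourier_coeff_bound:
  assumes q: "q absolutely_integrable_on {0..1}"
  shows "norm (fourier_coeff q k) \<le> integral {0..1} (\<lambda>x. norm (q x))"
  unfolding fourier_coeff_eq[OF q]
  by (rule integral_norm_bound_integral)
    (use q absolutely_integrable_mult_fexp[OF q, of "-k"] in \<open>auto simp: absolutely_integrable_on_def norm_mult\<close>)

lemma bessel_inequality:
  assumes f: "f absolutely_integrable_on {0..1}" and f2: "(\<lambda>x. (norm (f x))\<^sup>2) integrable_on {0..1}"
    and F: "finite F"
  shows "(\<Sum>k\<in>F. (norm (fourier_coeff f k))\<^sup>2) \<le> integral {0..1} (\<lambda>x. (norm (f x))\<^sup>2)"
proof -
  define c where "c = fourier_coeff f"
  define s where "s = (\<lambda>x. \<Sum>k\<in>F. c k * fexp k x)"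
  define T where "T = (\<Sum>k\<in>F. (norm (c k))\<^sup>2)"
  have sc: "continuous_on A s" for A unfolding s_def by (intro continuous_intros)
  have cnjs: "cnj (s x) = (\<Sum>k\<in>F. cnj (c k) * fexp (- k) x)" for x by (simp add: s_def cnj_fexp)
  have fs: "(\<lambda>x. f x * cnj (s x)) absolutely_integrable_on {0..1}"
    by (intro absolutely_integrable_mult_continuous f continuous_intros sc)
  have fsi: "(\<lambda>x. f x * cnj (s x)) integrable_on {0..1}" using fs by (simp add: absolutely_integrable_on_def)
  have TT: "complex_of_real T = (\<Sum>k\<in>F. cnj (c k) * c k)"
    unfolding T_def of_real_sum by (intro sum.cong refl) (metis complex_norm_square mult.commute)
  have "integral {0..1} (\<lambda>x. f x * cnj (s x)) = integral {0..1} (\<lambda>x. \<Sum>k\<in>F. cnj (c k) * (f x * fexp (- k) x))"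
    by (rule integral_cong) (simp add: cnjs sum_distrib_left mult_ac)
  also have "\<dots> = (\<Sum>k\<in>F. integral {0..1} (\<lambda>x. cnj (c k) * (f x * fexp (- k) x)))"
    using absolutely_integrable_mult_fexp[OF f]
    by (intro integral_sum F integrable_on_mult_right) (auto simp: absolutely_integrable_on_def)
  also have "\<dots> = T" by (simp add: TT c_def fourier_coeff_eq[OF f])
  finally have I1: "integral {0..1} (\<lambda>x. f x * cnj (s x)) = T" .
  have "s x * cnj (s x) = (\<Sum>j\<in>F. \<Sum>k\<in>F. c j * cnj (c k) * fexp (j - k) x)" for x
    unfolding cnjs unfolding s_def sum_product
    by (intro sum.cong refl) (simp add: fexp_add[of _ "- _", simplified] mult_ac)
  then have "integral {0..1} (\<lambda>x. s x * cnj (s x)) = integral {0..1} (\<lambda>x. \<Sum>j\<in>F. \<Sum>k\<in>F. c j * cnj (c k) * fexp (j - k) x)"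
    by simp
  also have "\<dots> = (\<Sum>j\<in>F. integral {0..1} (\<lambda>x. \<Sum>k\<in>F. c j * cnj (c k) * fexp (j - k) x))"
    by (intro integral_sum F integrable_continuous_real continuous_intros)
  also have "\<dots> = (\<Sum>j\<in>F. \<Sum>k\<in>F. integral {0..1} (\<lambda>x. c j * cnj (c k) * fexp (j - k) x))"
    by (intro sum.cong refl integral_sum F integrable_continuous_real continuous_intros)
  also have "\<dots> = (\<Sum>j\<in>F. \<Sum>k\<in>F. if j = k then c j * cnj (c k) else 0)"
    by (intro sum.cong refl) (simp add: integral_fexp)
  also have "\<dots> = T" using F by (simp add: TT mult.commute)
  finally have I2: "integral {0..1} (\<lambda>x. s x * cnj (s x)) = T" .
  have R1: "((\<lambda>x. Re (f x * cnj (s x))) has_integral T) {0..1}"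
    using has_integral_Re[OF integrable_integral[OF fsi]] by (simp add: I1)
  have "(\<lambda>x. s x * cnj (s x)) integrable_on {0..1}" by (intro integrable_continuous_real continuous_intros sc)
  then have R2: "((\<lambda>x. (norm (s x))\<^sup>2) has_integral T) {0..1}"
    using has_integral_Re[OF integrable_integral, of "\<lambda>x. s x * cnj (s x)" "{0..1}"]
    unfolding I2 by (simp only: complex_norm_square[symmetric] Re_complex_of_real)
  have "((\<lambda>x. (norm (f x))\<^sup>2 - 2 * Re (f x * cnj (s x)) + (norm (s x))\<^sup>2) has_integral
      (integral {0..1} (\<lambda>x. (norm (f x))\<^sup>2) - 2 * T + T)) {0..1}"
    by (intro has_integral_add has_integral_diff has_integral_mult_right R1 R2 integrable_integral f2)
  moreover have "(norm (f x))\<^sup>2 - 2 * Re (f x * cnj (s x)) + (norm (s x))\<^sup>2 = (norm (f x - s x))\<^sup>2" for x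
    by (simp add: cmod_power2) (simp add: power2_eq_square algebra_simps)
  ultimately have "((\<lambda>x. (norm (f x - s x))\<^sup>2) has_integral
      (integral {0..1} (\<lambda>x. (norm (f x))\<^sup>2) - 2 * T + T)) {0..1}"
    by (simp only:)
  then have "0 \<le> integral {0..1} (\<lambda>x. (norm (f x))\<^sup>2) - 2 * T + T"
    by (rule has_integral_nonneg) simp
  then show ?thesis by (simp add: T_def c_def)
qed

text \<open>Riemann--Lebesgue for square integrable functions, straight from Bessel's inequality. An
  arbitrary injective sequence of frequencies covers both ends of the integers.\<close>

lemma fourier_coeff_tendsto_0:
  fixes k :: "nat \<Rightarrow> int"
  assumes f: "f absolutely_integrable_on {0..1}" and f2: "(\<lambda>x. (norm (f x))\<^sup>2) integrable_on {0..1}"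
    and k: "inj k"
  shows "(\<lambda>n. fourier_coeff f (k n)) \<longlonglongrightarrow> 0"
proof -
  have "summable (\<lambda>n. (norm (fourier_coeff f (k n)))\<^sup>2)"
  proof (rule summableI_nonneg_bounded)
    fix n
    have "(\<Sum>i<n. (norm (fourier_coeff f (k i)))\<^sup>2) = (\<Sum>j\<in>k ` {..<n}. (norm (fourier_coeff f j))\<^sup>2)"
      by (subst sum.reindex) (use k in \<open>auto simp: inj_on_def inj_def\<close>)
    also have "\<dots> \<le> integral {0..1} (\<lambda>x. (norm (f x))\<^sup>2)" by (rule bessel_inequality[OF f f2]) simp
    finally show "(\<Sum>i<n. (norm (fourier_coeff f (k i)))\<^sup>2) \<le> integral {0..1} (\<lambda>x. (norm (f x))\<^sup>2)" .
  qed simp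
  then have "(\<lambda>n. (norm (fourier_coeff f (k n)))\<^sup>2) \<longlonglongrightarrow> 0" by (rule summable_LIMSEQ_zero)
  then have "(\<lambda>n. sqrt ((norm (fourier_coeff f (k n)))\<^sup>2)) \<longlonglongrightarrow> sqrt 0" by (rule tendsto_real_sqrt)
  then show ?thesis by (simp add: tendsto_norm_zero_iff)
qed

section \<open>Pointwise convergence for Lipschitz functions\<close>

lemma sin_ge_half:
  fixes t :: real
  assumes "0 \<le> t" "t \<le> pi / 2"
  shows "t / 2 \<le> sin t"
\<comment> \<open>Up to \<open>pi / 3\<close> the derivative \<open>cos t - 1 / 2\<close> is
  nonnegative; beyond, \<open>sin t\<close> is at least \<open>sqrt 3 / 2\<close>, which exceeds
  \<open>pi / 4\<close>.\<close>
proof (cases "t \<le> pi / 3")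
  case True
  have "sin 0 - 0 / 2 \<le> sin t - t / 2"
  proof (rule DERIV_nonneg_imp_nondecreasing[OF assms(1), of "\<lambda>t. sin t - t / 2"])
    fix x assume x: "0 \<le> x" "x \<le> t"
    have "cos (pi / 3) \<le> cos x" using x True by (intro cos_monotone_0_pi_le) auto
    then have "0 \<le> cos x - 1 / 2" by (simp add: cos_60)
    then show "\<exists>y. ((\<lambda>t. sin t - t / 2) has_real_derivative y) (at x) \<and> 0 \<le> y"
      by (intro exI[of _ "cos x - 1 / 2"] conjI) (auto intro!: derivative_eq_intros)
  qed
  then show ?thesis by simp
next
  case False
  have "sin (pi / 3) \<le> sin t" using False assms by (intro sin_monotone_2pi_le) auto
  moreover have "sqrt 3 \<ge> 1.7" by (rule real_le_rsqrt) (simp add: power2_eq_square)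
  moreover have "pi \<le> 3.2" using pi_approx by simp
  ultimately show ?thesis using assms by (simp add: sin_60)
qed

lemma norm_cis_minus_one: "norm (cis a - 1) = 2 * \<bar>sin (a / 2)\<bar>"
proof -
  have "(norm (cis a - 1))\<^sup>2 = (cos a - 1)\<^sup>2 + (sin a)\<^sup>2" by (simp add: cmod_power2)
  also have "\<dots> = 2 - 2 * cos (2 * (a / 2))"
    using sin_cos_squared_add[of a] by (simp add: power2_eq_square algebra_simps)
  also have "\<dots> = (2 * \<bar>sin (a / 2)\<bar>)\<^sup>2" by (subst cos_double_sin) (simp add: power_mult_distrib)
  finally show ?thesis by (rule power2_eq_imp_eq) auto
qed

text \<open>Chord against arc on the unit circle: for these \<open>d\<close> the left side is the
  distance of \<open>d\<close> to the integers.\<close>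

lemma norm_fexp_1_minus_one_ge:
  assumes "\<bar>d\<bar> \<le> 1"
  shows "min \<bar>d\<bar> (1 - \<bar>d\<bar>) \<le> norm (fexp 1 d - 1)"
proof -
  define m where "m = min \<bar>d\<bar> (1 - \<bar>d\<bar>)"
  have m: "0 \<le> m" "m \<le> 1/2" using assms by (auto simp: m_def min_def)
  have "\<bar>sin (pi * d)\<bar> = \<bar>sin (pi * \<bar>d\<bar>)\<bar>" by (cases "d \<ge> 0") auto
  also have "\<dots> = \<bar>sin (pi * m)\<bar>"
    using sin_pi_minus[of "pi * \<bar>d\<bar>"] by (auto simp: m_def min_def right_diff_distrib)
  finally have "\<bar>sin (pi * d)\<bar> = \<bar>sin (pi * m)\<bar>" .
  moreover have "pi * m \<le> pi * (1/2)" using m by (intro mult_left_mono) auto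
  then have "pi * m / 2 \<le> sin (pi * m)" using m by (intro sin_ge_half) auto
  moreover have "2 * m \<le> pi * m" using m pi_ge_two by (intro mult_right_mono) auto
  ultimately have "m \<le> 2 * \<bar>sin (pi * d)\<bar>" using m by auto
  then show ?thesis by (simp add: m_def fexp_cis norm_cis_minus_one)
qed

lemma has_sum_int_imp_tendsto:
  fixes f :: "int \<Rightarrow> 'a::{comm_monoid_add, topological_space}"
  assumes "(f has_sum s) UNIV"
  shows "(\<lambda>n. \<Sum>k\<in>{- int n..int n}. f k) \<longlonglongrightarrow> s"
proof -
  have "filterlim (\<lambda>n. {- int n..int n}) (finite_subsets_at_top UNIV) sequentially"
    unfolding filterlim_finite_subsets_at_top
  proof (intro allI impI)
    fix X :: "int set" assume X: "finite X \<and> X \<subseteq> UNIV"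
    obtain M where M: "\<And>x. x \<in> X \<Longrightarrow> \<bar>x\<bar> \<le> M" using X
      by (metis finite_imageI finite_nat_set_iff_bounded_le finite_int_iff_bounded_le atMost_iff image_subset_iff)
    show "\<forall>\<^sub>F n in sequentially. finite {- int n..int n} \<and> X \<subseteq> {- int n..int n} \<and> {- int n..int n} \<subseteq> UNIV"
      using eventually_ge_at_top[of "nat M"]
    proof eventually_elim
      case (elim n)
      have "x \<in> {- int n..int n}" if "x \<in> X" for x using M[OF that] elim by auto
      then show ?case by blast
    qed
  qed
  then show ?thesis using assms unfolding has_sum_def by (rule filterlim_compose[rotated])
qed

text \<open>After subtracting \<open>h x0\<close>, divide by \<open>fexp 1 (x - x0) - 1\<close>: the coefficients of the
  bounded quotient make the symmetric partial sums telescope, and Riemann--Lebesgue applies.\<close>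

lemma fourier_partial_sums_tendsto:
  fixes h :: "real \<Rightarrow> complex"
  assumes lip: "\<And>x y. x \<in> {0..1} \<Longrightarrow> y \<in> {0..1} \<Longrightarrow> norm (h x - h y) \<le> L * \<bar>x - y\<bar>"
    and per: "h 0 = h 1" and x0: "x0 \<in> {0..1}"
  shows "(\<lambda>n. \<Sum>k\<in>{- int n..int n}. fourier_coeff h k * fexp k x0) \<longlonglongrightarrow> h x0"
proof -
  define \<phi> where "\<phi> = (\<lambda>x. (h x - h x0) / (fexp 1 (x - x0) - 1))"
  have L: "L \<ge> 0" using order_trans[OF norm_ge_zero lip[of 0 1]] by simp
  have hc: "continuous_on {0..1} h"
    by (rule lipschitz_on_continuous_on[of L]) (use lip L in \<open>auto simp: lipschitz_on_def dist_norm\<close>)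
  \<comment> \<open>Since \<open>h 0 = h 1\<close>, the path from \<open>x\<close> to
    \<open>x0\<close> may also run through the endpoints, so the Lipschitz bound holds for the
    distance on the circle.\<close>
  have near: "norm (h x - h x0) \<le> L * min \<bar>x - x0\<bar> (1 - \<bar>x - x0\<bar>)" if x: "x \<in> {0..1}" for x
  proof -
    have "norm (h x - h x0) \<le> L * (1 - \<bar>x - x0\<bar>)"
    proof (cases "x \<le> x0")
      case True
      have "norm (h x - h x0) \<le> norm (h x - h 0) + norm (h 1 - h x0)"
        using norm_triangle_ineq[of "h x - h 0" "h 1 - h x0"] per by simp
      also have "\<dots> \<le> L * \<bar>x - 0\<bar> + L * \<bar>1 - x0\<bar>" using x x0 by (intro add_mono lip) auto
      also have "\<dots> = L * (1 - \<bar>x - x0\<bar>)" using x x0 True by (simp add: algebra_simps)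
      finally show ?thesis .
    next
      case False
      have "norm (h x - h x0) \<le> norm (h x - h 1) + norm (h 0 - h x0)"
        using norm_triangle_ineq[of "h x - h 1" "h 0 - h x0"] per by simp
      also have "\<dots> \<le> L * \<bar>x - 1\<bar> + L * \<bar>0 - x0\<bar>" using x x0 by (intro add_mono lip) auto
      also have "\<dots> = L * (1 - \<bar>x - x0\<bar>)" using x x0 False by (simp add: algebra_simps)
      finally show ?thesis .
    qed
    then show ?thesis using lip[OF x x0] L by (auto simp: min_def)
  qed
  have \<phi>b: "norm (\<phi> x) \<le> L" if x: "x \<in> {0..1}" for x
  proof -
    have "norm (h x - h x0) \<le> L * norm (fexp 1 (x - x0) - 1)"
      using near[OF x] mult_left_mono[OF norm_fexp_1_minus_one_ge[of "x - x0"] L] x x0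
      by (smt (verit) atLeastAtMost_iff)
    then show ?thesis using L by (cases "fexp 1 (x - x0) - 1 = 0") (auto simp: \<phi>_def norm_divide divide_le_eq)
  qed
  \<comment> \<open>Where the denominator of \<open>\<phi>\<close> vanishes, \<open>near\<close>
    forces the numerator to vanish too, so the default value of the quotient does no harm.\<close>
  have \<phi>eq: "h x - h x0 = \<phi> x * (fexp 1 (x - x0) - 1)" if x: "x \<in> {0..1}" for x
  proof (cases "fexp 1 (x - x0) - 1 = 0")
    case True
    then have "min \<bar>x - x0\<bar> (1 - \<bar>x - x0\<bar>) \<le> 0" using norm_fexp_1_minus_one_ge[of "x - x0"] x x0 by auto
    then have "L * min \<bar>x - x0\<bar> (1 - \<bar>x - x0\<bar>) \<le> 0" using L by (simp add: mult_nonneg_nonpos)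
    then have "norm (h x - h x0) \<le> 0" using near[OF x] by linarith
    then show ?thesis using True by simp
  qed (simp add: \<phi>_def)
  have "\<phi> \<in> borel_measurable (lebesgue_on {0..1})"
  proof -
    have "h \<in> borel_measurable (lebesgue_on {0..1})"
      by (intro continuous_imp_measurable_on_sets_lebesgue hc) auto
    moreover have "(\<lambda>x. fexp 1 (x - x0) - 1) \<in> borel_measurable (lebesgue_on {0..1})"
      unfolding fexp_def by (intro continuous_imp_measurable_on_sets_lebesgue continuous_intros) auto
    ultimately show ?thesis unfolding \<phi>_def by measurable
  qed
  note \<phi>m = this
  have \<phi>i: "\<phi> absolutely_integrable_on {0..1}"
    by (rule measurable_bounded_by_integrable_imp_absolutely_integrable[OF \<phi>m, of "\<lambda>_. L"]) (use \<phi>b in auto)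
  have "(\<lambda>x. (norm (\<phi> x))\<^sup>2) absolutely_integrable_on {0..1}"
  proof (rule measurable_bounded_by_integrable_imp_absolutely_integrable[of _ _ "\<lambda>_. L\<^sup>2"])
    show "(\<lambda>x. (norm (\<phi> x))\<^sup>2) \<in> borel_measurable (lebesgue_on {0..1})" using \<phi>m by measurable
  qed (use \<phi>b in \<open>auto intro: power_mono\<close>)
  then have \<phi>2: "(\<lambda>x. (norm (\<phi> x))\<^sup>2) integrable_on {0..1}" by (simp add: absolutely_integrable_on_def)
  define c where "c = fourier_coeff \<phi>"
  have hi: "h absolutely_integrable_on {0..1}" by (rule absolutely_integrable_continuous_real[OF hc])
  \<comment> \<open>Multiplication by \<open>fexp 1 (x - x0) - 1\<close> acts on the coefficients of
    \<open>\<phi>\<close> as a shift minus the identity; the factor \<open>fexp k x0\<close> turns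
    this into a difference of consecutive terms.\<close>
  have coeff: "fourier_coeff h k * fexp k x0 = (if k = 0 then h x0 else 0) + (fexp (k - 1) x0 * c (k - 1) - fexp k x0 * c k)" for k
  proof -
    have i: "(\<lambda>x. \<phi> x * fexp j x) integrable_on {0..1}" for j
      using absolutely_integrable_mult_fexp[OF \<phi>i] by (simp add: absolutely_integrable_on_def)
    have "fourier_coeff h k = integral {0..1} (\<lambda>x. h x * fexp (- k) x)" by (rule fourier_coeff_eq[OF hi])
    also have "\<dots> = integral {0..1} (\<lambda>x. h x0 * fexp (- k) x + (fexp (-1) x0 * (\<phi> x * fexp (- (k - 1)) x) - \<phi> x * fexp (- k) x))"
    proof (rule integral_cong)
      fix x :: real assume x: "x \<in> {0..1}"
      have hx: "h x = h x0 + \<phi> x * (fexp 1 x * fexp (-1) x0 - 1)" using \<phi>eq[OF x] unfolding fexp_arg_diff by (metis add.commute diff_add_cancel)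
      have fk: "fexp (- (k - 1)) x = fexp 1 x * fexp (- k) x" by (simp flip: fexp_add)
      show "h x * fexp (- k) x = h x0 * fexp (- k) x + (fexp (-1) x0 * (\<phi> x * fexp (- (k - 1)) x) - \<phi> x * fexp (- k) x)"
        unfolding fk by (subst hx) (simp add: algebra_simps)
    qed
    also have "\<dots> = integral {0..1} (\<lambda>x. h x0 * fexp (- k) x) + (integral {0..1} (\<lambda>x. fexp (-1) x0 * (\<phi> x * fexp (- (k - 1)) x)) - integral {0..1} (\<lambda>x. \<phi> x * fexp (- k) x))"
    proof (subst integral_add)
      show "integral {0..1} (\<lambda>x. h x0 * fexp (- k) x) + integral {0..1} (\<lambda>x. fexp (-1) x0 * (\<phi> x * fexp (- (k - 1)) x) - \<phi> x * fexp (- k) x)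
        = integral {0..1} (\<lambda>x. h x0 * fexp (- k) x) + (integral {0..1} (\<lambda>x. fexp (-1) x0 * (\<phi> x * fexp (- (k - 1)) x)) - integral {0..1} (\<lambda>x. \<phi> x * fexp (- k) x))"
        by (subst integral_diff) (intro integrable_on_mult_right i refl)+
    qed (intro integrable_on_mult_right i integrable_diff integrable_continuous_real continuous_intros)+
    also have "\<dots> = h x0 * integral {0..1} (fexp (- k)) + (fexp (-1) x0 * c (k - 1) - c k)"
      by (simp add: c_def fourier_coeff_eq[OF \<phi>i])
    finally have A: "fourier_coeff h k = (if k = 0 then h x0 else 0) + (fexp (-1) x0 * c (k - 1) - c k)"
      by (simp add: integral_fexp)
    have B: "fexp k x0 * fexp (-1) x0 = fexp (k - 1) x0" by (simp flip: fexp_add)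
    have "fourier_coeff h k * fexp k x0 = (if k = 0 then h x0 else 0) * fexp k x0
        + ((fexp k x0 * fexp (-1) x0) * c (k - 1) - fexp k x0 * c k)"
      unfolding A by (simp add: algebra_simps)
    then show ?thesis unfolding B by auto
  qed
  have tele: "(\<Sum>k\<in>{- int n..int n}. fourier_coeff h k * fexp k x0)
      = h x0 + (fexp (- int n - 1) x0 * c (- int n - 1) - fexp (int n) x0 * c (int n))" for n
  proof (induction n)
    case 0
    show ?case by (simp add: coeff[of 0, simplified])
  next
    case (Suc n)
    have "{- int (Suc n)..int (Suc n)} = insert (- int n - 1) (insert (int n + 1) {- int n..int n})" by auto
    then have "(\<Sum>k\<in>{- int (Suc n)..int (Suc n)}. fourier_coeff h k * fexp k x0)
       = fourier_coeff h (- int n - 1) * fexp (- int n - 1) x0 + (fourier_coeff h (int n + 1) * fexp (int n + 1) x0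
          + (\<Sum>k\<in>{- int n..int n}. fourier_coeff h k * fexp k x0))"
      by simp
    moreover have "- int n - 1 - 1 = - int (Suc n) - 1" "int n + 1 - 1 = int n" "int n + 1 = int (Suc n)" by auto
    ultimately show ?case unfolding Suc coeff[of "- int n - 1"] coeff[of "int n + 1"] by simp
  qed
  have c0: "(\<lambda>n. c (- int n - 1)) \<longlonglongrightarrow> 0" "(\<lambda>n. c (int n)) \<longlonglongrightarrow> 0"
    unfolding c_def by (rule fourier_coeff_tendsto_0[OF \<phi>i \<phi>2]; simp add: inj_def)+
  have "(\<lambda>n. fexp (- int n - 1) x0 * c (- int n - 1)) \<longlonglongrightarrow> 0"
    by (rule tendsto_norm_zero_cancel) (use tendsto_norm_zero[OF c0(1)] in \<open>simp add: norm_mult\<close>)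
  moreover have "(\<lambda>n. fexp (int n) x0 * c (int n)) \<longlonglongrightarrow> 0"
    by (rule tendsto_norm_zero_cancel) (use tendsto_norm_zero[OF c0(2)] in \<open>simp add: norm_mult\<close>)
  ultimately have "(\<lambda>n. h x0 + (fexp (- int n - 1) x0 * c (- int n - 1) - fexp (int n) x0 * c (int n))) \<longlonglongrightarrow> h x0 + (0 - 0)"
    by (intro tendsto_intros)
  then show ?thesis by (simp add: tele)
qed

text \<open>The term at 0 is 0 by the convention for division, so the sum can run over all
  integers.\<close>

lemma inverse_square_int_summable: "(\<lambda>k::int. 1 / (real_of_int k)\<^sup>2) summable_on UNIV"
proof -
  have n: "(\<lambda>n::nat. 1 / (real n)\<^sup>2) summable_on UNIV"
    using inverse_power_summable[of 2, where 'a = real]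
    by (intro summable_nonneg_imp_summable_on) (auto simp: inverse_eq_divide)
  have "(\<lambda>k::int. 1 / (real_of_int k)\<^sup>2) summable_on range int"
    using n by (subst summable_on_reindex) (auto simp: o_def)
  moreover have "(\<lambda>k::int. 1 / (real_of_int k)\<^sup>2) summable_on range (\<lambda>n. - int n)"
    using n by (subst summable_on_reindex) (auto simp: o_def inj_def)
  ultimately have "(\<lambda>k::int. 1 / (real_of_int k)\<^sup>2) summable_on (range int \<union> range (\<lambda>n. - int n))"
    by (rule summable_on_union)
  moreover have "range int \<union> range (\<lambda>n. - int n) = UNIV"
    by (auto simp: image_iff) (metis int_cases2)
  ultimately show ?thesis by simp
qed

section \<open>Periodic functions of class C1 and Parseval's identity\<close>

lemma summable_on_norm_iff_complex: "f summable_on A \<longleftrightarrow> (\<lambda>x. norm (f x)) summable_on A" for f :: "'a \<Rightarrow> complex"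
  by (rule summable_on_iff_abs_summable_on_complex)

text \<open>The derivative need not match at the two endpoints. This admits the damped polynomials
  used for the L1 bound as well as the Floquet function.\<close>

locale C1_periodic =
  fixes h h' :: "real \<Rightarrow> complex"
  assumes der: "\<And>x. x \<in> {0..1} \<Longrightarrow> (h has_vector_derivative h' x) (at x within {0..1})"
    and h'_cont: "continuous_on {0..1} h'" and per: "h 0 = h 1"
begin

lemma h_cont: "continuous_on {0..1} h"
  using der by (meson has_vector_derivative_continuous continuous_on_eq_continuous_within)

lemma h_lipschitz: "\<exists>L. \<forall>x\<in>{0..1}. \<forall>y\<in>{0..1}. norm (h x - h y) \<le> L * \<bar>x - y\<bar>"
proof -
  obtain L where L: "L > 0" "\<forall>y\<in>h' ` {0..1}. norm y \<le> L"
    using compact_imp_bounded[OF compact_continuous_image[OF h'_cont compact_Icc]] unfolding bounded_pos by blast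
  have "norm (h x - h y) \<le> L * norm (x - y)" if "x \<in> {0..1}" "y \<in> {0..1}" for x y
  proof (rule differentiable_bound[of "{0..1}" h "\<lambda>x t. t *\<^sub>R h' x"])
    show "\<And>x. x \<in> {0..1} \<Longrightarrow> (h has_derivative (\<lambda>t. t *\<^sub>R h' x)) (at x within {0..1})"
      using der by (simp add: has_vector_derivative_def)
    show "\<And>x. x \<in> {0..1} \<Longrightarrow> onorm (\<lambda>t. t *\<^sub>R h' x) \<le> L"
      using L by (intro onorm_le) (simp add: mult.commute[of L] mult_left_mono)
  qed (use that in auto)
  then show ?thesis by (intro exI[of _ L]) auto
qed

lemma fourier_coeff_derivative: "fourier_coeff h' k = 2 * of_real pi * \<i> * of_int k * fourier_coeff h k"
proof -
  have hi: "h absolutely_integrable_on {0..1}" and h'i: "h' absolutely_integrable_on {0..1}"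
    by (intro absolutely_integrable_continuous_real h_cont h'_cont)+
  have ftc: "h x = h 0 + integral {0..x} h'" if "x \<in> {0..1}" for x
  proof -
    have "(h' has_integral h x - h 0) {0..x}"
      by (rule fundamental_theorem_of_calculus)
        (use that in \<open>auto intro!: has_vector_derivative_within_subset[OF der]\<close>)
    then show ?thesis by (simp add: integral_unique)
  qed
  define c where "c = 2 * of_real pi * \<i> * of_int k"
  have c': "2 * of_real pi * \<i> * of_int (- k) = - c" by (simp add: c_def)
  have gd: "(fexp (- k) has_vector_derivative (- c) * fexp (- k) x) (at x within {0..1})" for x
    using fexp_has_vector_derivative[of "- k"] by (simp only: c')
  have "integral {0..1} (\<lambda>t. h' t * fexp (- k) t + h t * (- c * fexp (- k) t)) = h 1 * fexp (- k) 1 - h 0 * fexp (- k) 0"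
    by (rule integration_by_parts_absolutely_integrable[where b = 1 and F = h, OF h'i ftc])
      (auto intro!: continuous_intros gd[simplified])
  then have "integral {0..1} (\<lambda>t. h' t * fexp (- k) t + (- c) * (h t * fexp (- k) t)) = 0"
    by (simp add: per mult_ac)
  moreover have "(\<lambda>t. h' t * fexp (- k) t) integrable_on {0..1}" "(\<lambda>t. (- c) * (h t * fexp (- k) t)) integrable_on {0..1}"
    by (intro integrable_continuous_real continuous_intros h_cont h'_cont)+
  ultimately have "integral {0..1} (\<lambda>t. h' t * fexp (- k) t) + integral {0..1} (\<lambda>t. (- c) * (h t * fexp (- k) t)) = 0"
    by (simp only: integral_add)
  then show ?thesis by (simp add: fourier_coeff_eq[OF hi] fourier_coeff_eq[OF h'i] c_def)
qed

text \<open>A coefficient of \<open>h\<close> is at most that of \<open>h'\<close> divided by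
  \<bar>k\<bar>, hence at most the square of the latter plus \<open>1 / k^2\<close>; Bessel's
  inequality for \<open>h'\<close> handles the squares.\<close>

lemma fourier_coeff_summable: "(\<lambda>k. norm (fourier_coeff h k)) summable_on UNIV"
proof -
  have h'i: "h' absolutely_integrable_on {0..1}" by (intro absolutely_integrable_continuous_real h'_cont)
  have h'2: "(\<lambda>x. (norm (h' x))\<^sup>2) integrable_on {0..1}"
    by (intro integrable_continuous_real continuous_intros h'_cont)
  have 1: "(\<lambda>k. (norm (fourier_coeff h' k))\<^sup>2) summable_on UNIV"
    by (rule nonneg_bdd_above_summable_on) (auto intro!: bdd_aboveI2 bessel_inequality[OF h'i h'2])
  have "(\<lambda>k. norm (fourier_coeff h k)) summable_on (- {0})"
  proof (rule summable_on_comparison_test)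
    show "(\<lambda>k. (norm (fourier_coeff h' k))\<^sup>2 + 1 / (real_of_int k)\<^sup>2) summable_on - {0}"
      by (rule summable_on_subset_banach[of _ UNIV]) (intro summable_on_add 1 inverse_square_int_summable, simp)
    fix k :: int assume "k \<in> - {0}"
    then have k: "real_of_int \<bar>k\<bar> > 0" by simp
    define a where "a = norm (fourier_coeff h' k)"
    have a: "a = 2 * pi * real_of_int \<bar>k\<bar> * norm (fourier_coeff h k)"
      by (simp add: a_def fourier_coeff_derivative norm_mult)
    have "real_of_int \<bar>k\<bar> * norm (fourier_coeff h k) \<le> 2 * pi * (real_of_int \<bar>k\<bar> * norm (fourier_coeff h k))"
      using mult_right_mono[of 1 "2 * pi" "real_of_int \<bar>k\<bar> * norm (fourier_coeff h k)"] pi_ge_two by simp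
    then have "norm (fourier_coeff h k) \<le> a * (1 / real_of_int \<bar>k\<bar>)"
      using k by (simp add: a field_simps)
    also have "\<dots> \<le> a\<^sup>2 + (1 / real_of_int \<bar>k\<bar>)\<^sup>2"
    proof -
      have "0 \<le> a * (1 / real_of_int \<bar>k\<bar>)" unfolding a_def by simp
      then show ?thesis using sum_squares_bound[of a "1 / real_of_int \<bar>k\<bar>"] by linarith
    qed
    finally show "norm (fourier_coeff h k) \<le> (norm (fourier_coeff h' k))\<^sup>2 + 1 / (real_of_int k)\<^sup>2"
      by (simp add: a_def power_divide)
  qed simp
  moreover have "UNIV = insert 0 (- {0::int})" by auto
  ultimately show ?thesis by (metis summable_on_insert_iff)
qed

lemma fourier_series_has_sum:
  assumes x: "x \<in> {0..1}"
  shows "((\<lambda>k. fourier_coeff h k * fexp k x) has_sum h x) UNIV"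
proof -
  have "(\<lambda>k. fourier_coeff h k * fexp k x) summable_on UNIV"
    using fourier_coeff_summable by (simp add: summable_on_norm_iff_complex norm_mult)
  then obtain s where s: "((\<lambda>k. fourier_coeff h k * fexp k x) has_sum s) UNIV"
    by (auto simp: summable_on_def)
  obtain L where L: "\<forall>x\<in>{0..1}. \<forall>y\<in>{0..1}. norm (h x - h y) \<le> L * \<bar>x - y\<bar>" using h_lipschitz by blast
  have "s = h x"
    by (rule LIMSEQ_unique[OF has_sum_int_imp_tendsto[OF s] fourier_partial_sums_tendsto[OF _ per x]]) (use L in blast)
  then show ?thesis using s by simp
qed

text \<open>Only the series of \<open>h\<close> is expanded. Its partial sums are uniformly bounded
  and converge pointwise, so dominated convergence applies although \<open>q\<close> is merely
  integrable.\<close>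

lemma fourier_pairing:
  assumes q: "q absolutely_integrable_on {0..1}"
  shows "((\<lambda>k. fourier_coeff h k * fourier_coeff q (- k)) has_sum integral {0..1} (\<lambda>x. q x * h x)) UNIV"
proof -
  define S where "S = infsum (\<lambda>k. norm (fourier_coeff h k)) UNIV"
  define s where "s = (\<lambda>n x. \<Sum>k\<in>{- int n..int n}. fourier_coeff h k * fexp k x)"
  have nq: "(\<lambda>x. norm (q x)) integrable_on {0..1}" using q by (simp add: absolutely_integrable_on_def)
  have si: "(\<lambda>x. q x * s n x) integrable_on {0..1}" for n
  proof -
    have "continuous_on {0..1} (s n)" unfolding s_def by (intro continuous_intros)
    then show ?thesis
      using absolutely_integrable_mult_continuous[OF q] by (simp add: absolutely_integrable_on_def)
  qed
  have sb: "norm (s n x) \<le> S" for n x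
  proof -
    have "norm (s n x) \<le> (\<Sum>k\<in>{- int n..int n}. norm (fourier_coeff h k * fexp k x))"
      unfolding s_def by (rule norm_sum)
    also have "\<dots> \<le> S"
      unfolding S_def by (simp add: norm_mult finite_sum_le_infsum[OF fourier_coeff_summable])
    finally show ?thesis .
  qed
  have "(\<lambda>n. integral {0..1} (\<lambda>x. q x * s n x)) \<longlonglongrightarrow> integral {0..1} (\<lambda>x. q x * h x)"
  proof (rule dominated_convergence(2)[of _ _ "\<lambda>x. S * norm (q x)"])
    show "(\<lambda>x. S * norm (q x)) integrable_on {0..1}" by (intro integrable_on_mult_right nq)
    show "norm (q x * s n x) \<le> S * norm (q x)" for n x
      using mult_left_mono[OF sb[of n x], of "norm (q x)"] by (simp add: norm_mult mult.commute)
    show "(\<lambda>n. q x * s n x) \<longlonglongrightarrow> q x * h x" if "x \<in> {0..1}" for x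
      unfolding s_def by (intro tendsto_intros has_sum_int_imp_tendsto fourier_series_has_sum that)
  qed (rule si)
  moreover have "integral {0..1} (\<lambda>x. q x * s n x) = (\<Sum>k\<in>{- int n..int n}. fourier_coeff h k * fourier_coeff q (- k))" for n
  proof -
    have "integral {0..1} (\<lambda>x. q x * s n x) = integral {0..1} (\<lambda>x. \<Sum>k\<in>{- int n..int n}. fourier_coeff h k * (q x * fexp k x))"
      by (simp add: s_def sum_distrib_left mult_ac)
    also have "\<dots> = (\<Sum>k\<in>{- int n..int n}. integral {0..1} (\<lambda>x. fourier_coeff h k * (q x * fexp k x)))"
      using absolutely_integrable_mult_fexp[OF q]
      by (intro integral_sum integrable_on_mult_right) (auto simp: absolutely_integrable_on_def)
    finally show ?thesis by (simp add: fourier_coeff_eq[OF q])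
  qed
  ultimately have lim: "(\<lambda>n. \<Sum>k\<in>{- int n..int n}. fourier_coeff h k * fourier_coeff q (- k)) \<longlonglongrightarrow> integral {0..1} (\<lambda>x. q x * h x)"
    by simp
  have "(\<lambda>k. norm (fourier_coeff h k * fourier_coeff q (- k))) summable_on UNIV"
  proof (rule summable_on_comparison_test)
    show "(\<lambda>k. norm (fourier_coeff h k) * integral {0..1} (\<lambda>x. norm (q x))) summable_on UNIV"
      by (intro summable_on_cmult_left fourier_coeff_summable)
    show "norm (fourier_coeff h k * fourier_coeff q (- k)) \<le> norm (fourier_coeff h k) * integral {0..1} (\<lambda>x. norm (q x))" for k
      unfolding norm_mult by (intro mult_left_mono fourier_coeff_bound q) simp
  qed simp
  then obtain t where t: "((\<lambda>k. fourier_coeff h k * fourier_coeff q (- k)) has_sum t) UNIV"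
    by (auto simp: summable_on_norm_iff_complex[symmetric] summable_on_def)
  have "t = integral {0..1} (\<lambda>x. q x * h x)" by (rule LIMSEQ_unique[OF has_sum_int_imp_tendsto[OF t] lim])
  then show ?thesis using t by simp
qed

end

section \<open>The L1 norm is bounded by the Fourier norm\<close>

lemma infsum_Cauchy_Schwarz:
  fixes a b :: "'i \<Rightarrow> real"
  assumes "(\<lambda>x. (a x)\<^sup>2) summable_on A" "(\<lambda>x. (b x)\<^sup>2) summable_on A"
  shows "(\<lambda>x. \<bar>a x\<bar> * \<bar>b x\<bar>) summable_on A"
    and "(\<Sum>\<^sub>\<infinity>x\<in>A. \<bar>a x\<bar> * \<bar>b x\<bar>) \<le> sqrt (\<Sum>\<^sub>\<infinity>x\<in>A. (a x)\<^sup>2) * sqrt (\<Sum>\<^sub>\<infinity>x\<in>A. (b x)\<^sup>2)"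
proof -
  have fin: "(\<Sum>x\<in>F. \<bar>a x\<bar> * \<bar>b x\<bar>) \<le> sqrt (\<Sum>\<^sub>\<infinity>x\<in>A. (a x)\<^sup>2) * sqrt (\<Sum>\<^sub>\<infinity>x\<in>A. (b x)\<^sup>2)"
    if "finite F" "F \<subseteq> A" for F
  proof -
    have "(\<Sum>x\<in>F. \<bar>a x\<bar> * \<bar>b x\<bar>) \<le> sqrt (\<Sum>x\<in>F. (a x)\<^sup>2) * sqrt (\<Sum>x\<in>F. (b x)\<^sup>2)"
      using L2_set_mult_ineq[of a b F] by (simp add: L2_set_def)
    also have "\<dots> \<le> sqrt (\<Sum>\<^sub>\<infinity>x\<in>A. (a x)\<^sup>2) * sqrt (\<Sum>\<^sub>\<infinity>x\<in>A. (b x)\<^sup>2)"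
      using that assms by (intro mult_mono real_sqrt_le_mono finite_sum_le_infsum) (auto intro: infsum_nonneg sum_nonneg)
    finally show ?thesis .
  qed
  show s: "(\<lambda>x. \<bar>a x\<bar> * \<bar>b x\<bar>) summable_on A"
    by (rule nonneg_bdd_above_summable_on) (auto intro!: bdd_aboveI2 fin)
  show "(\<Sum>\<^sub>\<infinity>x\<in>A. \<bar>a x\<bar> * \<bar>b x\<bar>) \<le> sqrt (\<Sum>\<^sub>\<infinity>x\<in>A. (a x)\<^sup>2) * sqrt (\<Sum>\<^sub>\<infinity>x\<in>A. (b x)\<^sup>2)"
    by (rule infsum_le_finite_sums[OF s fin])
qed

lemma HC_0_absolutely_integrable:
  assumes "q \<in> HC 0" shows "q absolutely_integrable_on {0..1}"
proof -
  have m: "q \<in> borel_measurable (lebesgue_on {0..1})"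
    using assms by (auto simp: HC_def intro: measurable_restrict_space1)
  have "(\<lambda>x. (cmod (q x))\<^sup>2) absolutely_integrable_on {0..1}"
    using assms by (simp add: HC_def integrable_lebesgue_on_iff)
  then have i: "(\<lambda>x. 1 + (cmod (q x))\<^sup>2) integrable_on {0..1}"
    by (intro integrable_add) (auto simp: absolutely_integrable_on_def)
  show ?thesis
  proof (rule measurable_bounded_by_integrable_imp_absolutely_integrable[OF m _ i])
    show "cmod (q x) \<le> 1 + (cmod (q x))\<^sup>2" for x
    proof -
      have "2 * cmod (q x) \<le> 1 + (cmod (q x))\<^sup>2" using sum_squares_bound[of 1 "cmod (q x)"] by simp
      then show ?thesis using norm_ge_zero[of "q x"] by linarith
    qed
  qed simp
qed

lemma HC_0_coeff_summable:
  assumes "q \<in> HC 0" shows "(\<lambda>k. (cmod (fourier_coeff q k))\<^sup>2) summable_on UNIV"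
proof -
  have "(\<lambda>n. (cmod (fourier_coeff q n))\<^sup>2) summable_on {n. n \<noteq> 0}" using assms by (simp add: HC_def)
  moreover have "UNIV = insert 0 {n::int. n \<noteq> 0}" by auto
  ultimately show ?thesis by (metis summable_on_insert_iff)
qed

lemma HC_0_Hnorm:
  assumes "q \<in> HC 0" shows "Hnorm 0 q = sqrt (\<Sum>\<^sub>\<infinity>k. (cmod (fourier_coeff q k))\<^sup>2)"
proof -
  have "(\<Sum>\<^sub>\<infinity>k. (cmod (fourier_coeff q k))\<^sup>2) = (\<Sum>\<^sub>\<infinity>n\<in>{n::int. n \<noteq> 0}. (cmod (fourier_coeff q n))\<^sup>2)"
    by (rule infsum_cong_neutral) (use assms in \<open>auto simp: HC_def\<close>)
  then show ?thesis by (simp add: Hnorm_def)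
qed

text \<open>Bessel's inequality is applied to \<open>h\<close> and not to \<open>q\<close>: it
  bounds the coefficients of \<open>h\<close>, while those of \<open>q\<close> make up
  \<open>Hnorm 0 q\<close>. The identification of \<open>Hnorm 0 q\<close> with the L2 norm is
  thereby avoided.\<close>

lemma (in C1_periodic) norm_pairing_le_Hnorm:
  assumes q: "q \<in> HC 0" and h: "\<And>x. x \<in> {0..1} \<Longrightarrow> norm (h x) \<le> 1"
  shows "norm (integral {0..1} (\<lambda>x. q x * h x)) \<le> Hnorm 0 q"
proof -
  have hi: "h absolutely_integrable_on {0..1}" by (intro absolutely_integrable_continuous_real h_cont)
  have h2: "(\<lambda>x. (norm (h x))\<^sup>2) integrable_on {0..1}"
    by (intro integrable_continuous_real continuous_intros h_cont)
  have "integral {0..1} (\<lambda>x. (norm (h x))\<^sup>2) \<le> integral {0..1::real} (\<lambda>x. 1)"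
    by (intro integral_le h2) (use h in \<open>auto intro: power_le_one\<close>)
  then have fin: "(\<Sum>k\<in>F. (norm (fourier_coeff h k))\<^sup>2) \<le> 1" if "finite F" for F
    using bessel_inequality[OF hi h2 that] by simp
  have s1: "(\<lambda>k. (norm (fourier_coeff h k))\<^sup>2) summable_on UNIV"
    by (rule nonneg_bdd_above_summable_on) (auto intro!: bdd_aboveI2 fin)
  have s1': "(\<Sum>\<^sub>\<infinity>k. (norm (fourier_coeff h k))\<^sup>2) \<le> 1" by (rule infsum_le_finite_sums[OF s1 fin])
  have bij: "bij_betw uminus (UNIV :: int set) UNIV" by (rule bij_uminus)
  have s2: "(\<lambda>k. (norm (fourier_coeff q (- k)))\<^sup>2) summable_on UNIV"
    using HC_0_coeff_summable[OF q] summable_on_reindex_bij_betw[OF bij, of "\<lambda>k. (norm (fourier_coeff q k))\<^sup>2"] by simp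
  have s2': "(\<Sum>\<^sub>\<infinity>k. (norm (fourier_coeff q (- k)))\<^sup>2) = (\<Sum>\<^sub>\<infinity>k. (norm (fourier_coeff q k))\<^sup>2)"
    using infsum_reindex_bij_betw[OF bij, of "\<lambda>k. (norm (fourier_coeff q k))\<^sup>2"] by simp
  note P = fourier_pairing[OF HC_0_absolutely_integrable[OF q]]
  have sn: "(\<lambda>k. norm (fourier_coeff h k * fourier_coeff q (- k))) summable_on UNIV"
    using infsum_Cauchy_Schwarz(1)[OF s1 s2] by (simp add: norm_mult)
  have "norm (integral {0..1} (\<lambda>x. q x * h x)) \<le> (\<Sum>\<^sub>\<infinity>k. norm (fourier_coeff h k * fourier_coeff q (- k)))"
    using norm_infsum_bound[OF sn] infsumI[OF P] by simp
  also have "\<dots> \<le> sqrt (\<Sum>\<^sub>\<infinity>k. (norm (fourier_coeff h k))\<^sup>2) * sqrt (\<Sum>\<^sub>\<infinity>k. (norm (fourier_coeff q (- k)))\<^sup>2)"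
    using infsum_Cauchy_Schwarz(2)[OF s1 s2] by (simp add: norm_mult)
  also have "\<dots> \<le> 1 * Hnorm 0 q"
    unfolding s2' HC_0_Hnorm[OF q] using s1' by (intro mult_right_mono) (auto intro: infsum_nonneg)
  finally show ?thesis by simp
qed

text \<open>Trigonometric polynomials alone would need the completeness of the Fourier system;
  polynomials damped at the endpoints are periodic \<open>C\<^sup>1\<close> functions to which the pairing applies.\<close>

lemma norm_pairing_continuous_le_Hnorm:
  assumes q: "q \<in> HC 0" and g: "continuous_on {0..1} g" "\<And>x. x \<in> {0..1} \<Longrightarrow> norm (g x) \<le> 1"
  shows "norm (integral {0..1} (\<lambda>x. q x * g x)) \<le> Hnorm 0 q"
proof -
  have qi: "q absolutely_integrable_on {0..1}" by (rule HC_0_absolutely_integrable[OF q])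
  have "\<exists>p. polynomial_function p \<and> (\<forall>x\<in>{0..1}. norm (g x - p x) < 1 / real (Suc n))" for n
    by (rule Stone_Weierstrass_polynomial_function) (use g in auto)
  then obtain p where p: "\<And>n. polynomial_function (p n)" "\<And>n x. x \<in> {0..1} \<Longrightarrow> norm (g x - p n x) < 1 / real (Suc n)"
    by metis
  \<comment> \<open>The numerator vanishes at both endpoints and tends to 1 in between; the divisor
    compensates the approximation error of \<open>p n\<close>, so that \<open>h n\<close> stays in
    the unit disc.\<close>
  define d where "d = (\<lambda>n x. (1 - (2 * x - 1) ^ (2 * Suc n)) / (1 + 1 / real (Suc n)) :: real)"
  define h where "h = (\<lambda>n x. complex_of_real (d n x) * p n x)"
  have d01: "0 \<le> d n x" "d n x * (1 + 1 / real (Suc n)) \<le> 1" if "x \<in> {0..1}" for n x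
  proof -
    have "\<bar>2 * x - 1\<bar> \<le> 1" using that by auto
    then have "(2 * x - 1) ^ (2 * Suc n) \<le> 1" by (simp only: power_mult abs_square_le_1 power_le_one zero_le_power2)
    moreover have "0 \<le> (2 * x - 1) ^ (2 * Suc n)" by (simp only: power_mult zero_le_power zero_le_power2)
    moreover have "1 + 1 / real (Suc n) > 0" by (simp add: add_pos_nonneg)
    ultimately show "0 \<le> d n x" "d n x * (1 + 1 / real (Suc n)) \<le> 1" by (auto simp: d_def divide_nonneg_pos)
  qed
  have pb: "norm (p n x) \<le> 1 + 1 / real (Suc n)" if "x \<in> {0..1}" for n x
    using g(2)[OF that] p(2)[OF that, of n] norm_triangle_ineq2[of "p n x" "g x"] by (simp add: norm_minus_commute)
  have hb: "norm (h n x) \<le> 1" if "x \<in> {0..1}" for n x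
  proof -
    have "norm (h n x) \<le> d n x * (1 + 1 / real (Suc n))"
      using mult_left_mono[OF pb[OF that, of n] d01(1)[OF that, of n]] d01(1)[OF that, of n] by (simp add: h_def norm_mult)
    also have "\<dots> \<le> 1" by (rule d01[OF that])
    finally show ?thesis .
  qed
  have C1: "\<exists>h'. C1_periodic (h n) h'" for n
  proof -
    have "real_polynomial_function (d n)"
      unfolding d_def by (intro real_polynomial_function_divide real_polynomial_function_diff
          real_polynomial_function_power real_polynomial_function.intros) (auto intro: bounded_linear_intros)
    then have "polynomial_function (\<lambda>x. d n x *\<^sub>R p n x)"
      by (intro polynomial_function_mult p(1)) (simp add: real_polynomial_function_eq)
    then have "polynomial_function (h n)" by (simp add: h_def[abs_def] scaleR_conv_of_real)
    then obtain h' where h': "polynomial_function h'" "\<And>x. (h n has_vector_derivative h' x) (at x)"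
      using has_vector_derivative_polynomial_function by blast
    have "h n 0 = h n 1" by (simp add: h_def d_def)
    then have "C1_periodic (h n) h'"
      by unfold_locales (auto intro: has_vector_derivative_at_within[OF h'(2)] continuous_on_polymonial_function[OF h'(1)])
    then show ?thesis by blast
  qed
  have le: "norm (integral {0..1} (\<lambda>x. q x * h n x)) \<le> Hnorm 0 q" for n
  proof -
    obtain h' where "C1_periodic (h n) h'" using C1[of n] by blast
    then show ?thesis by (rule C1_periodic.norm_pairing_le_Hnorm[OF _ q hb])
  qed
  have nq: "(\<lambda>x. norm (q x)) integrable_on {0..1}" using qi by (simp add: absolutely_integrable_on_def)
  have hc: "continuous_on {0..1} (h n)" for n using C1[of n] C1_periodic.h_cont by blast
  have neg: "negligible {0, 1::real}" by (intro negligible_finite) simp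
  \<comment> \<open>At the two endpoints \<open>h n\<close> is 0 and need not converge to
    \<open>g\<close>; resetting both functions there changes no integral.\<close>
  define hh where "hh = (\<lambda>n x. if x \<in> {0,1} then 0 else h n x)"
  define gg where "gg = (\<lambda>x. if x \<in> {0,1} then 0 else g x)"
  have "(\<lambda>n. integral {0..1} (\<lambda>x. q x * hh n x)) \<longlonglongrightarrow> integral {0..1} (\<lambda>x. q x * gg x)"
  proof (rule dominated_convergence(2)[OF _ nq])
    fix n
    have "(\<lambda>x. q x * h n x) integrable_on {0..1}"
      using absolutely_integrable_mult_continuous[OF qi hc] by (simp add: absolutely_integrable_on_def)
    then show "(\<lambda>x. q x * hh n x) integrable_on {0..1}"
      by (rule integrable_spike[OF _ neg]) (auto simp: hh_def)
  next
    fix n x assume "x \<in> {0..1::real}"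
    then show "norm (q x * hh n x) \<le> norm (q x)"
      using hb[of x n] by (auto simp: hh_def norm_mult intro: mult_left_le)
  next
    fix x assume x: "x \<in> {0..1::real}"
    show "(\<lambda>n. q x * hh n x) \<longlonglongrightarrow> q x * gg x"
    proof (cases "x \<in> {0, 1}")
      case False
      have z: "(\<lambda>n. 1 / real (Suc n)) \<longlonglongrightarrow> 0" by (rule LIMSEQ_Suc[OF lim_1_over_n])
      have "(\<lambda>n. g x - p n x) \<longlonglongrightarrow> 0"
        by (rule Lim_null_comparison[OF _ z]) (use p(2)[OF x] in \<open>auto intro!: always_eventually less_imp_le simp del: of_nat_Suc\<close>)
      then have "(\<lambda>n. g x - (g x - p n x)) \<longlonglongrightarrow> g x - 0" by (intro tendsto_intros)
      then have p_lim: "(\<lambda>n. p n x) \<longlonglongrightarrow> g x" by simp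
      have "\<bar>2 * x - 1\<bar> < 1" using x False by auto
      then have "\<bar>(2 * x - 1)\<^sup>2\<bar> < 1" by (simp add: abs_square_less_1)
      then have "(\<lambda>n. ((2 * x - 1)\<^sup>2) ^ Suc n) \<longlonglongrightarrow> 0" by (intro LIMSEQ_Suc LIMSEQ_power_zero) simp
      then have "(\<lambda>n. (2 * x - 1) ^ (2 * Suc n)) \<longlonglongrightarrow> 0" by (simp only: power_mult)
      then have "(\<lambda>n. d n x) \<longlonglongrightarrow> (1 - 0) / (1 + 0)" unfolding d_def by (intro tendsto_intros z) auto
      then have "(\<lambda>n. complex_of_real (d n x)) \<longlonglongrightarrow> 1" using tendsto_of_real by fastforce
      then have "(\<lambda>n. q x * h n x) \<longlonglongrightarrow> q x * (1 * g x)" unfolding h_def by (intro tendsto_intros p_lim)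
      then show ?thesis using False by (simp add: hh_def gg_def)
    qed (simp add: hh_def gg_def)
  qed
  moreover have "integral {0..1} (\<lambda>x. q x * hh n x) = integral {0..1} (\<lambda>x. q x * h n x)" for n
    by (rule integral_spike[OF neg]) (auto simp: hh_def)
  moreover have "integral {0..1} (\<lambda>x. q x * gg x) = integral {0..1} (\<lambda>x. q x * g x)"
    by (rule integral_spike[OF neg]) (auto simp: gg_def)
  ultimately have "(\<lambda>n. integral {0..1} (\<lambda>x. q x * h n x)) \<longlonglongrightarrow> integral {0..1} (\<lambda>x. q x * g x)" by simp
  from tendsto_norm[OF this] show ?thesis by (rule LIMSEQ_le_const2) (use le in auto)
qed

text \<open>Duality with the conjugate sign of \<open>q\<close>, which is an almost everywhere limit
  of continuous functions. This makes the constants for solutions uniform on sets bounded in the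
  Fourier norm.\<close>

lemma L1_norm_le_Hnorm:
  assumes q: "q \<in> HC 0"
  shows "L1_norm q \<le> Hnorm 0 q"
proof -
  have qi: "q absolutely_integrable_on {0..1}" by (rule HC_0_absolutely_integrable[OF q])
  have nq: "(\<lambda>x. norm (q x)) integrable_on {0..1}" using qi by (simp add: absolutely_integrable_on_def)
  have "q \<in> borel_measurable lebesgue" using q by (simp add: HC_def)
  moreover have "(\<lambda>z::complex. cnj (sgn z)) \<in> borel_measurable borel"
    by (intro measurable_compose[OF borel_measurable_sgn] borel_measurable_continuous_onI continuous_intros)
  ultimately have "(\<lambda>x. cnj (sgn (q x))) \<in> borel_measurable lebesgue" by (rule measurable_compose)
  then have "(\<lambda>x. cnj (sgn (q x))) measurable_on {0..1}" by (rule lebesgue_measurable_imp_measurable_on) simp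
  then obtain N g where N: "negligible N" and g: "\<And>n. continuous_on UNIV (g n :: real \<Rightarrow> complex)"
    "\<And>x. x \<notin> N \<Longrightarrow> (\<lambda>n. g n x) \<longlonglongrightarrow> (if x \<in> {0..1} then cnj (sgn (q x)) else 0)"
    unfolding measurable_on_def by blast
  \<comment> \<open>Radial truncation to the closed unit disc keeps the limit, because the sign
    function already takes values there.\<close>
  define h where "h = (\<lambda>n x. g n x / of_real (max 1 (norm (g n x))))"
  have hc: "continuous_on {0..1} (h n)" for n
  proof -
    have "max 1 (cmod (g n x)) \<noteq> 0" for x by (metis max.cobounded1 not_one_le_zero)
    then show ?thesis unfolding h_def by (intro continuous_intros continuous_on_subset[OF g(1)]) auto
  qed
  have hb: "norm (h n x) \<le> 1" for n x
    by (simp add: h_def norm_divide divide_le_eq_1 less_max_iff_disj)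
  define hh where "hh = (\<lambda>n x. if x \<in> N then 0 else h n x)"
  define s where "s = (\<lambda>x. if x \<in> N then 0 else cnj (sgn (q x)))"
  have "(\<lambda>n. integral {0..1} (\<lambda>x. q x * hh n x)) \<longlonglongrightarrow> integral {0..1} (\<lambda>x. q x * s x)"
  proof (rule dominated_convergence(2)[OF _ nq])
    fix n
    have "(\<lambda>x. q x * h n x) integrable_on {0..1}"
      using absolutely_integrable_mult_continuous[OF qi hc] by (simp add: absolutely_integrable_on_def)
    then show "(\<lambda>x. q x * hh n x) integrable_on {0..1}"
      by (rule integrable_spike[OF _ N]) (auto simp: hh_def)
  next
    fix n x assume "x \<in> {0..1::real}"
    then show "norm (q x * hh n x) \<le> norm (q x)"
      using hb[of n x] by (auto simp: hh_def norm_mult intro: mult_left_le)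
  next
    fix x assume x: "x \<in> {0..1::real}"
    show "(\<lambda>n. q x * hh n x) \<longlonglongrightarrow> q x * s x"
    proof (cases "x \<in> N")
      case False
      have gl: "(\<lambda>n. g n x) \<longlonglongrightarrow> cnj (sgn (q x))" using g(2)[OF False] x by simp
      have "(\<lambda>n. h n x) \<longlonglongrightarrow> cnj (sgn (q x)) / of_real (max 1 (norm (cnj (sgn (q x)))))"
        unfolding h_def by (intro tendsto_intros gl) auto
      moreover have "max 1 (norm (cnj (sgn (q x)))) = 1" by (simp add: norm_sgn)
      ultimately have "(\<lambda>n. h n x) \<longlonglongrightarrow> cnj (sgn (q x))" by simp
      then have "(\<lambda>n. q x * h n x) \<longlonglongrightarrow> q x * cnj (sgn (q x))" by (intro tendsto_intros)
      then show ?thesis using False by (simp add: hh_def s_def)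
    qed (simp add: hh_def s_def)
  qed
  moreover have "integral {0..1} (\<lambda>x. q x * hh n x) = integral {0..1} (\<lambda>x. q x * h n x)" for n
    by (rule integral_spike[OF N]) (auto simp: hh_def)
  moreover have "integral {0..1} (\<lambda>x. q x * s x) = integral {0..1} (\<lambda>x. complex_of_real (norm (q x)))"
  proof (rule integral_spike[OF N])
    fix x assume "x \<in> {0..1} - N"
    then show "complex_of_real (norm (q x)) = q x * s x"
      by (cases "q x = 0") (auto simp: s_def sgn_eq complex_norm_square[symmetric] power2_eq_square)
  qed
  ultimately have "(\<lambda>n. integral {0..1} (\<lambda>x. q x * h n x)) \<longlonglongrightarrow> integral {0..1} (\<lambda>x. complex_of_real (norm (q x)))"
    by simp
  from tendsto_norm[OF this] have "norm (integral {0..1} (\<lambda>x. complex_of_real (norm (q x)))) \<le> Hnorm 0 q"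
    by (rule LIMSEQ_le_const2) (use norm_pairing_continuous_le_Hnorm[OF q hc hb] in auto)
  moreover have "integral {0..1} (\<lambda>x. complex_of_real (norm (q x))) = complex_of_real (L1_norm q)"
    unfolding L1_norm_def using integral_linear[OF nq bounded_linear_of_real] by (simp add: o_def)
  ultimately show ?thesis by simp
qed

section \<open>Location of the Dirichlet eigenvalues\<close>

lemma lex_le_refl [simp]: "lex_le a a"
  and lex_le_trans: "lex_le a b \<Longrightarrow> lex_le b c \<Longrightarrow> lex_le a c"
  and lex_le_total: "lex_le a b \<or> lex_le b a"
  and lex_le_antisym: "lex_le a b \<Longrightarrow> lex_le b a \<Longrightarrow> a = b"
  by (auto simp: lex_le_def complex_eq_iff)

text \<open>\<open>Z\<close> with multiplicities \<open>m\<close> is exhausted by sets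
  \<open>D n\<close>, each holding \<open>n\<close> points by multiplicity and lying to the left of
  the rest of \<open>Z\<close>. Lexicographic initial segments are therefore finite, and positions
  in the list can be read off from the \<open>D n\<close>.\<close>

locale exhausted_multiset =
  fixes Z :: "complex set" and m :: "complex \<Rightarrow> nat" and D :: "nat \<Rightarrow> complex set" and n0 :: nat
  assumes m_pos: "z \<in> Z \<Longrightarrow> m z > 0"
    and D_finite: "n \<ge> n0 \<Longrightarrow> finite (Z \<inter> D n)"
    and D_card: "n \<ge> n0 \<Longrightarrow> (\<Sum>z\<in>Z \<inter> D n. m z) = n"
    and D_lower: "n \<ge> n0 \<Longrightarrow> z \<in> Z \<Longrightarrow> z \<in> D n \<Longrightarrow> w \<in> Z \<Longrightarrow> w \<notin> D n \<Longrightarrow> Re z < Re w"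
    and D_cover: "z \<in> Z \<Longrightarrow> \<exists>n\<ge>n0. z \<in> D n"
begin

lemma lower_closed:
  assumes "n \<ge> n0" "z \<in> Z" "z \<in> D n" "w \<in> Z" "lex_le w z" shows "w \<in> D n"
proof (rule ccontr)
  assume "w \<notin> D n"
  then have "Re z < Re w" using D_lower assms by blast
  then show False using assms(5) by (simp add: lex_le_def)
qed

definition below :: "complex \<Rightarrow> complex set" where "below z = {w \<in> Z. lex_le w z}"

definition lexrank :: "complex \<Rightarrow> nat" where "lexrank z = (\<Sum>w\<in>below z. m w)"

lemma finite_below: "z \<in> Z \<Longrightarrow> finite (below z)"
  by (metis (no_types, lifting) D_cover D_finite IntI below_def finite_subset lower_closed mem_Collect_eq subsetI)

text \<open>The point \<open>z\<close> is to occupy the positions after \<open>lexrank' z\<close> up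
  to \<open>lexrank z\<close>, as many as its multiplicity.\<close>

definition lexrank' :: "complex \<Rightarrow> nat" where "lexrank' z = (\<Sum>w\<in>below z - {z}. m w)"

lemma lexrank_eq: "z \<in> Z \<Longrightarrow> lexrank z = lexrank' z + m z"
  using finite_below[of z] by (subst lexrank_def, subst sum.remove[of _ z]) (auto simp: lexrank'_def below_def)

lemma lexrank_less:
  assumes "w \<in> Z" "z \<in> Z" "lex_le w z" "w \<noteq> z" shows "lexrank w \<le> lexrank' z"
  unfolding lexrank_def lexrank'_def
  by (rule sum_mono2)
    (use assms finite_below[of z] lex_le_trans lex_le_antisym in \<open>auto simp: below_def\<close>)

lemma lexrank_interval_unique:
  assumes "w \<in> Z" "z \<in> Z" "lexrank' w < i" "i \<le> lexrank w" "lexrank' z < i" "i \<le> lexrank z"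
  shows "w = z"
proof (rule ccontr)
  assume "w \<noteq> z"
  then show False using lex_le_total[of w z] lexrank_less[of w z] lexrank_less[of z w] assms by auto
qed

lemma exists_greatest_rank:
  assumes "finite P" "P \<noteq> {}" "P \<subseteq> Z"
  obtains z where "z \<in> P" "P \<subseteq> below z"
proof -
  have "Max (lexrank ` P) \<in> lexrank ` P" using assms by (intro Max_in) auto
  then obtain z where "z \<in> P" "lexrank z = Max (lexrank ` P)" by auto
  then have z: "z \<in> P" "\<And>w. w \<in> P \<Longrightarrow> lexrank w \<le> lexrank z" using assms by auto
  have "lex_le w z" if "w \<in> P" for w
  proof (rule ccontr)
    assume n: "\<not> lex_le w z"
    then have "lex_le z w" "z \<noteq> w" using lex_le_total by auto
    then have "lexrank z \<le> lexrank' w" using lexrank_less[of z w] z that assms by auto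
    moreover have "lexrank' w < lexrank w" using lexrank_eq[of w] m_pos[of w] that assms by auto
    ultimately show False using z(2)[OF that] by simp
  qed
  then show ?thesis using that[of z] z assms by (auto simp: below_def)
qed

lemma lexrank_interval_exists:
  assumes "i \<ge> 1" shows "\<exists>z\<in>Z. lexrank' z < i \<and> i \<le> lexrank z"
proof -
  \<comment> \<open>\<open>D n\<close> contains at least \<open>i\<close> points by multiplicity, so
    its lexicographically last point has rank at least \<open>i\<close>.\<close>
  define n where "n = max i n0"
  define S where "S = {z \<in> Z \<inter> D n. i \<le> lexrank z}"
  have fin: "finite (Z \<inter> D n)" by (rule D_finite) (simp add: n_def)
  have ne: "Z \<inter> D n \<noteq> {}" using D_card[of n] assms by (auto simp: n_def)
  obtain z where z: "z \<in> Z \<inter> D n" "Z \<inter> D n \<subseteq> below z" using exists_greatest_rank[OF fin ne] by blast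
  have "(\<Sum>z\<in>Z \<inter> D n. m z) \<le> lexrank z"
    unfolding lexrank_def using z finite_below[of z] by (intro sum_mono2) auto
  then have "n \<le> lexrank z" using D_card[of n] by (simp add: n_def)
  then have "z \<in> S" using z by (auto simp: S_def n_def)
  then obtain u where u: "u \<in> S" "\<And>w. w \<in> S \<Longrightarrow> lexrank u \<le> lexrank w"
    using arg_min_natI[of "\<lambda>x. x \<in> S" z lexrank] arg_min_nat_le[of "\<lambda>x. x \<in> S" _ lexrank] by blast
  have uZ: "u \<in> Z" "u \<in> D n" "i \<le> lexrank u" using u by (auto simp: S_def)
  \<comment> \<open>Otherwise the immediate predecessor of \<open>u\<close> would already have rank
    at least \<open>i\<close>, against the minimality of \<open>u\<close>.\<close>
  have "lexrank' u < i"
  proof (rule ccontr)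
    assume "\<not> lexrank' u < i"
    then have i: "i \<le> lexrank' u" by simp
    define P where "P = below u - {u}"
    have P: "finite P" "P \<subseteq> Z" using finite_below[OF uZ(1)] by (auto simp: P_def below_def)
    have "P \<noteq> {}" using i assms unfolding lexrank'_def P_def[symmetric] by (cases "P = {}") auto
    then obtain w where w: "w \<in> P" "P \<subseteq> below w" using exists_greatest_rank[OF P(1) _ P(2)] by blast
    have wZ: "w \<in> Z" "lex_le w u" "w \<noteq> u" using w by (auto simp: P_def below_def)
    have "lexrank' u \<le> lexrank w"
      unfolding lexrank'_def lexrank_def P_def[symmetric] using w finite_below[OF wZ(1)] by (intro sum_mono2) auto
    moreover have "w \<in> D n" using lower_closed[of n u w] uZ wZ by (simp add: n_def)
    ultimately have "w \<in> S" using i wZ by (simp add: S_def)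
    then have "lexrank u \<le> lexrank w" by (rule u(2))
    also have "lexrank w \<le> lexrank' u" by (rule lexrank_less[OF wZ(1) uZ(1) wZ(2,3)])
    also have "lexrank' u < lexrank u" using lexrank_eq[OF uZ(1)] m_pos[OF uZ(1)] by simp
    finally show False by simp
  qed
  then show ?thesis using uZ by blast
qed

lemma listing_exists:
  "\<exists>\<mu> :: nat \<Rightarrow> complex. (\<forall>i j. 1 \<le> i \<and> i \<le> j \<longrightarrow> lex_le (\<mu> i) (\<mu> j)) \<and> (\<forall>i\<ge>1. \<mu> i \<in> Z)
     \<and> (\<forall>\<nu>\<in>Z. finite {i. 1 \<le> i \<and> \<mu> i = \<nu>} \<and> card {i. 1 \<le> i \<and> \<mu> i = \<nu>} = m \<nu>)"
proof -
  obtain \<mu> where \<mu>: "\<And>i. i \<ge> 1 \<Longrightarrow> \<mu> i \<in> Z \<and> lexrank' (\<mu> i) < i \<and> i \<le> lexrank (\<mu> i)"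
    using lexrank_interval_exists by metis
  have mono: "lex_le (\<mu> i) (\<mu> j)" if ij: "1 \<le> i" "i \<le> j" for i j
  proof (rule ccontr)
    assume "\<not> lex_le (\<mu> i) (\<mu> j)"
    then have "lex_le (\<mu> j) (\<mu> i)" "\<mu> j \<noteq> \<mu> i" using lex_le_total by auto
    then have "lexrank (\<mu> j) \<le> lexrank' (\<mu> i)" using lexrank_less \<mu>[of i] \<mu>[of j] ij by auto
    then show False using \<mu>[of i] \<mu>[of j] ij by auto
  qed
  have fin: "finite {i. 1 \<le> i \<and> \<mu> i = \<nu>} \<and> card {i. 1 \<le> i \<and> \<mu> i = \<nu>} = m \<nu>" if \<nu>: "\<nu> \<in> Z" for \<nu>
  proof -
    have "{i. 1 \<le> i \<and> \<mu> i = \<nu>} = {lexrank' \<nu><..lexrank \<nu>}"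
    proof (intro equalityI subsetI)
      fix i assume i: "i \<in> {lexrank' \<nu><..lexrank \<nu>}"
      then have "1 \<le> i" by auto
      then show "i \<in> {i. 1 \<le> i \<and> \<mu> i = \<nu>}"
        using lexrank_interval_unique[of "\<mu> i" \<nu> i] \<mu>[of i] \<nu> i by auto
    qed (use \<mu> in auto)
    then show ?thesis using lexrank_eq[OF \<nu>] by simp
  qed
  show ?thesis
  proof (rule exI[of _ \<mu>], intro conjI)
    show "\<forall>i j. 1 \<le> i \<and> i \<le> j \<longrightarrow> lex_le (\<mu> i) (\<mu> j)" using mono by simp
    show "\<forall>i\<ge>1. \<mu> i \<in> Z" using \<mu> by simp
    show "\<forall>\<nu>\<in>Z. finite {i. 1 \<le> i \<and> \<mu> i = \<nu>} \<and> card {i. 1 \<le> i \<and> \<mu> i = \<nu>} = m \<nu>" using fin by simp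
  qed
qed

text \<open>Because \<open>D n\<close> is closed downwards, the positions it fills form an initial
  segment, and their number is the total multiplicity \<open>n\<close>. This holds for every
  listing, hence also for one obtained by choice.\<close>

lemma listing_position:
  assumes mono: "\<And>i j. 1 \<le> i \<Longrightarrow> i \<le> j \<Longrightarrow> lex_le (\<mu> i) (\<mu> j)" and mem: "\<And>i. 1 \<le> i \<Longrightarrow> \<mu> i \<in> Z"
    and card: "\<And>\<nu>. \<nu> \<in> Z \<Longrightarrow> finite {i. 1 \<le> i \<and> \<mu> i = \<nu>} \<and> card {i. 1 \<le> i \<and> \<mu> i = \<nu>} = m \<nu>"
    and n: "n \<ge> n0"
  shows "{i. 1 \<le> i \<and> \<mu> i \<in> D n} = {1..n}"
proof -
  define A where "A = {i. 1 \<le> i \<and> \<mu> i \<in> D n}"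
  have "A = (\<Union>\<nu>\<in>Z \<inter> D n. {i. 1 \<le> i \<and> \<mu> i = \<nu>})" using mem by (auto simp: A_def)
  then have "finite A" "card A = (\<Sum>\<nu>\<in>Z \<inter> D n. card {i. 1 \<le> i \<and> \<mu> i = \<nu>})"
    using D_finite[OF n] card card_UN_disjoint[of "Z \<inter> D n" "\<lambda>\<nu>. {i. 1 \<le> i \<and> \<mu> i = \<nu>}"] by auto
  moreover have "(\<Sum>\<nu>\<in>Z \<inter> D n. card {i. 1 \<le> i \<and> \<mu> i = \<nu>}) = n"
    using card D_card[OF n] by simp
  ultimately have fin: "finite A" and cardA: "card A = n" by auto
  have down: "j \<in> A" if "i \<in> A" "1 \<le> j" "j \<le> i" for i j
    using lower_closed[OF n, of "\<mu> i" "\<mu> j"] mem mono that by (auto simp: A_def)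
  have "A = {1..n}"
  proof (cases "A = {}")
    case True
    then show ?thesis using cardA by auto
  next
    case False
    have "A = {1..Max A}"
      using down[OF Max_in[OF fin False]] Max_ge[OF fin] by (auto simp: A_def)
    then show ?thesis using cardA by (metis card_atLeastAtMost diff_Suc_1)
  qed
  then show ?thesis by (simp add: A_def)
qed

end

text \<open>The square of |sin z| splits into the squares of sin (Re z) and sinh (Im z). Being small
  relative to \<open>E = exp \<bar>Im z\<bar>\<close> forces \<open>E^2 < 25 / 24\<close>, so
  \<bar>Im z\<bar> is at most 1/48; then \<bar>sin (Re z)\<bar> is at most 1/48, and Re z lies
  within 1/24 of a multiple of pi.\<close>

lemma sin_small_imp_near_multiple_pi:
  assumes "cmod (sin z) < exp \<bar>Im z\<bar> / 50"
  obtains k :: int where "cmod (z - of_int k * pi) \<le> 1 / 10"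
proof -
  define x where "x = Re z"
  define E where "E = exp \<bar>Im z\<bar>"
  have E: "E \<ge> 1" by (simp add: E_def)
  have EE: "exp (2 * Im z) + inverse (exp (2 * Im z)) = E\<^sup>2 + 1 / E\<^sup>2"
    by (cases "Im z \<ge> 0") (auto simp: E_def exp_minus inverse_eq_divide power2_eq_square exp_add[symmetric])
  have sq: "(cmod (sin z))\<^sup>2 = (sin x)\<^sup>2 + ((E - 1 / E) / 2)\<^sup>2"
    using E unfolding norm_sin_squared EE x_def[symmetric] cos_double_sin[of x] by (simp add: power2_eq_square field_simps)
  have lt: "cmod (sin z) < E / 50" using assms by (simp add: E_def)
  have "((E - 1 / E) / 2)\<^sup>2 \<le> (cmod (sin z))\<^sup>2" unfolding sq by simp
  then have "(E - 1 / E) / 2 \<le> cmod (sin z)" by (rule power2_le_imp_le) simp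
  then have "E - 1 / E < E / 25" using lt by simp
  then have "E * (E - 1 / E) < E * (E / 25)" using E by (intro mult_strict_left_mono) auto
  then have E2: "E\<^sup>2 < 25 / 24" using E by (simp add: power2_eq_square field_simps)
  have "E\<^sup>2 = exp (2 * \<bar>Im z\<bar>)" by (simp add: E_def power2_eq_square exp_add[symmetric])
  then have "1 + 2 * \<bar>Im z\<bar> \<le> E\<^sup>2" using exp_ge_add_one_self[of "2 * \<bar>Im z\<bar>"] by simp
  then have Im: "\<bar>Im z\<bar> \<le> 1 / 48" using E2 by simp
  have "(sin x)\<^sup>2 \<le> (cmod (sin z))\<^sup>2" unfolding sq by simp
  also have "\<dots> \<le> (E / 50)\<^sup>2" using lt by (intro power_mono) auto
  also have "\<dots> \<le> (1 / 48)\<^sup>2" using E2 by (simp add: power_divide)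
  finally have sx: "\<bar>sin x\<bar> \<le> 1 / 48" using abs_le_square_iff[of "sin x" "1 / 48"] by simp
  define k where "k = round (x / pi)"
  define t where "t = x - of_int k * pi"
  have "\<bar>x / pi - of_int k\<bar> \<le> 1 / 2" unfolding k_def using of_int_round_abs_le[of "x / pi"] by (simp add: abs_minus_commute)
  then have "\<bar>x / pi - of_int k\<bar> * pi \<le> 1 / 2 * pi" by (intro mult_right_mono) auto
  then have t: "\<bar>t\<bar> \<le> pi / 2" by (simp add: t_def abs_mult[symmetric, of _ pi, simplified] left_diff_distrib)
  have "\<bar>sin x\<bar> = \<bar>sin t\<bar>"
  proof -
    have "x = t + pi * of_int k" by (simp add: t_def)
    then have "sin x = sin t * cos (pi * of_int k)" by (simp add: sin_add sin_npi_int)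
    then show ?thesis by (simp add: abs_mult cos_npi_int)
  qed
  moreover have "\<bar>t\<bar> / 2 \<le> \<bar>sin t\<bar>" using sin_ge_half[of "\<bar>t\<bar>"] t by (cases "t \<ge> 0") auto
  ultimately have "\<bar>t\<bar> \<le> 1 / 24" using sx by simp
  then have "cmod (z - of_int k * pi) \<le> 1 / 10"
    using cmod_le[of "z - of_int k * pi"] Im by (simp add: t_def x_def)
  then show ?thesis by (rule that)
qed

section \<open>The zero potential as comparison problem\<close>

lemma sin_multiple_pi: "sin (of_real (of_nat k * pi) :: complex) = 0"
  by (metis sin_of_real sin_npi of_real_0)

text \<open>The asymptotic formula is exact when the L1 norm is 0. The value at spectral parameter
  0, which has no nonzero root, comes from the Volterra equation.\<close>

lemma y2_zero_potential:
  shows "z \<noteq> 0 \<Longrightarrow> y2 (\<lambda>_. 0) 1 (z\<^sup>2) = sin z / z" and "y2 (\<lambda>_. 0) 1 0 = 1"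
proof -
  have q: "(\<lambda>_. 0 :: complex) absolutely_integrable_on {0..1::real}" by simp
  have L: "L1_norm (\<lambda>_. 0) = 0" by (simp add: L1_norm_def)
  show "z \<noteq> 0 \<Longrightarrow> y2 (\<lambda>_. 0) 1 (z\<^sup>2) = sin z / z" using y2_asymptotics[OF q, of z] by (simp add: L)
  show "y2 (\<lambda>_. 0) 1 0 = 1"
    using schroedinger_solution_volterra[OF q y2_solution(1)[OF q, of 0], of 1] by (simp add: y2_solution[OF q])
qed

lemma y2_zero_potential_zeros:
  "y2 (\<lambda>_. 0) 1 \<nu> = 0 \<longleftrightarrow> (\<exists>k::nat. k \<ge> 1 \<and> \<nu> = of_real ((of_nat k * pi)\<^sup>2))"
proof
  assume 0: "y2 (\<lambda>_. 0) 1 \<nu> = 0"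
  define z where "z = csqrt \<nu>"
  have \<nu>: "\<nu> = z\<^sup>2" by (simp add: z_def)
  have z: "z \<noteq> 0" using 0 y2_zero_potential(2) by (auto simp: \<nu>)
  then have "sin z = 0" using 0 y2_zero_potential(1)[OF z] by (simp add: \<nu>)
  then obtain n :: int where n: "z = of_real (n * pi)" by (auto simp: sin_eq_0)
  then have "n \<noteq> 0" using z by auto
  then have "nat \<bar>n\<bar> \<ge> 1" "\<nu> = of_real ((of_nat (nat \<bar>n\<bar>) * pi)\<^sup>2)" by (auto simp: \<nu> n power_mult_distrib)
  then show "\<exists>k::nat. k \<ge> 1 \<and> \<nu> = of_real ((of_nat k * pi)\<^sup>2)" by blast
next
  assume "\<exists>k::nat. k \<ge> 1 \<and> \<nu> = of_real ((of_nat k * pi)\<^sup>2)"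
  then obtain k :: nat where k: "k \<ge> 1" "\<nu> = of_real ((of_nat k * pi)\<^sup>2)" by blast
  have "sin (of_real (of_nat k * pi) :: complex) = 0" by (rule sin_multiple_pi)
  then show "y2 (\<lambda>_. 0) 1 \<nu> = 0"
    using y2_zero_potential(1)[of "of_real (of_nat k * pi)"] k by simp
qed

lemma y2_zero_potential_zorder:
  assumes k: "k \<ge> (1::nat)"
  shows "zorder (y2 (\<lambda>_. 0) 1) (of_real ((of_nat k * pi)\<^sup>2)) = 1"
proof -
  have q: "(\<lambda>_. 0 :: complex) absolutely_integrable_on {0..1::real}" by simp
  define w :: complex where "w = of_real (of_nat k * pi)"
  have w: "w \<noteq> 0" "csqrt (w\<^sup>2) = w" "w\<^sup>2 \<notin> \<real>\<^sub>\<le>\<^sub>0"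
  proof -
    have "real k * pi > 0" using k by simp
    then have "(real k * pi) * (real k * pi) > 0" by (rule mult_pos_pos) fact
    moreover have "w\<^sup>2 = of_real ((real k * pi) * (real k * pi))" by (simp add: w_def power2_eq_square)
    ultimately have "Re (w\<^sup>2) > 0" by (simp only: Re_complex_of_real)
    then show "w\<^sup>2 \<notin> \<real>\<^sub>\<le>\<^sub>0" by (simp only: complex_nonpos_Reals_iff) linarith
    show "w \<noteq> 0" "csqrt (w\<^sup>2) = w"
      using k by (auto simp: w_def csqrt_square)
  qed
  have sw: "sin w = 0" unfolding w_def by (rule sin_multiple_pi)
  have cw: "cos w \<noteq> 0" using sin_cos_squared_add[of w] sw by auto
  have "((\<lambda>\<nu>. sin (csqrt \<nu>) / csqrt \<nu>) has_field_derivative cos w / (2 * w\<^sup>2)) (at (w\<^sup>2))"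
    using w by (auto intro!: derivative_eq_intros simp: sw power2_eq_square field_simps)
  then have "(y2 (\<lambda>_. 0) 1 has_field_derivative cos w / (2 * w\<^sup>2)) (at (w\<^sup>2))"
  proof (rule has_field_derivative_transform_within_open[of _ _ _ "- {0}"])
    show "sin (csqrt x) / csqrt x = y2 (\<lambda>_. 0) 1 x" if "x \<in> - {0}" for x
      using y2_zero_potential(1)[of "csqrt x"] that by simp
  qed (use w in auto)
  then have d: "deriv (y2 (\<lambda>_. 0) 1) (w\<^sup>2) \<noteq> 0" using w cw by (simp add: DERIV_imp_deriv)
  have "y2 (\<lambda>_. 0) 1 (w\<^sup>2) = 0" using y2_zero_potential(1)[of w] w sw by simp
  then have "zorder (y2 (\<lambda>_. 0) 1) (w\<^sup>2) = 1"
    using d by (intro zorder_zero_eqI[OF y2_holomorphic[OF q, of UNIV]]) auto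
  then show ?thesis by (simp add: w_def)
qed

section \<open>Counting zeros in discs\<close>

definition zero_radius :: "nat \<Rightarrow> real" where "zero_radius n = ((of_nat n + 1 / 2) * pi)\<^sup>2"

lemma sqrt_zero_radius: "sqrt (zero_radius n) = (of_nat n + 1 / 2) * pi"
  by (simp add: zero_radius_def)

lemma zero_radius_pos: "zero_radius n > 0"
  by (simp add: zero_radius_def add_pos_nonneg)

text \<open>The condition on \<open>n0\<close> ensures \<open>100 * M < norm z\<close> for the roots
  z of all parameters outside the disc of index \<open>n0\<close>; the perturbation of
  \<open>sin z / z\<close> is then below \<open>exp \<bar>Im z\<bar> / (50 * norm z)\<close>,
  matching the threshold 1/50 for the sine.\<close>

locale dirichlet_counting =
  fixes q :: "real \<Rightarrow> complex" and M :: real and n0 :: nat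
  assumes q: "q absolutely_integrable_on {0..1}" and M: "L1_norm q \<le> M"
    and n0: "100 * M < (of_nat n0 + 1 / 2) * pi"
begin

abbreviation "G \<equiv> y2 q 1"
abbreviation "G0 \<equiv> y2 (\<lambda>_. 0 :: complex) 1"

lemma M_nonneg: "M \<ge> 0" using L1_norm_nonneg[OF q] M by simp

lemma zero_q: "(\<lambda>_. 0 :: complex) absolutely_integrable_on {0..1::real}" by simp

lemma G_diff:
  assumes "n \<ge> n0" "cmod \<nu> \<ge> zero_radius n"
  shows "cmod (G \<nu> - sin (csqrt \<nu>) / csqrt \<nu>) < exp \<bar>Im (csqrt \<nu>)\<bar> / (50 * cmod (csqrt \<nu>))"
    and "csqrt \<nu> \<noteq> 0" and "(of_nat n + 1 / 2) * pi \<le> cmod (csqrt \<nu>)" and "100 * M < cmod (csqrt \<nu>)"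
proof -
  define z where "z = csqrt \<nu>"
  have \<nu>: "\<nu> = z\<^sup>2" by (simp add: z_def)
  have zs: "cmod z = sqrt (cmod \<nu>)" by (simp add: \<nu> norm_power)
  have "sqrt (zero_radius n) \<le> cmod z" unfolding zs using assms(2) by (rule real_sqrt_le_mono)
  then show zn: "(of_nat n + 1 / 2) * pi \<le> cmod (csqrt \<nu>)" by (simp add: sqrt_zero_radius z_def)
  have "(of_nat n0 + 1 / 2) * pi \<le> (of_nat n + 1 / 2) * pi" using assms(1) by (intro mult_right_mono) auto
  then show zM: "100 * M < cmod (csqrt \<nu>)" using n0 zn by linarith
  then show z0: "csqrt \<nu> \<noteq> 0" using M_nonneg by auto
  have "cmod (G (z\<^sup>2) - sin z / z) \<le> 2 * L1_norm q * exp \<bar>Im z\<bar> / (cmod z)\<^sup>2"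
    by (rule y2_asymptotics[OF q]) (use z0 zM M M_nonneg in \<open>auto simp: z_def\<close>)
  also have "\<dots> \<le> 2 * M * exp \<bar>Im z\<bar> / (cmod z)\<^sup>2"
    using M by (intro divide_right_mono mult_right_mono) auto
  also have "\<dots> < exp \<bar>Im z\<bar> / (50 * cmod z)"
  proof -
    have "2 * M * exp \<bar>Im z\<bar> / (cmod z)\<^sup>2 = (100 * M / cmod z) * (exp \<bar>Im z\<bar> / (50 * cmod z))"
      by (simp add: power2_eq_square)
    also have "\<dots> < 1 * (exp \<bar>Im z\<bar> / (50 * cmod z))"
      using zM z0 by (intro mult_strict_right_mono) (auto simp: z_def divide_less_eq)
    finally show ?thesis by simp
  qed
  finally show "cmod (G \<nu> - sin (csqrt \<nu>) / csqrt \<nu>) < exp \<bar>Im (csqrt \<nu>)\<bar> / (50 * cmod (csqrt \<nu>))"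
    by (simp add: \<nu>[symmetric] z_def[symmetric] del: csqrt_square)
qed

text \<open>The radius is chosen so that the root has modulus (n + 1/2) pi, halfway between
  consecutive zeros of the sine. It is therefore more than 1/10 away from every multiple of pi, and
  the sine cannot be small.\<close>

lemma circle_estimate:
  assumes n: "n \<ge> n0" and \<nu>: "cmod \<nu> = zero_radius n"
  shows "cmod (G \<nu> - G0 \<nu>) < cmod (G0 \<nu>)" and "G \<nu> \<noteq> 0"
proof -
  define z where "z = csqrt \<nu>"
  have \<nu>z: "\<nu> = z\<^sup>2" by (simp add: z_def)
  note D = G_diff[OF n, of \<nu>, folded z_def]
  have z0: "z \<noteq> 0" using D \<nu> by simp
  have cz: "cmod z = (of_nat n + 1 / 2) * pi"
    unfolding sqrt_zero_radius[symmetric] \<nu>[symmetric] by (simp add: \<nu>z norm_power)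
  have ge: "cmod (sin z) \<ge> exp \<bar>Im z\<bar> / 50"
  proof (rule ccontr)
    assume "\<not> cmod (sin z) \<ge> exp \<bar>Im z\<bar> / 50"
    then obtain k :: int where k: "cmod (z - of_int k * pi) \<le> 1 / 10"
      using sin_small_imp_near_multiple_pi[of z] by auto
    have "cmod (of_int k * of_real pi) = of_int \<bar>k\<bar> * pi" by (simp add: norm_mult)
    then have le: "\<bar>(of_nat n + 1 / 2) * pi - of_int \<bar>k\<bar> * pi\<bar> \<le> 1 / 10"
      using norm_triangle_ineq3[of z "of_int k * of_real pi"] k cz by simp
    have "real_of_int \<bar>k\<bar> \<le> real_of_int (int n) \<or> real_of_int (int n + 1) \<le> real_of_int \<bar>k\<bar>"
      unfolding of_int_le_iff by linarith
    then have "1 / 2 \<le> \<bar>of_nat n + 1 / 2 - real_of_int \<bar>k\<bar>\<bar>" by auto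
    then have "1 / 2 * pi \<le> \<bar>of_nat n + 1 / 2 - real_of_int \<bar>k\<bar>\<bar> * pi" by (intro mult_right_mono) auto
    also have "\<dots> = \<bar>(of_nat n + 1 / 2) * pi - of_int \<bar>k\<bar> * pi\<bar>" by (simp add: abs_mult[symmetric, of _ pi, simplified] left_diff_distrib)
    finally show False using le pi_gt3 by linarith
  qed
  have G0: "G0 \<nu> = sin z / z" using y2_zero_potential(1)[OF z0] by (simp add: \<nu>z)
  have "cmod (G \<nu> - G0 \<nu>) < exp \<bar>Im z\<bar> / (50 * cmod z)" using D(1) \<nu> by (simp add: G0)
  also have "\<dots> \<le> cmod (G0 \<nu>)"
    unfolding G0 norm_divide using ge z0 divide_right_mono[OF ge, of "cmod z"] by simp
  finally show lt: "cmod (G \<nu> - G0 \<nu>) < cmod (G0 \<nu>)" .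
  show "G \<nu> \<noteq> 0" using lt by auto
qed

lemma zero_location:
  assumes "n \<ge> n0" "cmod \<nu> \<ge> zero_radius n" "G \<nu> = 0"
  obtains k :: nat where "k > n" "cmod (csqrt \<nu> - of_nat k * pi) \<le> 1 / 10"
proof -
  define z where "z = csqrt \<nu>"
  note D = G_diff[OF assms(1,2), folded z_def]
  have z0: "cmod z > 0" using D(2) by simp
  have "cmod (sin z) / cmod z < exp \<bar>Im z\<bar> / (50 * cmod z)"
    using D(1) assms(3) by (simp add: norm_divide)
  then have "cmod (sin z) < exp \<bar>Im z\<bar> / 50" using z0 by (simp add: field_simps)
  then obtain k :: int where k: "cmod (z - of_int k * pi) \<le> 1 / 10" by (rule sin_small_imp_near_multiple_pi)
  \<comment> \<open>The principal root has nonnegative real part, which excludes negative multiples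
    of pi.\<close>
  have "Re z \<ge> 0" using csqrt_principal[of \<nu>] by (auto simp: z_def)
  moreover have "\<bar>Re (z - of_int k * pi)\<bar> \<le> 1 / 10" using abs_Re_le_cmod k order_trans by blast
  moreover have "Re (z - of_int k * pi) = Re z - of_int k * pi" by simp
  ultimately have kge: "- (1/10) \<le> of_int k * pi" by linarith
  have k0: "k \<ge> 0"
  proof (rule ccontr)
    assume "\<not> k \<ge> 0"
    then have "real_of_int k \<le> -1" by linarith
    then have "of_int k * pi \<le> -1 * pi" by (rule mult_right_mono) simp
    then show False using kge pi_gt3 by linarith
  qed
  have "cmod z \<le> cmod (z - of_int k * pi) + cmod (of_int k * of_real pi)" using norm_triangle_sub[of z "of_int k * pi"] by simp
  also have "cmod (of_int k * of_real pi) = of_int k * pi" using k0 by (simp add: norm_mult)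
  finally have "(of_nat n + 1 / 2) * pi \<le> 1 / 10 + of_int k * pi" using k D(3) by simp
  moreover have "(of_nat n + 1 / 2) * pi = of_nat n * pi + pi / 2" by (simp add: algebra_simps)
  ultimately have "of_nat n * pi < of_int k * pi" using pi_gt3 by linarith
  then have "int n < k" by simp
  then show ?thesis using that[of "nat k"] k k0 by (simp add: z_def nat_less_iff)
qed

text \<open>A constant \<open>G\<close> would be nonzero by \<open>circle_estimate\<close>. At the
  squares of large multiples of pi, however, the sine vanishes and \<open>G\<close> is arbitrarily
  small.\<close>

lemma finite_zeros: "finite {\<nu> \<in> cball 0 r. G \<nu> = 0}" and G_not_constant: "\<not> G constant_on UNIV"
proof -
  show nc: "\<not> G constant_on UNIV"
  proof
    assume "G constant_on UNIV"
    then obtain c where c: "\<And>\<nu>. G \<nu> = c" by (auto simp: constant_on_def)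
    have "c \<noteq> 0" using circle_estimate(2)[of n0 "of_real (zero_radius n0)"] zero_radius_pos[of n0] by (auto simp: c)
    obtain k :: nat where k: "k > max (n0 + 1) (nat \<lceil>1 / cmod c\<rceil>)" using reals_Archimedean2 by (meson gt_ex)
    define z :: complex where "z = of_real (of_nat k * pi)"
    have sz: "sin z = 0" unfolding z_def by (rule sin_multiple_pi)
    have cz: "cmod z = of_nat k * pi" by (simp add: z_def norm_mult)
    have cs: "csqrt (z\<^sup>2) = z" using k by (intro csqrt_square) (simp add: z_def)
    have "(of_nat n0 + 1 / 2) * pi \<le> of_nat k * pi" using k by (intro mult_right_mono) auto
    then have "zero_radius n0 \<le> cmod (z\<^sup>2)"
      unfolding zero_radius_def norm_power cz by (intro power_mono) auto
    from G_diff(1)[OF order_refl this] have "cmod c < 1 / (50 * (of_nat k * pi))"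
      unfolding cs cz by (simp add: sz c) (simp add: z_def)
    also have "\<dots> \<le> 1 / of_nat k" using k pi_gt3 by (intro divide_left_mono) (auto simp: mult_le_cancel_left1 intro!: mult_pos_pos)
    also have "\<dots> \<le> cmod c"
    proof -
      have "1 / cmod c \<le> of_nat k" using k by linarith
      then show ?thesis using k \<open>c \<noteq> 0\<close> by (simp add: field_simps)
    qed
    finally show False by simp
  qed
  show "finite {\<nu> \<in> cball 0 r. G \<nu> = 0}"
    by (rule holomorphic_compact_finite_zeros[of _ UNIV]) (use nc y2_holomorphic[OF q] in auto)
qed

lemma zorder_zero_pos: "G \<nu> = 0 \<Longrightarrow> zorder G \<nu> > 0"
proof -
  assume 0: "G \<nu> = 0"
  have "\<not> \<nu> islimpt {w \<in> cball 0 (cmod \<nu> + 1). G w = 0}"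
    using finite_zeros islimpt_finite by blast
  moreover have "eventually (\<lambda>w. w \<in> ball \<nu> 1) (at \<nu>)"
    using eventually_at_ball[of 1 \<nu> UNIV] by simp
  ultimately have "eventually (\<lambda>w. G w \<noteq> 0) (at \<nu>)"
    unfolding islimpt_iff_eventually not_not
  proof (eventually_elim)
    case (elim w)
    have "cmod w \<le> cmod \<nu> + 1" using elim(2) norm_triangle_sub[of w \<nu>] by (simp add: dist_norm norm_minus_commute)
    then show ?case using elim(1) by simp
  qed
  then have "frequently (\<lambda>w. G w \<noteq> 0) (at \<nu>)" by (rule eventually_frequently[rotated]) simp
  then show ?thesis using zorder_pos_iff[OF y2_holomorphic[OF q, of UNIV], of \<nu>] 0 by simp
qed

text \<open>Rouche's theorem against the zero potential, whose zeros in this disc are the squares of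
  pi, ..., n pi, all simple.\<close>

lemma zero_count:
  assumes n: "n \<ge> n0"
  shows "(\<Sum>\<nu>\<in>{\<nu> \<in> ball 0 (zero_radius n). G \<nu> = 0}. zorder G \<nu>) = int n"
proof -
  define r where "r = zero_radius n"
  \<comment> \<open>The region must contain the contour; the zeros it has beyond the disc carry
    winding number 0.\<close>
  define s where "s = ball (0::complex) (r + 1)"
  define \<gamma> where "\<gamma> = circlepath 0 r"
  have r: "r > 0" by (simp add: r_def zero_radius_pos)
  \<comment> \<open>The comparison problem is the instance with vanishing bound and threshold 0,
    which supplies its finiteness and nonvanishing statements.\<close>
  interpret Z: dirichlet_counting "\<lambda>_. 0" 0 0
    by unfold_locales (auto simp: L1_norm_def)
  have fin: "finite {p \<in> s. G p = 0}" "finite {p \<in> s. G0 p = 0}"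
    by (rule finite_subset[OF _ finite_zeros[of "r + 1"]], auto simp: s_def)
      (rule finite_subset[OF _ Z.finite_zeros[of "r + 1"]], auto simp: s_def)
  have wind: "winding_number \<gamma> p = (if p \<in> ball 0 r then 1 else 0)" if "p \<in> s" "cmod p \<noteq> r" for p
  proof (cases "p \<in> ball 0 r")
    case True
    then show ?thesis by (simp add: \<gamma>_def winding_number_circlepath)
  next
    case False
    then have "winding_number \<gamma> p = 0" unfolding \<gamma>_def
      by (intro winding_number_zero_outside[of _ "cball 0 r"]) (use r that in auto)
    then show ?thesis using False by simp
  qed
  have red: "(\<Sum>p\<in>{p \<in> s. f p = 0}. winding_number \<gamma> p * of_int (zorder f p))
     = (\<Sum>p\<in>{p \<in> ball 0 r. f p = 0}. of_int (zorder f p))"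
    if "finite {p \<in> s. f p = 0}" "\<And>p. cmod p = r \<Longrightarrow> f p \<noteq> 0" for f :: "complex \<Rightarrow> complex"
  proof -
    have "(\<Sum>p\<in>{p \<in> s. f p = 0}. winding_number \<gamma> p * of_int (zorder f p))
       = (\<Sum>p\<in>{p \<in> s. f p = 0}. if p \<in> ball 0 r then of_int (zorder f p) else 0)"
    proof (intro sum.cong refl)
      fix p assume "p \<in> {p \<in> s. f p = 0}"
      then have "p \<in> s" "cmod p \<noteq> r" using that(2)[of p] by auto
      then show "winding_number \<gamma> p * of_int (zorder f p) = (if p \<in> ball 0 r then of_int (zorder f p) else 0)"
        by (simp add: wind)
    qed
    also have "\<dots> = (\<Sum>p\<in>{p \<in> s. f p = 0} \<inter> ball 0 r. of_int (zorder f p))"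
      using that(1) by (simp add: sum.inter_restrict)
    also have "{p \<in> s. f p = 0} \<inter> ball 0 r = {p \<in> ball 0 r. f p = 0}" by (auto simp: s_def)
    finally show ?thesis .
  qed
  have "(\<Sum>p\<in>{p \<in> s. (\<lambda>p. G0 p + (G p - G0 p)) p = 0}. winding_number \<gamma> p * of_int (zorder (\<lambda>p. G0 p + (G p - G0 p)) p))
      = (\<Sum>p\<in>{p \<in> s. G0 p = 0}. winding_number \<gamma> p * of_int (zorder G0 p))"
  proof (rule Rouche_theorem)
    show "G0 holomorphic_on s" by (rule y2_holomorphic[OF zero_q])
    show "(\<lambda>p. G p - G0 p) holomorphic_on s"
      by (intro holomorphic_intros y2_holomorphic[OF q] y2_holomorphic[OF zero_q])
    show "path_image \<gamma> \<subseteq> s" using r by (auto simp: \<gamma>_def s_def)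
    show "\<forall>z\<in>path_image \<gamma>. cmod (G z - G0 z) < cmod (G0 z)"
      using circle_estimate(1)[OF n] r by (auto simp: \<gamma>_def r_def)
    show "\<forall>z. z \<notin> s \<longrightarrow> winding_number \<gamma> z = 0"
    proof (intro allI impI)
      fix z assume "z \<notin> s"
      then show "winding_number \<gamma> z = 0" unfolding \<gamma>_def s_def
        by (intro winding_number_zero_outside[of _ "cball 0 r"]) (use r in auto)
    qed
  qed (use fin in \<open>auto simp: s_def \<gamma>_def\<close>)
  then have "(\<Sum>p\<in>{p \<in> s. G p = 0}. winding_number \<gamma> p * of_int (zorder G p))
      = (\<Sum>p\<in>{p \<in> s. G0 p = 0}. winding_number \<gamma> p * of_int (zorder G0 p))" by simp
  then have "(\<Sum>p\<in>{p \<in> ball 0 r. G p = 0}. complex_of_int (zorder G p)) = (\<Sum>p\<in>{p \<in> ball 0 r. G0 p = 0}. complex_of_int (zorder G0 p))"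
    using red[OF fin(1)] red[OF fin(2)] circle_estimate(2)[OF n] Z.circle_estimate(2)[of n] by (simp add: r_def)
  then have eq: "(\<Sum>p\<in>{p \<in> ball 0 r. G p = 0}. zorder G p) = (\<Sum>p\<in>{p \<in> ball 0 r. G0 p = 0}. zorder G0 p)"
    by (simp only: of_int_sum[symmetric] of_int_eq_iff)
  have set: "{p \<in> ball 0 r. G0 p = 0} = (\<lambda>k. of_real ((of_nat k * pi)\<^sup>2)) ` {1..n}"
  proof -
    have iff: "(of_nat k * pi)\<^sup>2 < r \<longleftrightarrow> k \<le> n" for k
    proof -
      have "(of_nat k * pi)\<^sup>2 < r \<longleftrightarrow> of_nat k * pi < (of_nat n + 1 / 2) * pi"
        unfolding r_def zero_radius_def
      proof
        assume "(of_nat k * pi)\<^sup>2 < ((of_nat n + 1 / 2) * pi)\<^sup>2"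
        then show "of_nat k * pi < (of_nat n + 1 / 2) * pi" by (rule power2_less_imp_less) simp
      qed (intro power_strict_mono, auto)
      also have "\<dots> \<longleftrightarrow> of_nat k < (of_nat n + 1 / 2 :: real)" by simp
      also have "\<dots> \<longleftrightarrow> k \<le> n" by linarith
      finally show ?thesis .
    qed
    have "of_real ((of_nat k * pi)\<^sup>2) \<in> ball (0::complex) r \<longleftrightarrow> k \<le> n" for k
      unfolding mem_ball_0 norm_of_real iff[symmetric] by simp
    then show ?thesis unfolding y2_zero_potential_zeros by fastforce
  qed
  have "(\<Sum>p\<in>{p \<in> ball 0 r. G0 p = 0}. zorder G0 p) = (\<Sum>k\<in>{1..n}. zorder G0 (of_real ((of_nat k * pi)\<^sup>2)))"
    unfolding set by (rule sum.reindex_cong[OF _ refl refl]) (auto simp: inj_on_def power2_eq_iff_nonneg simp del: of_real_power of_real_mult)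
  also have "\<dots> = (\<Sum>k\<in>{1..n}. 1)" by (intro sum.cong refl y2_zero_potential_zorder) auto
  finally show ?thesis unfolding eq[symmetric] by (simp add: r_def)
qed

end

section \<open>Labelling the eigenvalues and bounding kappa\<close>

lemma norm_exp_minus_one_le:
  fixes w :: complex
  assumes "norm w \<le> 1 / 2" shows "norm (exp w - 1) \<le> 2 * norm w"
proof -
  have "norm (exp w - exp 0) \<le> 2 * norm (w - 0)"
  proof (rule field_differentiable_bound[of "cball 0 (1 / 2)" exp exp 2])
    fix z :: complex assume "z \<in> cball 0 (1 / 2)"
    then have "Re z \<le> 1 / 2" using complex_Re_le_cmod[of z] by simp
    then have "norm (exp z) \<le> exp (1 / 2)" by simp
    also have "\<dots> \<le> 2" by (rule exp_half_le2)
    finally show "norm (exp z) \<le> 2" .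
  qed (use assms in \<open>auto intro: DERIV_subset DERIV_exp\<close>)
  then show ?thesis by simp
qed

context dirichlet_counting
begin

text \<open>Separation of moduli is not enough for the lexicographic order. The root lies near k pi
  with \<open>k > n\<close>, so the real part of its square exceeds the radius.\<close>

lemma zero_above_disc:
  assumes n: "n \<ge> n0" and w: "G w = 0" "cmod w \<ge> zero_radius n"
  shows "zero_radius n < Re w"
proof -
  obtain k :: nat where k: "k > n" "cmod (csqrt w - of_nat k * pi) \<le> 1 / 10"
    using zero_location[OF n w(2,1)] .
  define z where "z = csqrt w"
  have r: "\<bar>Re z - of_nat k * pi\<bar> \<le> 1 / 10" "\<bar>Im z\<bar> \<le> 1 / 10"
    using k(2) abs_Re_le_cmod[of "z - of_nat k * pi"] abs_Im_le_cmod[of "z - of_nat k * pi"] by (simp_all add: z_def)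
  have kn: "(of_nat n + 1) * pi \<le> of_nat k * pi" using k(1) by (intro mult_right_mono) auto
  \<comment> \<open>The clearance is pi/2 - 1/10, more than 14/10; its square outweighs the loss of
    at most 1/100 from the imaginary part.\<close>
  then have x: "(of_nat n + 1 / 2) * pi + 14 / 10 \<le> Re z"
  proof -
    have "of_nat k * pi - 1 / 10 \<le> Re z" using r(1) by linarith
    moreover have "(of_nat n + 1) * pi = (of_nat n + 1 / 2) * pi + pi / 2" by (simp add: algebra_simps)
    ultimately show ?thesis using kn pi_gt3 by linarith
  qed
  have a: "(of_nat n + 1 / 2) * pi \<ge> 0" by simp
  have "zero_radius n + 1 \<le> ((of_nat n + 1 / 2) * pi)\<^sup>2 + 2 * ((of_nat n + 1 / 2) * pi) * (14/10) + (14/10)\<^sup>2"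
  proof -
    have "(14 / 10 :: real)\<^sup>2 \<ge> 1" by (simp add: power2_eq_square)
    then show ?thesis unfolding zero_radius_def using a by linarith
  qed
  also have "\<dots> = ((of_nat n + 1 / 2) * pi + 14 / 10)\<^sup>2" by (simp add: power2_sum)
  also have "\<dots> \<le> (Re z)\<^sup>2" using x a by (intro power_mono) auto
  finally have 1: "zero_radius n + 1 \<le> (Re z)\<^sup>2" .
  have "(Im z)\<^sup>2 \<le> (1/10)\<^sup>2" using r(2) by (metis abs_le_square_iff abs_of_nonneg divide_nonneg_nonneg zero_le_numeral zero_le_one)
  moreover have "w = z\<^sup>2" by (simp add: z_def)
  then have "Re w = (Re z)\<^sup>2 - (Im z)\<^sup>2" by (simp add: power2_eq_square)
  ultimately show ?thesis using 1 by (simp add: power2_eq_square)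
qed

sublocale ex: exhausted_multiset "{\<nu>. G \<nu> = 0}" "\<lambda>\<nu>. nat (zorder G \<nu>)" "\<lambda>n. ball 0 (zero_radius n)" n0
proof
  fix z assume "z \<in> {\<nu>. G \<nu> = 0}"
  then show "0 < nat (zorder G z)" using zorder_zero_pos by simp
  obtain k :: nat where k: "cmod z < of_nat k" using reals_Archimedean2 by blast
  have "real k * 1 \<le> (of_nat (max k n0) + 1 / 2) * pi" using pi_gt3 by (intro mult_mono) auto
  moreover have "1 \<le> (of_nat (max k n0) + 1 / 2) * pi"
  proof -
    have "1 / 2 * 2 \<le> (of_nat (max k n0) + 1 / 2) * pi" using pi_gt3 by (intro mult_mono) auto
    then show ?thesis by simp
  qed
  ultimately have "real k * 1 \<le> ((of_nat (max k n0) + 1 / 2) * pi) * ((of_nat (max k n0) + 1 / 2) * pi)"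
    by (intro mult_mono) auto
  then have "cmod z < zero_radius (max k n0)" using k by (simp add: zero_radius_def power2_eq_square)
  then show "\<exists>n\<ge>n0. z \<in> ball 0 (zero_radius n)" by (intro exI[of _ "max k n0"]) auto
next
  fix n assume n: "n0 \<le> n"
  have set: "{\<nu>. G \<nu> = 0} \<inter> ball 0 (zero_radius n) = {\<nu> \<in> ball 0 (zero_radius n). G \<nu> = 0}" by auto
  show fin: "finite ({\<nu>. G \<nu> = 0} \<inter> ball 0 (zero_radius n))"
    unfolding set by (rule finite_subset[OF _ finite_zeros[of "zero_radius n"]]) auto
  have "int (\<Sum>z\<in>{\<nu>. G \<nu> = 0} \<inter> ball 0 (zero_radius n). nat (zorder G z)) = int n"
    unfolding set zero_count[OF n, symmetric] of_nat_sum
    using zorder_zero_pos by (intro sum.cong refl) (auto simp: less_imp_le)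
  then show "(\<Sum>z\<in>{\<nu>. G \<nu> = 0} \<inter> ball 0 (zero_radius n). nat (zorder G z)) = n" by (simp only: of_nat_eq_iff)
  fix z w assume "z \<in> {\<nu>. G \<nu> = 0}" "z \<in> ball 0 (zero_radius n)" "w \<in> {\<nu>. G \<nu> = 0}" "w \<notin> ball 0 (zero_radius n)"
  then show "Re z < Re w"
    using zero_above_disc[OF n, of w] complex_Re_le_cmod[of z] by simp
qed

lemma dirichlet_listing_iff:
  "dirichlet_listing q \<mu> \<longleftrightarrow> (\<forall>i j. 1 \<le> i \<and> i \<le> j \<longrightarrow> lex_le (\<mu> i) (\<mu> j)) \<and> (\<forall>i\<ge>1. \<mu> i \<in> {\<nu>. G \<nu> = 0})
     \<and> (\<forall>\<nu>\<in>{\<nu>. G \<nu> = 0}. finite {i. 1 \<le> i \<and> \<mu> i = \<nu>} \<and> card {i. 1 \<le> i \<and> \<mu> i = \<nu>} = nat (zorder G \<nu>))"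
proof -
  have "int (card A) = zorder G \<nu> \<longleftrightarrow> card A = nat (zorder G \<nu>)" if "G \<nu> = 0" for \<nu> and A :: "nat set"
    using zorder_zero_pos[OF that] by auto
  then show ?thesis unfolding dirichlet_listing_def by auto
qed

lemma dirichlet_listing_dirichlet_ev: "dirichlet_listing q (\<lambda>n. dirichlet_ev n q)"
proof -
  have "\<exists>\<mu>. dirichlet_listing q \<mu>" unfolding dirichlet_listing_iff by (rule ex.listing_exists)
  then show ?thesis unfolding dirichlet_ev_def by (rule someI_ex)
qed

lemma y2_dirichlet_ev: "n \<ge> 1 \<Longrightarrow> y2 q 1 (dirichlet_ev n q) = 0"
  using dirichlet_listing_dirichlet_ev by (simp add: dirichlet_listing_def)

lemma dirichlet_ev_disc:
  assumes "n \<ge> n0" "i \<ge> 1"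
  shows "cmod (dirichlet_ev i q) < zero_radius n \<longleftrightarrow> i \<le> n"
proof -
  note L = dirichlet_listing_dirichlet_ev[unfolded dirichlet_listing_iff]
  have "{i. 1 \<le> i \<and> dirichlet_ev i q \<in> ball 0 (zero_radius n)} = {1..n}"
  proof (rule ex.listing_position[OF _ _ _ assms(1)])
    show "lex_le (dirichlet_ev i q) (dirichlet_ev j q)" if "1 \<le> i" "i \<le> j" for i j
      using L that by simp
    show "dirichlet_ev i q \<in> {\<nu>. G \<nu> = 0}" if "1 \<le> i" for i
      using L that by simp
    show "finite {i. 1 \<le> i \<and> dirichlet_ev i q = \<nu>} \<and> card {i. 1 \<le> i \<and> dirichlet_ev i q = \<nu>} = nat (zorder G \<nu>)"
      if "\<nu> \<in> {\<nu>. G \<nu> = 0}" for \<nu> using conjunct2[OF conjunct2[OF L]] that by (rule bspec)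
  qed
  then have "i \<in> {i. 1 \<le> i \<and> dirichlet_ev i q \<in> ball 0 (zero_radius n)} \<longleftrightarrow> i \<in> {1..n}" by (simp only:)
  then show ?thesis using assms(2) by simp
qed

text \<open>The n-th eigenvalue lies outside the disc of index \<open>n - 1\<close> and inside the
  disc of index \<open>n\<close>, which leaves only the multiple n pi. Both discs must be
  admissible, hence the strict inequality.\<close>

lemma csqrt_dirichlet_ev:
  assumes "n > n0"
  shows "cmod (csqrt (dirichlet_ev n q) - of_nat n * pi) \<le> 1 / 10"
    and "100 * M < cmod (csqrt (dirichlet_ev n q))"
proof -
  define z where "z = csqrt (dirichlet_ev n q)"
  have n1: "n - 1 \<ge> n0" "n \<ge> 1" "n \<ge> n0" using assms by auto
  have out: "cmod (dirichlet_ev n q) \<ge> zero_radius (n - 1)"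
    using dirichlet_ev_disc[OF n1(1,2)] n1 by auto
  have "cmod (dirichlet_ev n q) < zero_radius n" using dirichlet_ev_disc[OF n1(3,2)] by simp
  then have zlt: "cmod z < (of_nat n + 1 / 2) * pi"
    unfolding sqrt_zero_radius[symmetric] z_def by (simp add: norm_csqrt real_sqrt_less_mono)
  show "100 * M < cmod (csqrt (dirichlet_ev n q))" by (rule G_diff(4)[OF n1(1) out])
  obtain k :: nat where k: "k > n - 1" "cmod (z - of_nat k * pi) \<le> 1 / 10"
    using zero_location[OF n1(1) out y2_dirichlet_ev[OF n1(2)]] unfolding z_def .
  have "of_nat k * pi = cmod (of_nat k * of_real pi)" by (simp add: norm_mult)
  also have "\<dots> \<le> cmod z + 1 / 10"
    using norm_triangle_sub[of "of_nat k * of_real pi" z] k(2) by (simp add: norm_minus_commute)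
  finally have "of_nat k * pi < (of_nat n + 1 / 2) * pi + 1 / 10" using zlt by simp
  moreover have "(of_nat n + 1) * pi = (of_nat n + 1 / 2) * pi + pi / 2" by (simp add: algebra_simps)
  ultimately have "of_nat k * pi < (of_nat n + 1) * pi" using pi_gt3 by linarith
  then have "real k < real n + 1" by (rule mult_right_less_imp_less) simp
  then have "k = n" using k(1) by linarith
  then show "cmod (csqrt (dirichlet_ev n q) - of_nat n * pi) \<le> 1 / 10" using k(2) by (simp add: z_def)
qed

lemma exp_kappa:
  assumes "n \<ge> 1"
  shows "exp (- kappa n q) = (-1) ^ n * y1 q 1 (dirichlet_ev n q)"
    and "exp (kappa n q) = (-1) ^ n * y2' q (dirichlet_ev n q) 1"
proof -
  define \<mu> where "\<mu> = dirichlet_ev n q"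
  have W: "y1 q 1 \<mu> * y2' q \<mu> 1 = 1"
    using wronskian_fundamental[OF q, of \<mu>] y2_dirichlet_ev[OF assms] by (simp add: \<mu>_def)
  then have "(-1) ^ n * y1 q 1 \<mu> \<noteq> 0" by auto
  then show 1: "exp (- kappa n q) = (-1) ^ n * y1 q 1 (dirichlet_ev n q)"
    by (simp add: kappa_def \<mu>_def exp_Ln)
  have "((-1) ^ n * y1 q 1 \<mu>) * ((-1) ^ n * y2' q \<mu> 1) = ((-1) ^ n * (-1) ^ n) * (y1 q 1 \<mu> * y2' q \<mu> 1)" by (simp only: mult_ac)
  also have "\<dots> = 1" by (simp add: W flip: power_mult_distrib)
  finally have "exp (- kappa n q) * ((-1) ^ n * y2' q \<mu> 1) = 1" unfolding 1 \<mu>_def .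
  then show "exp (kappa n q) = (-1) ^ n * y2' q (dirichlet_ev n q) 1"
    by (simp add: exp_minus \<mu>_def field_simps)
qed

text \<open>Here both \<open>y1\<close> and the eigenvalue are close to their values for the zero
  potential. The two bounds are the hypotheses on \<open>\<kappa>\<close> and \<open>\<tau>\<close>
  under which the resonant system is solved.\<close>

lemma kappa_small:
  assumes "n > n0"
  shows "cmod (kappa n q) \<le> 1 / 2"
    and "cmod (dirichlet_ev n q + (kappa n q)\<^sup>2 - (of_nat n * pi)\<^sup>2) \<le> of_nat n"
proof -
  define z where "z = csqrt (dirichlet_ev n q)"
  define \<zeta> where "\<zeta> = z - of_nat n * pi"
  have \<mu>: "dirichlet_ev n q = z\<^sup>2" by (simp add: z_def)
  have \<zeta>: "cmod \<zeta> \<le> 1 / 10" and zM: "100 * M < cmod z"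
    using csqrt_dirichlet_ev[OF assms] by (simp_all add: z_def \<zeta>_def)
  have zeq: "z = \<zeta> + of_nat n * pi" by (simp add: \<zeta>_def)
  have z0: "z \<noteq> 0" using zM M_nonneg by auto
  have Im: "\<bar>Im z\<bar> \<le> 1 / 10" using abs_Im_le_cmod[of \<zeta>] \<zeta> by (simp add: zeq)
  have "cos z = (-1) ^ n * cos \<zeta>"
  proof -
    have "cos z = cos \<zeta> * cos (of_nat n * of_real pi) - sin \<zeta> * sin (of_nat n * of_real pi)" by (simp add: zeq cos_add)
    then show ?thesis by simp
  qed
  then have cz: "(-1) ^ n * cos z = cos \<zeta>" by (simp add: mult.assoc[symmetric] flip: power_mult_distrib)
  have "cos \<zeta> - 1 = ((exp (\<i> * \<zeta>) - 1) + (exp (- (\<i> * \<zeta>)) - 1)) / 2" by (simp add: cos_exp_eq)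
  then have "cmod (cos \<zeta> - 1) \<le> (cmod (exp (\<i> * \<zeta>) - 1) + cmod (exp (- (\<i> * \<zeta>)) - 1)) / 2"
    by (simp only: norm_divide norm_numeral) (intro divide_right_mono norm_triangle_ineq, simp)
  also have "\<dots> \<le> (2 * cmod \<zeta> + 2 * cmod \<zeta>) / 2"
    using norm_exp_minus_one_le[of "\<i> * \<zeta>"] norm_exp_minus_one_le[of "- (\<i> * \<zeta>)"] \<zeta> by (simp add: norm_mult)
  also have "\<dots> \<le> 1 / 5" using \<zeta> by simp
  finally have c1: "cmod (cos \<zeta> - 1) \<le> 1 / 5" .
  have "cmod (y1 q 1 (z\<^sup>2) - cos z) \<le> 2 * L1_norm q * exp \<bar>Im z\<bar> / cmod z"
    by (rule y1_asymptotics[OF q z0]) (use zM M M_nonneg in simp)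
  also have "\<dots> \<le> 2 * M * 2 / cmod z"
  proof -
    have "exp \<bar>Im z\<bar> \<le> exp (1 / 2)" using Im by simp
    also have "exp (1 / 2 :: real) \<le> 2" using exp_half_le2 by simp
    finally show ?thesis using M M_nonneg L1_norm_nonneg[OF q] by (intro divide_right_mono mult_mono) auto
  qed
  also have "\<dots> \<le> 4 / 100" using zM z0 M_nonneg by (simp add: divide_le_eq)
  finally have c2: "cmod (y1 q 1 (z\<^sup>2) - cos z) \<le> 4 / 100" .
  \<comment> \<open>The asymptotic error of \<open>y1\<close> contributes 4/100 and the cosine 1/5;
    this keeps the argument of the logarithm within 24/100 of 1, where the modulus of
    \<open>Ln (1 + u)\<close> is at most twice that of \<open>u\<close>.\<close>
  define u where "u = (-1) ^ n * y1 q 1 (z\<^sup>2) - 1"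
  have "u = (-1) ^ n * (y1 q 1 (z\<^sup>2) - cos z) + (cos \<zeta> - 1)" by (simp add: u_def cz right_diff_distrib)
  then have "cmod u \<le> cmod ((-1) ^ n * (y1 q 1 (z\<^sup>2) - cos z)) + cmod (cos \<zeta> - 1)"
    by (simp only: norm_triangle_ineq)
  also have "\<dots> \<le> 4 / 100 + 1 / 5" using c1 c2 by (intro add_mono) (auto simp: norm_mult norm_power)
  finally have u: "cmod u \<le> 24 / 100" by simp
  have "kappa n q = - Ln (1 + u)" by (simp add: kappa_def u_def \<mu>)
  then have k: "cmod (kappa n q) \<le> 48 / 100" using norm_Ln_le[of u] u by simp
  then show "cmod (kappa n q) \<le> 1 / 2" by simp
  have "(cmod (kappa n q))\<^sup>2 \<le> (48 / 100)\<^sup>2" using k by (rule power_mono) simp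
  also have "(48 / 100)\<^sup>2 \<le> (25 / 100 :: real)" by (simp add: power2_eq_square)
  finally have k2: "cmod ((kappa n q)\<^sup>2) \<le> 25 / 100" by (simp only: norm_power)
  have "dirichlet_ev n q - (of_nat n * pi)\<^sup>2 = \<zeta> * (\<zeta> + 2 * of_nat n * pi)"
    by (simp add: \<mu> zeq power2_eq_square algebra_simps)
  also have "cmod \<dots> \<le> 1 / 10 * (1 / 10 + 2 * of_nat n * pi)"
  proof -
    have "cmod (2 * of_nat n * of_real pi) = 2 * of_nat n * pi" by (simp add: norm_mult)
    then have "cmod (\<zeta> + 2 * of_nat n * pi) \<le> 1 / 10 + 2 * of_nat n * pi"
      using norm_triangle_ineq[of \<zeta> "2 * of_nat n * of_real pi"] \<zeta> by simp
    then show ?thesis unfolding norm_mult using \<zeta> by (intro mult_mono) auto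
  qed
  finally have d: "cmod (dirichlet_ev n q - (of_nat n * pi)\<^sup>2) \<le> 1 / 10 * (1 / 10 + 2 * of_nat n * pi)" .
  have "cmod (dirichlet_ev n q + (kappa n q)\<^sup>2 - (of_nat n * pi)\<^sup>2)
     \<le> cmod (dirichlet_ev n q - (of_nat n * pi)\<^sup>2) + cmod ((kappa n q)\<^sup>2)"
    using norm_triangle_ineq[of "dirichlet_ev n q - (of_nat n * pi)\<^sup>2" "(kappa n q)\<^sup>2"] by (simp add: algebra_simps)
  also have "\<dots> \<le> 1 / 10 * (1 / 10 + 2 * of_nat n * pi) + 25 / 100" using d k2 by (rule add_mono)
  also have "\<dots> \<le> of_nat n"
  proof -
    have "of_nat n * pi \<le> of_nat n * (32 / 10)" using pi_approx by (intro mult_left_mono) auto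
    moreover have "real n \<ge> 1" using assms by simp
    ultimately show ?thesis by (simp only: mult.assoc distrib_left)
  qed
  finally show "cmod (dirichlet_ev n q + (kappa n q)\<^sup>2 - (of_nat n * pi)\<^sup>2) \<le> of_nat n" .
qed

text \<open>For the first \<open>n0\<close> indices the eigenvalues lie in a fixed disc. The
  solution bounds estimate \<open>y1\<close> at 1 from above, and from below through its reciprocal
  \<open>y2'\<close>; the argument of the principal logarithm contributes at most pi.\<close>

lemma kappa_bounded:
  assumes n: "1 \<le> n" "n \<le> n0"
  shows "cmod (kappa n q) \<le> 10 * (1 + M + zero_radius n0) * exp (2 * (1 + M + zero_radius n0)) + 4"
proof -
  define \<mu> where "\<mu> = dirichlet_ev n q"
  define R where "R = M + zero_radius n0"
  have R0: "R \<ge> 0" using M_nonneg zero_radius_pos[of n0] by (simp add: R_def)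
  have R: "L1_norm q + norm \<mu> \<le> R" using dirichlet_ev_disc[OF order_refl n(1)] n M by (simp add: \<mu>_def R_def)
  define E where "E = exp (2 * (1 + R))"
  have E: "E \<ge> 1" using R0 by (simp add: E_def)
  have 1: "cmod (y1 q 1 \<mu>) \<le> 2 * E"
    using schroedinger_solution_bound[OF q y1_solution(1)[OF q] R, of 1] by (simp add: y1_solution[OF q] E_def)
  have "cmod (y2 q x \<mu>) \<le> 2 * E" if "x \<in> {0..1}" for x
    using schroedinger_solution_bound[OF q y2_solution(1)[OF q] R that] by (simp add: y2_solution[OF q] E_def)
  from schroedinger_solution_derivative_bound[OF q y2_solution(1)[OF q] R _ this, of 1]
  have 2: "cmod (y2' q \<mu> 1) \<le> 1 + R * (2 * E)" by (simp add: y2_solution[OF q])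
  define B where "B = 2 * (1 + R) * E"
  have 1: "cmod (y1 q 1 \<mu>) \<le> B"
  proof -
    have "2 * E \<le> 2 * (1 + R) * E" using E R0 by (intro mult_right_mono) auto
    then show ?thesis using 1 by (simp add: B_def)
  qed
  have 2: "cmod (y2' q \<mu> 1) \<le> B" using 2 E by (simp add: B_def algebra_simps)
  have W: "y1 q 1 \<mu> * y2' q \<mu> 1 = 1"
    using wronskian_fundamental[OF q, of \<mu>] y2_dirichlet_ev[OF n(1)] by (simp add: \<mu>_def)
  define w where "w = (-1) ^ n * y1 q 1 \<mu>"
  have w: "cmod w = cmod (y1 q 1 \<mu>)" by (simp add: w_def norm_mult norm_power)
  have w0: "w \<noteq> 0" using W by (auto simp: w_def)
  have prod: "cmod w * cmod (y2' q \<mu> 1) = 1" unfolding w using W by (metis norm_mult norm_one)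
  have "ln (cmod w) \<le> B" using ln_le_minus_one[of "cmod w"] w0 1 unfolding w[symmetric] by simp
  moreover have "- ln (cmod w) \<le> B"
  proof -
    have "inverse (cmod w) = cmod (y2' q \<mu> 1)" using prod by (simp add: inverse_unique)
    then have "- ln (cmod w) = ln (cmod (y2' q \<mu> 1))" using w0 ln_inverse[of "cmod w"] by simp
    also have "\<dots> \<le> cmod (y2' q \<mu> 1) - 1" using prod w0 by (intro ln_le_minus_one) (metis norm_ge_zero zero_less_one mult_zero_right less_eq_real_def)
    finally show ?thesis using 2 by simp
  qed
  ultimately have "\<bar>Re (Ln w)\<bar> \<le> B" using w0 by (simp add: Re_Ln)
  moreover have "\<bar>Im (Ln w)\<bar> \<le> 4" using Im_Ln_le_pi[OF w0] mpi_less_Im_Ln[OF w0] pi_less_4 by linarith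
  ultimately have "cmod (Ln w) \<le> B + 4" using cmod_le[of "Ln w"] by linarith
  moreover have "kappa n q = - Ln w" by (simp add: kappa_def w_def \<mu>_def)
  moreover have "B \<le> 10 * (1 + R) * E"
    unfolding B_def using E R0 by (intro mult_right_mono) auto
  ultimately show ?thesis by (simp add: R_def E_def add.assoc)
qed

end

text \<open>At a Dirichlet eigenvalue \<open>\<mu>\<close> the function \<open>y2\<close> is a Floquet solution with multiplier
  \<open>(-1) ^ n * exp \<kappa>\<close>, hence \<open>y2\<close> times \<open>exp (- s x)\<close>, \<open>s = \<kappa> + i \<pi> n\<close>, is periodic.\<close>

lemma dirichlet_floquet_fourier:
  fixes q :: "real \<Rightarrow> complex" and n :: nat
  assumes q: "q absolutely_integrable_on {0..1}"
    and dir: "y2 q 1 \<mu> = 0" and mult: "y2' q \<mu> 1 = (-1) ^ n * exp \<kappa>"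
  obtains H :: "int \<Rightarrow> complex" where
    "(\<lambda>k. norm (H k)) summable_on UNIV" "(H has_sum 0) UNIV" "\<exists>k. H k \<noteq> 0"
    "\<And>k. ((\<lambda>j. fourier_coeff q (k - j) * H j) has_sum
        ((\<mu> + \<kappa>\<^sup>2 - (of_nat n * of_real pi)\<^sup>2 - 4 * (of_real pi)\<^sup>2 * of_int (k * (k + int n))
          + 2 * of_real pi * \<i> * \<kappa> * of_int (int n + 2 * k)) * H k)) UNIV"
proof -
  define s where "s = \<kappa> + \<i> * of_real pi * of_nat n"
  define y where "y = (\<lambda>x. y2 q x \<mu>)"
  define y' where "y' = y2' q \<mu>"
  note S = y2_solution[OF q, of \<mu>, folded y_def y'_def]
  have y0: "y 0 = 0" "y 1 = 0" "y' 0 = 1" "y' 1 = (-1) ^ n * exp \<kappa>"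
    using S(2,3) dir mult by (auto simp: y_def y'_def)
  note D = schroedinger_solutionD[OF q S(1)]
  \<comment> \<open>This normalisation makes the boundary terms at 0 and 1 cancel below.\<close>
  have es: "exp (- s) * y' 1 = 1"
  proof -
    have "exp (- (\<i> * of_real pi * of_nat n)) = (-1) ^ n"
      using exp_of_nat_mult[of n "- (\<i> * of_real pi)"] by (simp add: exp_minus mult_ac)
    then have "exp (- s) = exp (- \<kappa>) * (-1) ^ n" by (simp add: s_def exp_add exp_diff exp_minus field_simps)
    then have "exp (- s) * y' 1 = (exp (- \<kappa>) * exp \<kappa>) * ((-1) ^ n * (-1) ^ n)" by (simp add: y0 mult_ac)
    then show ?thesis by (simp add: exp_minus flip: power_mult_distrib)
  qed
  have E: "((\<lambda>x. exp (- \<sigma> * of_real x)) has_vector_derivative - \<sigma> * exp (- \<sigma> * of_real x)) (at x within A)" for \<sigma> :: complex and x A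
  proof -
    have "((\<lambda>w. exp (- \<sigma> * w)) has_field_derivative - \<sigma> * exp (- \<sigma> * of_real x)) (at (of_real x))"
      by (auto intro!: derivative_eq_intros)
    from has_vector_derivative_real_field[OF this] show ?thesis by (simp add: has_vector_derivative_at_within)
  qed
  have Ec: "continuous_on A (\<lambda>x. exp (- \<sigma> * complex_of_real x))" for \<sigma> A by (intro continuous_intros)
  define h where "h = (\<lambda>x. y x * exp (- s * of_real x))"
  define h' where "h' = (\<lambda>x. y x * (- s * exp (- s * of_real x)) + y' x * exp (- s * of_real x))"
  interpret C1_periodic h h'
  proof
    show "(h has_vector_derivative h' x) (at x within {0..1})" if "x \<in> {0..1}" for x
      unfolding h_def h'_def by (rule has_vector_derivative_mult[OF D(1)[OF that] E])
    show "continuous_on {0..1} h'" unfolding h'_def by (intro continuous_intros D)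
    show "h 0 = h 1" by (simp add: h_def y0)
  qed
  define H where "H = fourier_coeff h"
  have hi: "h absolutely_integrable_on {0..1}" by (intro absolutely_integrable_continuous_real h_cont)
  have coeff: "fourier_coeff (\<lambda>x. q x * h x) k = (\<mu> + (s + 2 * of_real pi * \<i> * of_int k)\<^sup>2) * H k" for k
  proof -
    define \<sigma> where "\<sigma> = s + 2 * of_real pi * \<i> * of_int k"
    define e where "e = (\<lambda>x. exp (- \<sigma> * complex_of_real x))"
    have he: "h x * fexp (- k) x = y x * e x" for x
      by (simp add: h_def fexp_def e_def \<sigma>_def exp_add[symmetric] algebra_simps)
    have e1: "e 1 * y' 1 = 1" "e 0 = 1"
    proof -
      have "exp (- \<sigma>) = exp (- s) * fexp (- k) 1" by (simp add: fexp_def \<sigma>_def exp_add[symmetric] algebra_simps)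
      then show "e 1 * y' 1 = 1" using es by (simp add: e_def)
    qed (simp add: e_def)
    have ec: "continuous_on A e" for A unfolding e_def by (rule Ec)
    have ed: "(e has_vector_derivative - \<sigma> * e x) (at x within A)" for x A unfolding e_def by (rule E)
    \<comment> \<open>\<open>y'\<close> is only absolutely continuous, so the equation is tested
      against the exponential instead of being differentiated: one integration by parts for
      \<open>y'\<close>, a second one for \<open>y\<close>.\<close>
    have "integral {0..1} (\<lambda>t. (q t - \<mu>) * y t * e t + y' t * (- \<sigma> * e t)) = y' 1 * e 1 - y' 0 * e 0"
      by (rule integration_by_parts_absolutely_integrable[where F = y' and g = e and b = 1, OF D(4) D(5) ed])
        (auto intro!: continuous_intros ec)
    then have I1: "integral {0..1} (\<lambda>t. (q t - \<mu>) * y t * e t + (- \<sigma>) * (y' t * e t)) = 0"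
      using e1 y0 by (simp add: mult_ac)
    have ftc: "y x = y 0 + integral {0..x} y'" if "x \<in> {0..1}" for x
    proof -
      have "(y' has_integral y x - y 0) {0..x}"
        by (rule fundamental_theorem_of_calculus)
          (use that in \<open>auto intro!: has_vector_derivative_within_subset[OF D(1)]\<close>)
      then show ?thesis by (simp add: integral_unique)
    qed
    have "integral {0..1} (\<lambda>t. y' t * e t + y t * (- \<sigma> * e t)) = y 1 * e 1 - y 0 * e 0"
      by (rule integration_by_parts_absolutely_integrable[where F = y and g = e and b = 1,
            OF absolutely_integrable_continuous_real[OF D(3)] ftc ed])
        (auto intro!: continuous_intros ec)
    then have I2: "integral {0..1} (\<lambda>t. y' t * e t + (- \<sigma>) * (y t * e t)) = 0"
      using y0 by (simp add: mult_ac)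
    have i: "(\<lambda>t. y' t * e t) integrable_on {0..1}" "(\<lambda>t. y t * e t) integrable_on {0..1}"
      by (intro integrable_continuous_real continuous_intros ec D)+
    have iq: "(\<lambda>t. q t * (y t * e t)) integrable_on {0..1}"
      using absolutely_integrable_mult_continuous[OF q continuous_on_mult[OF D(2) ec]] by (simp add: absolutely_integrable_on_def)
    define Y Y' QY where "Y = integral {0..1} (\<lambda>t. y t * e t)" and "Y' = integral {0..1} (\<lambda>t. y' t * e t)"
      and "QY = integral {0..1} (\<lambda>t. q t * (y t * e t))"
    have h1: "((\<lambda>t. q t * (y t * e t) - \<mu> * (y t * e t) + (- \<sigma>) * (y' t * e t)) has_integral (QY - \<mu> * Y + (- \<sigma>) * Y')) {0..1}"
      unfolding Y_def Y'_def QY_def by (intro has_integral_add has_integral_diff has_integral_mult_right integrable_integral i iq)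
    have eq1: "(\<lambda>t. q t * (y t * e t) - \<mu> * (y t * e t) + (- \<sigma>) * (y' t * e t)) = (\<lambda>t. (q t - \<mu>) * y t * e t + (- \<sigma>) * (y' t * e t))"
      by (auto simp: algebra_simps)
    have "QY - \<mu> * Y + (- \<sigma>) * Y' = 0" using integral_unique[OF h1] I1 unfolding eq1 by simp
    moreover have h2: "((\<lambda>t. y' t * e t + (- \<sigma>) * (y t * e t)) has_integral (Y' + (- \<sigma>) * Y)) {0..1}"
      unfolding Y_def Y'_def by (intro has_integral_add has_integral_mult_right integrable_integral i)
    have "Y' = \<sigma> * Y" using integral_unique[OF h2] unfolding I2 by simp
    ultimately have QY: "QY = (\<mu> + \<sigma>\<^sup>2) * Y" by (simp add: power2_eq_square algebra_simps)
    have "fourier_coeff (\<lambda>x. q x * h x) k = integral {0..1} (\<lambda>x. q x * h x * fexp (- k) x)"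
      by (intro fourier_coeff_eq absolutely_integrable_mult_continuous q h_cont)
    also have "\<dots> = QY" unfolding QY_def by (simp add: mult.assoc he)
    finally have "fourier_coeff (\<lambda>x. q x * h x) k = (\<mu> + \<sigma>\<^sup>2) * Y" by (simp add: QY)
    moreover have "Y = H k" unfolding Y_def H_def fourier_coeff_eq[OF hi] by (simp add: he)
    ultimately show ?thesis by (simp add: \<sigma>_def)
  qed
  have conv: "((\<lambda>j. fourier_coeff q (k - j) * H j) has_sum fourier_coeff (\<lambda>x. q x * h x) k) UNIV" for k
  proof -
    have qk: "(\<lambda>x. q x * fexp (- k) x) absolutely_integrable_on {0..1}" by (rule absolutely_integrable_mult_fexp[OF q])
    have "fourier_coeff (\<lambda>x. q x * fexp (- k) x) (- j) = fourier_coeff q (k - j)" for j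
      unfolding fourier_coeff_eq[OF qk] fourier_coeff_eq[OF q]
      by (rule integral_cong) (simp add: mult.assoc flip: fexp_add)
    moreover have "integral {0..1} (\<lambda>x. q x * fexp (- k) x * h x) = fourier_coeff (\<lambda>x. q x * h x) k"
      unfolding fourier_coeff_eq[OF absolutely_integrable_mult_continuous[OF q h_cont]]
      by (simp add: mult_ac)
    ultimately show ?thesis using fourier_pairing[OF qk] by (simp add: H_def mult.commute)
  qed
  show ?thesis
  proof (rule that[of H])
    show "(\<lambda>k. norm (H k)) summable_on UNIV" unfolding H_def by (rule fourier_coeff_summable)
    show "(H has_sum 0) UNIV" using fourier_series_has_sum[of 0] by (simp add: H_def h_def y0)
    \<comment> \<open>If all coefficients vanished, so would \<open>h\<close> on the interval,
      against \<open>h' 0 = y' 0 = 1\<close>.\<close>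
    show "\<exists>k. H k \<noteq> 0"
    proof (rule ccontr)
      assume "\<not> (\<exists>k. H k \<noteq> 0)"
      then have h0: "h x = 0" if "x \<in> {0..1}" for x
        using infsumI[OF fourier_series_has_sum[OF that]] by (simp add: H_def)
      have "((\<lambda>_. 0) has_vector_derivative h' 0) (at 0 within {0..1})"
        by (rule has_vector_derivative_transform[of 0 "{0..1}" "\<lambda>_. 0" h]) (use h0 der[of 0] in auto)
      then have "h' 0 = 0"
        using vector_derivative_unique_within_closed_interval[of 0 1 0 "\<lambda>_. 0" "h' 0" 0] by simp
      then show False by (simp add: h'_def y0)
    qed
    fix k :: int
    \<comment> \<open>The bracket is \<kappa> + \<i> \<pi> (n + 2 k), and (n + 2 k)^2 = n^2 + 4 k (k
      + n).\<close>
    have eq: "\<mu> + (s + 2 * of_real pi * \<i> * of_int k)\<^sup>2 = \<mu> + \<kappa>\<^sup>2 - (of_nat n * of_real pi)\<^sup>2 - 4 * (of_real pi)\<^sup>2 * of_int (k * (k + int n))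
          + 2 * of_real pi * \<i> * \<kappa> * of_int (int n + 2 * k)"
      by (simp add: s_def power2_eq_square algebra_simps)
    show "((\<lambda>j. fourier_coeff q (k - j) * H j) has_sum
        ((\<mu> + \<kappa>\<^sup>2 - (of_nat n * of_real pi)\<^sup>2 - 4 * (of_real pi)\<^sup>2 * of_int (k * (k + int n))
          + 2 * of_real pi * \<i> * \<kappa> * of_int (int n + 2 * k)) * H k)) UNIV"
      using conv[of k] unfolding coeff eq .
  qed
qed

section \<open>The resonant system\<close>

text \<open>The contraction is measured in the supremum norm, the invariant set by a pointwise
  majorant \<open>W\<close>. The majorant passes to the limit, so the fixed point inherits a
  weighted decay without a weighted contraction estimate.\<close>

lemma pointwise_contraction_fixed_point:
  fixes T :: "('i \<Rightarrow> complex) \<Rightarrow> 'i \<Rightarrow> complex" and W :: "'i \<Rightarrow> real"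
  assumes W: "\<And>k. 0 \<le> W k" "\<And>k. W k \<le> B"
    and inv: "\<And>y k. (\<And>k. norm (y k) \<le> W k) \<Longrightarrow> norm (T y k) \<le> W k"
    and lip: "\<And>y z d k. (\<And>k. norm (y k) \<le> W k) \<Longrightarrow> (\<And>k. norm (z k) \<le> W k) \<Longrightarrow>
       (\<And>k. norm (y k - z k) \<le> d) \<Longrightarrow> norm (T y k - T z k) \<le> d / 2"
  obtains y where "\<And>k. norm (y k) \<le> W k" "\<And>k. T y k = y k"
proof -
  define Y where "Y = (\<lambda>r. (T ^^ r) (\<lambda>_. 0))"
  have YS: "norm (Y r k) \<le> W k" for r k
    by (induction r arbitrary: k) (auto simp: Y_def W inv)
  have step: "norm (Y (Suc r) k - Y r k) \<le> B * (1 / 2) ^ r" for r k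
  proof (induction r arbitrary: k)
    case 0
    show ?case using YS[of 1 k] W(2)[of k] by (simp add: Y_def)
  next
    case (Suc r)
    have "norm (T (Y (Suc r)) k - T (Y r) k) \<le> (B * (1 / 2) ^ r) / 2"
      by (rule lip) (use YS Suc in auto)
    then show ?case by (simp add: Y_def)
  qed
  have summ: "summable (\<lambda>i. Y (Suc i) k - Y i k)" for k
  proof (rule summable_comparison_test)
    show "summable (\<lambda>r. B * (1 / 2 :: real) ^ r)" by (intro summable_mult summable_geometric) simp
  qed (use step in auto)
  define y where "y = (\<lambda>k. \<Sum>i. Y (Suc i) k - Y i k)"
  have Y0: "Y 0 k = 0" for k by (simp add: Y_def)
  have lim: "(\<lambda>r. Y r k) \<longlonglongrightarrow> y k" for k
    using summable_LIMSEQ[OF summ[of k]] by (simp add: sum_lessThan_telescope[of "\<lambda>r. Y r k"] y_def Y0)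
  have yW: "norm (y k) \<le> W k" for k
    by (rule LIMSEQ_le_const2[OF tendsto_norm[OF lim]]) (use YS in auto)
  have far: "norm (y k - Y r k) \<le> 2 * B * (1 / 2) ^ r" for r k
  proof -
    have "norm (Y (r + s) k - Y r k) \<le> 2 * B * (1 / 2) ^ r" for s
    proof -
      have B: "B \<ge> 0" using W[of k] by simp
      have "norm (Y (r + s) k - Y r k) \<le> (2 - 2 * (1 / 2) ^ s) * B * (1 / 2) ^ r"
      proof (induction s)
        case (Suc s)
        have "norm (Y (r + Suc s) k - Y r k) \<le> norm (Y (Suc (r + s)) k - Y (r + s) k) + norm (Y (r + s) k - Y r k)"
          using norm_triangle_ineq[of "Y (Suc (r + s)) k - Y (r + s) k" "Y (r + s) k - Y r k"] by simp
        also have "\<dots> \<le> B * (1 / 2) ^ (r + s) + (2 - 2 * (1 / 2) ^ s) * B * (1 / 2) ^ r"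
          by (intro add_mono step Suc)
        also have "\<dots> = (2 - 2 * (1 / 2) ^ Suc s) * B * (1 / 2) ^ r" by (simp add: power_add algebra_simps)
        finally show ?case .
      qed simp
      also have "\<dots> \<le> 2 * B * (1 / 2) ^ r" using B by (intro mult_right_mono) auto
      finally show ?thesis .
    qed
    moreover have "(\<lambda>s. norm (Y (r + s) k - Y r k)) \<longlonglongrightarrow> norm (y k - Y r k)"
      using LIMSEQ_ignore_initial_segment[OF lim[of k], of r] by (intro tendsto_intros) (simp add: add.commute)
    ultimately show ?thesis by (intro LIMSEQ_le_const2) auto
  qed
  have "T y k = y k" for k
  proof -
    have "norm (T y k - y k) \<le> 3 * B * (1 / 2) ^ r" for r
    proof -
      have "norm (T y k - T (Y r) k) \<le> (2 * B * (1 / 2) ^ r) / 2" by (rule lip) (use yW YS far in auto)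
      moreover have "norm (T (Y r) k - y k) \<le> 2 * B * (1 / 2) ^ Suc r"
        using far[of k "Suc r"] by (simp add: Y_def norm_minus_commute)
      ultimately have "norm (T y k - y k) \<le> 2 * B * (1 / 2) ^ r"
        using norm_triangle_ineq[of "T y k - T (Y r) k" "T (Y r) k - y k"] by simp
      also have "\<dots> \<le> 3 * B * (1 / 2) ^ r" using W[of k] by (intro mult_right_mono) auto
      finally show ?thesis .
    qed
    moreover have "(\<lambda>r. 3 * B * (1 / 2) ^ r) \<longlonglongrightarrow> 3 * B * 0" by (intro tendsto_intros LIMSEQ_power_zero) simp
    ultimately have "norm (T y k - y k) \<le> 3 * B * 0" by (intro LIMSEQ_le_const) auto
    then show ?thesis by simp
  qed
  with yW show ?thesis by (rule that)
qed

section \<open>Weights and shifted sums over the integers\<close>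

definition zeta2 :: real where "zeta2 = (\<Sum>\<^sub>\<infinity>k::int. 1 / (real_of_int k)\<^sup>2)"

lemma zeta2_nonneg: "zeta2 \<ge> 0" unfolding zeta2_def by (rule infsum_nonneg) simp

lemma bij_int_affine: "bij (\<lambda>j::int. j + n)" "bij (\<lambda>j::int. n - j)"
  by (rule bij_betw_byWitness[of _ "\<lambda>j. j - n"]; auto) (rule bij_betw_byWitness[of _ "\<lambda>j. n - j"]; auto)

lemma summable_on_int_shift:
  fixes f :: "int \<Rightarrow> 'a::{comm_monoid_add, topological_space}"
  shows "(\<lambda>j. f (j + n)) summable_on UNIV \<longleftrightarrow> f summable_on UNIV"
    and "(\<lambda>j. f (n - j)) summable_on UNIV \<longleftrightarrow> f summable_on UNIV"
  using summable_on_reindex_bij_betw[OF bij_int_affine(1)[of n], of f]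
    summable_on_reindex_bij_betw[OF bij_int_affine(2)[of n], of f] by auto

lemma infsum_int_shift:
  fixes f :: "int \<Rightarrow> 'a::{comm_monoid_add, t2_space}"
  shows "(\<Sum>\<^sub>\<infinity>j. f (j + n)) = (\<Sum>\<^sub>\<infinity>j. f j)" and "(\<Sum>\<^sub>\<infinity>j. f (n - j)) = (\<Sum>\<^sub>\<infinity>j. f j)"
  using infsum_reindex_bij_betw[OF bij_int_affine(1)[of n], of f]
    infsum_reindex_bij_betw[OF bij_int_affine(2)[of n], of f] by auto

text \<open>Division by zero makes the weight vanish at the two resonant indices \<open>0\<close> and \<open>- n\<close>.\<close>

definition wt :: "nat \<Rightarrow> int \<Rightarrow> real" where
  "wt n k = 1 / \<bar>real_of_int (k * (k + int n))\<bar>"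

lemma wt_nonneg: "0 \<le> wt n k" by (simp add: wt_def)

lemma wt_reflect: "wt n (- int n - k) = wt n k"
proof -
  have "(- int n - k) * (- int n - k + int n) = k * (k + int n)" by (simp add: algebra_simps)
  then show ?thesis by (simp add: wt_def)
qed

text \<open>Partial fractions of 1 / (k (k + n)) exchange one factor of the weight for the gain 1/n;
  the last power of n in the remainder comes from here.\<close>

lemma wt_split:
  assumes "n \<ge> 1"
  shows "real n * wt n k \<le> \<bar>1 / real_of_int k\<bar> + \<bar>1 / real_of_int (k + int n)\<bar>"
proof (cases "k = 0 \<or> k + int n = 0")
  case False
  then have "real_of_int k \<noteq> 0" "real_of_int (k + int n) \<noteq> 0" by linarith+
  then have "real n / (real_of_int k * real_of_int (k + int n)) = 1 / real_of_int k - 1 / real_of_int (k + int n)"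
    by (simp add: field_simps)
  moreover have "real n * wt n k = \<bar>real n / (real_of_int k * real_of_int (k + int n))\<bar>" by (simp add: wt_def)
  ultimately show ?thesis
    using abs_triangle_ineq4[of "1 / real_of_int k" "1 / real_of_int (k + int n)"] by simp
next
  case True
  then have "k * (k + int n) = 0" by auto
  then have "wt n k = 0" unfolding wt_def by (simp only: of_int_0 abs_zero div_by_0)
  then show ?thesis by simp
qed

lemma wt_summable: "wt n summable_on UNIV" and wt_infsum: "(\<Sum>\<^sub>\<infinity>k. wt n k) \<le> zeta2"
proof -
  define g where "g = (\<lambda>k::int. 1 / (real_of_int k)\<^sup>2)"
  have g: "g summable_on UNIV" "infsum g UNIV = zeta2"
    using inverse_square_int_summable by (simp_all add: g_def zeta2_def)
  have s: "(\<lambda>k. 1/2 * g k + 1/2 * g (k + int n)) summable_on UNIV"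
    using g(1) by (intro summable_on_add summable_on_cmult_right) (simp_all add: summable_on_int_shift)
  have le: "wt n k \<le> 1/2 * g k + 1/2 * g (k + int n)" for k
    using sum_squares_bound[of "\<bar>1 / real_of_int k\<bar>" "\<bar>1 / real_of_int (k + int n)\<bar>"]
    by (simp add: g_def wt_def abs_mult power_divide)
  show 1: "wt n summable_on UNIV" by (rule summable_on_comparison_test[OF s le wt_nonneg])
  have "(\<Sum>\<^sub>\<infinity>k. wt n k) \<le> (\<Sum>\<^sub>\<infinity>k. 1/2 * g k + 1/2 * g (k + int n))" by (rule infsum_mono[OF 1 s le])
  also have "\<dots> = (\<Sum>\<^sub>\<infinity>k. 1/2 * g k) + (\<Sum>\<^sub>\<infinity>k. 1/2 * g (k + int n))"
    using g(1) by (intro infsum_add summable_on_cmult_right) (simp_all add: summable_on_int_shift)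
  also have "\<dots> = zeta2" by (simp only: infsum_cmult_right' infsum_int_shift g(2))
  finally show "(\<Sum>\<^sub>\<infinity>k. wt n k) \<le> zeta2" .
qed

text \<open>A bound, independent of \<open>n\<close>, for \<open>n\<close> times the l2 norm of
  \<open>wt n\<close>: \<open>wt_split\<close> with (a + b)^2 \<le> 2 a^2 + 2 b^2 gives the square
  sum \<open>4 * zeta2 / n^2\<close>.\<close>

definition wt_const :: real where "wt_const = 2 * sqrt zeta2"

lemma wt_const_nonneg: "wt_const \<ge> 0" using zeta2_nonneg by (simp add: wt_const_def)

lemma
  assumes n: "n \<ge> 1"
  shows wt_sq_summable: "(\<lambda>k. (wt n k)\<^sup>2) summable_on UNIV"
  and wt_sq_infsum: "sqrt (\<Sum>\<^sub>\<infinity>k. (wt n k)\<^sup>2) \<le> wt_const / real n"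
proof -
  define g where "g = (\<lambda>k::int. 1 / (real_of_int k)\<^sup>2)"
  have g: "g summable_on UNIV" "infsum g UNIV = zeta2"
    using inverse_square_int_summable by (simp_all add: g_def zeta2_def)
  define c where "c = 2 / (real n)\<^sup>2"
  have s: "(\<lambda>k. c * g k + c * g (k + int n)) summable_on UNIV"
    using g(1) by (intro summable_on_add summable_on_cmult_right) (simp_all add: summable_on_int_shift)
  have le: "(wt n k)\<^sup>2 \<le> c * g k + c * g (k + int n)" for k
  proof -
    define a b where "a = \<bar>1 / real_of_int k\<bar>" and "b = \<bar>1 / real_of_int (k + int n)\<bar>"
    have "(real n * wt n k)\<^sup>2 \<le> (a + b)\<^sup>2"
      using wt_split[OF n, of k] wt_nonneg[of n k] by (intro power_mono) (auto simp: a_def b_def)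
    also have "\<dots> \<le> 2 * a\<^sup>2 + 2 * b\<^sup>2" using sum_squares_bound[of a b] by (simp add: power2_sum)
    also have "\<dots> = 2 * g k + 2 * g (k + int n)" by (simp add: a_def b_def g_def power_divide)
    finally have "(real n)\<^sup>2 * (wt n k)\<^sup>2 \<le> 2 * g k + 2 * g (k + int n)" by (simp add: power_mult_distrib)
    then show ?thesis using n by (simp add: c_def field_simps)
  qed
  show 1: "(\<lambda>k. (wt n k)\<^sup>2) summable_on UNIV" by (rule summable_on_comparison_test[OF s le]) simp
  have "(\<Sum>\<^sub>\<infinity>k. (wt n k)\<^sup>2) \<le> (\<Sum>\<^sub>\<infinity>k. c * g k + c * g (k + int n))" by (rule infsum_mono[OF 1 s le])
  also have "\<dots> = (\<Sum>\<^sub>\<infinity>k. c * g k) + (\<Sum>\<^sub>\<infinity>k. c * g (k + int n))"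
    using g(1) by (intro infsum_add summable_on_cmult_right) (simp_all add: summable_on_int_shift)
  also have "\<dots> = 4 * zeta2 / (real n)\<^sup>2" by (simp only: infsum_cmult_right' infsum_int_shift g(2)) (simp add: c_def)
  finally have "sqrt (\<Sum>\<^sub>\<infinity>k. (wt n k)\<^sup>2) \<le> sqrt (4 * zeta2 / (real n)\<^sup>2)" by (rule real_sqrt_le_mono)
  also have "\<dots> = wt_const / real n" by (simp add: wt_const_def real_sqrt_divide real_sqrt_mult)
  finally show "sqrt (\<Sum>\<^sub>\<infinity>k. (wt n k)\<^sup>2) \<le> wt_const / real n" .
qed

lemma conv_wt:
  assumes n: "n \<ge> 1" and P: "(\<lambda>k::int. (P k)\<^sup>2) summable_on UNIV" "sqrt (\<Sum>\<^sub>\<infinity>k. (P k)\<^sup>2) \<le> M" "\<And>k. P k \<ge> 0"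
  shows "(\<lambda>j. P (k - j) * wt n j) summable_on UNIV"
    and "(\<Sum>\<^sub>\<infinity>j. P (k - j) * wt n j) \<le> M * wt_const / real n"
proof -
  have s: "(\<lambda>j. (P (k - j))\<^sup>2) summable_on UNIV" using P(1) summable_on_int_shift(2)[of "\<lambda>k. (P k)\<^sup>2" k] by simp
  have e: "(\<Sum>\<^sub>\<infinity>j. (P (k - j))\<^sup>2) = (\<Sum>\<^sub>\<infinity>j. (P j)\<^sup>2)" using infsum_int_shift(2)[of "\<lambda>k. (P k)\<^sup>2" k] by simp
  note CS = infsum_Cauchy_Schwarz[OF s wt_sq_summable[OF n]]
  have [simp]: "\<bar>P k\<bar> = P k" "\<bar>wt n k\<bar> = wt n k" for k using P(3) wt_nonneg by auto
  show "(\<lambda>j. P (k - j) * wt n j) summable_on UNIV" using CS(1) by simp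
  have "(\<Sum>\<^sub>\<infinity>j. P (k - j) * wt n j) \<le> sqrt (\<Sum>\<^sub>\<infinity>j. (P j)\<^sup>2) * sqrt (\<Sum>\<^sub>\<infinity>k. (wt n k)\<^sup>2)" using CS(2) by (simp add: e)
  also have "\<dots> \<le> M * (wt_const / real n)"
    using P(2) wt_sq_infsum[OF n] by (intro mult_mono) (auto intro!: infsum_nonneg order_trans[OF _ P(2)])
  finally show "(\<Sum>\<^sub>\<infinity>j. P (k - j) * wt n j) \<le> M * wt_const / real n" by simp
qed

text \<open>A weight that stays invertible at 0. Against coefficients that vanish at 0 it is
  interchangeable with the modulus, see \<open>jap_Q\<close>.\<close>

definition jap :: "int \<Rightarrow> real" where "jap k = max 1 \<bar>real_of_int k\<bar>"

lemma jap_ge_1: "jap k \<ge> 1" and jap_pos: "jap k > 0"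
  by (auto simp: jap_def)

lemma jap_add_power: "jap (a + b) ^ N \<le> 2 ^ N * (jap a ^ N + jap b ^ N)"
proof -
  have "jap (a + b) \<le> 2 * max (jap a) (jap b)" by (auto simp: jap_def)
  then have "jap (a + b) ^ N \<le> (2 * max (jap a) (jap b)) ^ N" using jap_pos[of "a + b"] by (intro power_mono) auto
  also have "\<dots> = 2 ^ N * max (jap a) (jap b) ^ N" by (simp add: power_mult_distrib)
  also have "max (jap a) (jap b) ^ N \<le> jap a ^ N + jap b ^ N"
    using jap_pos[of a] jap_pos[of b] by (auto simp: max_def)
  finally show ?thesis by simp
qed

text \<open>For nonzero integers the sum of the moduli is at most twice the modulus of the product,
  here for \<open>k\<close> and \<open>k + n\<close>. Off resonance this lets k (k + n) dominate the
  \<open>\<tau>\<close> and \<open>\<kappa>\<close> terms of the divisor.\<close>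

lemma abs_int_resonance:
  fixes k :: int and n :: nat
  assumes "k * (k + int n) \<noteq> 0"
  shows "\<bar>int n + 2 * k\<bar> \<le> 2 * \<bar>k * (k + int n)\<bar>" and "int n \<le> 2 * \<bar>k * (k + int n)\<bar>"
proof -
  have k: "k \<noteq> 0" "k + int n \<noteq> 0" using assms by auto
  define a b where "a = \<bar>k\<bar>" and "b = \<bar>k + int n\<bar>"
  have ab: "a \<ge> 1" "b \<ge> 1" using k by (auto simp: a_def b_def)
  have "(a - 1) * (b - 1) \<ge> 0" using ab by simp
  then have "a + b \<le> a * b + 1" by (simp add: algebra_simps)
  moreover have "1 \<le> a * b" using ab mult_mono[of 1 a 1 b] by simp
  ultimately have "a + b \<le> 2 * (a * b)" by simp
  moreover have "\<bar>int n + 2 * k\<bar> \<le> a + b" "int n \<le> a + b" by (auto simp: a_def b_def)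
  moreover have "a * b = \<bar>k * (k + int n)\<bar>" by (simp add: a_def b_def abs_mult)
  ultimately show "\<bar>int n + 2 * k\<bar> \<le> 2 * \<bar>k * (k + int n)\<bar>" "int n \<le> 2 * \<bar>k * (k + int n)\<bar>" by auto
qed

text \<open>\<open>Q\<close> stands for the Fourier coefficients of the potential and
  \<open>\<tau>\<close> for \<mu> + \<kappa>^2 - (n \<pi>)^2. The assumption \<open>small\<close>
  makes the nonresonant operator map weighted balls into themselves.\<close>

locale resonance =
  fixes Q :: "int \<Rightarrow> complex" and n N :: nat and M :: real and \<kappa> \<tau> :: complex
  assumes n: "n \<ge> 1" and Q0: "Q 0 = 0"
    and P_summable: "(\<lambda>k. (\<bar>real_of_int k\<bar> ^ N * norm (Q k))\<^sup>2) summable_on UNIV"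
    and P_norm: "sqrt (\<Sum>\<^sub>\<infinity>k. (\<bar>real_of_int k\<bar> ^ N * norm (Q k))\<^sup>2) \<le> M"
    and small: "2 ^ (N + 2) * M * wt_const \<le> real n"
    and \<kappa>: "norm \<kappa> \<le> 1" and \<tau>: "norm \<tau> \<le> real n"
begin

definition P :: "int \<Rightarrow> real" where "P k = \<bar>real_of_int k\<bar> ^ N * norm (Q k)"

definition D :: "int \<Rightarrow> complex" where
  "D k = \<tau> - 4 * (of_real pi)\<^sup>2 * of_int (k * (k + int n)) + 2 * of_real pi * \<i> * \<kappa> * of_int (int n + 2 * k)"

text \<open>The value 0 at the resonant indices turns sums over all integers into sums over the
  nonresonant ones.\<close>

definition iD :: "int \<Rightarrow> complex" where "iD k = (if k * (k + int n) = 0 then 0 else 1 / D k)"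

text \<open>The operator acts on the sequence \<open>D k * H k\<close> instead of \<open>H\<close>:
  at nonresonant indices \<open>iD j\<close> recovers \<open>H j\<close>, and this factor supplies
  the smallness.\<close>

definition Kop :: "(int \<Rightarrow> complex) \<Rightarrow> int \<Rightarrow> complex" where
  "Kop y k = (\<Sum>\<^sub>\<infinity>j. Q (k - j) * iD j * y j)"

lemma P_nonneg: "P k \<ge> 0" by (simp add: P_def)

lemma P_sq: "(\<lambda>k. (P k)\<^sup>2) summable_on UNIV" "sqrt (\<Sum>\<^sub>\<infinity>k. (P k)\<^sup>2) \<le> M"
  using P_summable P_norm by (simp_all add: P_def)

lemma M_nonneg: "M \<ge> 0" by (rule order_trans[OF _ P_sq(2)]) (auto intro: infsum_nonneg)

lemma P_le_M: "P k \<le> M"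
proof -
  have "(P k)\<^sup>2 \<le> (\<Sum>\<^sub>\<infinity>k. (P k)\<^sup>2)" using finite_sum_le_infsum[OF P_sq(1), of "{k}"] by simp
  then have "sqrt ((P k)\<^sup>2) \<le> M" using P_sq(2) real_sqrt_le_mono order_trans by blast
  then show ?thesis using P_nonneg by simp
qed

lemma jap_Q: "jap k ^ N * norm (Q k) = P k"
proof (cases "k = 0")
  case False
  then have "jap k = \<bar>real_of_int k\<bar>" by (simp add: jap_def)
  then show ?thesis by (simp add: P_def)
qed (simp add: P_def Q0)

lemma Q_le_P: "norm (Q k) \<le> P k"
  using mult_right_mono[OF one_le_power[OF jap_ge_1, of k N] norm_ge_zero[of "Q k"]] by (simp add: jap_Q)

lemma Q_le: "norm (Q k) \<le> M / jap k ^ N"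
  using P_le_M[of k] jap_pos[of k] by (simp add: jap_Q[symmetric] field_simps)

text \<open>With m the modulus of k (k + n), the main term of \<open>D k\<close> is 4 pi^2 m, while
  \<open>\<tau>\<close> contributes at most 2 m and the \<open>\<kappa>\<close> term at most 4 pi
  m.\<close>

lemma D_ge:
  assumes False: "k * (k + int n) \<noteq> 0"
  shows "\<bar>real_of_int (k * (k + int n))\<bar> \<le> norm (D k)"
proof -
  define m where "m = \<bar>real_of_int (k * (k + int n))\<bar>"
  have m: "\<bar>real_of_int (int n + 2 * k)\<bar> \<le> 2 * m" "real n \<le> 2 * m"
  proof -
    have "real_of_int \<bar>int n + 2 * k\<bar> \<le> real_of_int (2 * \<bar>k * (k + int n)\<bar>)"
      "real_of_int (int n) \<le> real_of_int (2 * \<bar>k * (k + int n)\<bar>)"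
      using abs_int_resonance[OF False] by (simp_all only: of_int_le_iff)
    then show "\<bar>real_of_int (int n + 2 * k)\<bar> \<le> 2 * m" "real n \<le> 2 * m" by (simp_all only: m_def of_int_mult of_int_numeral of_int_abs of_int_of_nat_eq)
  qed
  have m0: "m > 0" using False by (simp add: m_def)
  have "cmod (4 * (of_real pi)\<^sup>2 * of_int (k * (k + int n))) = 4 * pi\<^sup>2 * m"
    by (simp add: norm_mult norm_power m_def del: of_int_mult of_int_add)
  moreover have "cmod (2 * of_real pi * \<i> * \<kappa> * of_int (int n + 2 * k)) \<le> 2 * pi * 1 * (2 * m)"
  proof -
    have "cmod (2 * of_real pi * \<i> * \<kappa> * of_int (int n + 2 * k)) = 2 * pi * cmod \<kappa> * \<bar>real_of_int (int n + 2 * k)\<bar>"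
      by (simp add: norm_mult del: of_int_add of_int_mult)
    also have "\<dots> \<le> 2 * pi * 1 * (2 * m)" using m(1) \<kappa> by (intro mult_mono) auto
    finally show ?thesis .
  qed
  moreover have "cmod (4 * (of_real pi)\<^sup>2 * of_int (k * (k + int n)))
     \<le> cmod (D k) + cmod \<tau> + cmod (2 * of_real pi * \<i> * \<kappa> * of_int (int n + 2 * k))"
  proof -
    have "4 * (of_real pi)\<^sup>2 * of_int (k * (k + int n)) = \<tau> + 2 * of_real pi * \<i> * \<kappa> * of_int (int n + 2 * k) - D k"
      by (simp add: D_def)
    then have "cmod (4 * (of_real pi)\<^sup>2 * of_int (k * (k + int n))) \<le> cmod (\<tau> + 2 * of_real pi * \<i> * \<kappa> * of_int (int n + 2 * k)) + cmod (D k)"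
      by (simp only: norm_triangle_ineq4)
    also have "cmod (\<tau> + 2 * of_real pi * \<i> * \<kappa> * of_int (int n + 2 * k)) \<le> cmod \<tau> + cmod (2 * of_real pi * \<i> * \<kappa> * of_int (int n + 2 * k))"
      by (rule norm_triangle_ineq)
    finally show ?thesis by simp
  qed
  ultimately have "4 * pi\<^sup>2 * m \<le> cmod (D k) + 2 * m + 2 * pi * 1 * (2 * m)" using \<tau> m(2) by linarith
  moreover have "3 * m \<le> 4 * pi\<^sup>2 * m - 2 * pi * 1 * (2 * m)"
  proof -
    have "3 * 2 \<le> pi * (pi - 1)" using pi_gt3 by (intro mult_mono) auto
    then have "3 \<le> 4 * pi\<^sup>2 - 4 * pi" by (simp add: power2_eq_square algebra_simps)
    then have "3 * m \<le> (4 * pi\<^sup>2 - 4 * pi) * m" using m0 by (intro mult_right_mono) auto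
    then show ?thesis by (simp add: algebra_simps)
  qed
  ultimately have "m \<le> cmod (D k)" by linarith
  then show ?thesis by (simp only: m_def)
qed

lemma iD_le: "norm (iD k) \<le> wt n k"
proof (cases "k * (k + int n) = 0")
  case False
  define m where "m = \<bar>real_of_int (k * (k + int n))\<bar>"
  have m: "m > 0" "m \<le> cmod (D k)" using D_ge[OF False] False by (simp_all only: m_def)
  then have "1 / cmod (D k) \<le> 1 / m" by (intro divide_left_mono mult_pos_pos) auto
  then show ?thesis using False by (simp add: iD_def norm_divide wt_def m_def)
qed (simp add: iD_def wt_def)

text \<open>The reflection preserves k (k + n) and reverses the sign of n + 2 k, so only the
  \<open>\<kappa>\<close> term changes. At \<open>k = 0\<close> it compares the two resonant
  divisors, and this is how \<open>\<kappa>\<close> is recovered.\<close>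

lemma D_reflect: "D (- int n - k) = D k - 4 * of_real pi * \<i> * \<kappa> * of_int (int n + 2 * k)"
proof -
  have e: "(- int n - k) * (- int n - k + int n) = k * (k + int n)" "int n + 2 * (- int n - k) = - (int n + 2 * k)"
    by (simp_all add: algebra_simps)
  have gen: "\<tau> - A + 2 * of_real pi * \<i> * \<kappa> * (- X) = \<tau> - A + 2 * of_real pi * \<i> * \<kappa> * X - 4 * of_real pi * \<i> * \<kappa> * X"
    for A X :: complex by (simp add: algebra_simps)
  show ?thesis unfolding D_def e of_int_minus by (rule gen)
qed

lemma P_reflect_sq: "(\<lambda>k. (P (- k))\<^sup>2) summable_on UNIV" "sqrt (\<Sum>\<^sub>\<infinity>k. (P (- k))\<^sup>2) \<le> M"
  using summable_on_int_shift(2)[of "\<lambda>k. (P k)\<^sup>2" 0] infsum_int_shift(2)[of "\<lambda>k. (P k)\<^sup>2" 0] P_sq by simp_all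

lemmas conv_P = conv_wt[OF n P_sq P_nonneg]

lemma shift_P: "(\<lambda>j. P (j + m) * wt n j) summable_on UNIV" "(\<Sum>\<^sub>\<infinity>j. P (j + m) * wt n j) \<le> M * wt_const / real n"
  using conv_wt[OF n P_reflect_sq P_nonneg, of "- m"] by (simp_all add: add.commute)

text \<open>A bound for \<open>Kop\<close> in the supremum norm, of order 1/n.\<close>

definition \<theta> :: real where "\<theta> = M * wt_const / real n"

lemma \<theta>: "\<theta> \<ge> 0" "2 ^ (N + 2) * \<theta> \<le> 1" "\<theta> \<le> 1 / 4"
proof -
  show t0: "\<theta> \<ge> 0" using M_nonneg wt_const_nonneg by (simp add: \<theta>_def)
  show t1: "2 ^ (N + 2) * \<theta> \<le> 1" using small n by (simp add: \<theta>_def field_simps)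
  have "4 * \<theta> \<le> 2 ^ (N + 2) * \<theta>" using t0 by (intro mult_right_mono) auto
  then show "\<theta> \<le> 1 / 4" using t1 by simp
qed

lemma Kop_term:
  assumes "\<And>j. norm (y j) \<le> B"
  shows "norm (Q (k - j) * iD j * y j) \<le> B * (P (k - j) * wt n j)"
proof -
  have "norm (Q (k - j) * iD j * y j) \<le> P (k - j) * wt n j * B"
    unfolding norm_mult using Q_le_P iD_le assms P_nonneg wt_nonneg by (intro mult_mono) auto
  then show ?thesis by (simp add: mult_ac)
qed

lemma Kop_summable:
  assumes "\<And>j. norm (y j) \<le> B"
  shows "(\<lambda>j. norm (Q (k - j) * iD j * y j)) summable_on UNIV"
    and "(\<lambda>j. Q (k - j) * iD j * y j) summable_on UNIV"
proof -
  show 1: "(\<lambda>j. norm (Q (k - j) * iD j * y j)) summable_on UNIV"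
    by (rule summable_on_comparison_test[OF summable_on_cmult_right[OF conv_P(1), of B k]])
      (use Kop_term[OF assms] in auto)
  show "(\<lambda>j. Q (k - j) * iD j * y j) summable_on UNIV" using 1 by (simp add: summable_on_norm_iff_complex)
qed

lemma norm_infsum_le_real:
  assumes "g summable_on UNIV" "\<And>j. norm (f j :: complex) \<le> g j"
  shows "norm (\<Sum>\<^sub>\<infinity>j. f j) \<le> (\<Sum>\<^sub>\<infinity>j. g j)"
proof -
  have s: "(\<lambda>j. norm (f j)) summable_on UNIV"
    by (rule summable_on_comparison_test[OF assms(1)]) (use assms(2) in auto)
  show ?thesis using norm_infsum_bound[OF s] infsum_mono[OF s assms(1)] assms(2) by fastforce
qed

lemma Kop_bound:
  assumes "\<And>j. norm (y j) \<le> B"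
  shows "norm (Kop y k) \<le> B * \<theta>"
proof -
  have B: "B \<ge> 0" using assms[of 0] norm_ge_zero order_trans by blast
  have "norm (Kop y k) \<le> (\<Sum>\<^sub>\<infinity>j. B * (P (k - j) * wt n j))"
    unfolding Kop_def by (intro norm_infsum_le_real summable_on_cmult_right conv_P Kop_term assms)
  also have "\<dots> \<le> B * \<theta>" unfolding \<theta>_def using mult_left_mono[OF conv_P(2) B] by (simp only: infsum_cmult_right')
  finally show ?thesis .
qed

lemma Kop_diff:
  assumes "\<And>j. norm (y j) \<le> B" "\<And>j. norm (z j) \<le> B'"
  shows "Kop y k - Kop z k = Kop (\<lambda>j. y j - z j) k"
proof -
  have "Kop (\<lambda>j. y j - z j) k = (\<Sum>\<^sub>\<infinity>j. Q (k - j) * iD j * y j + - (Q (k - j) * iD j * z j))"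
    unfolding Kop_def by (rule infsum_cong) (simp add: algebra_simps)
  also have "\<dots> = Kop y k + (\<Sum>\<^sub>\<infinity>j. - (Q (k - j) * iD j * z j))"
    unfolding Kop_def by (intro infsum_add summable_on_uminus Kop_summable(2)[OF assms(1)])
      (simp add: summable_on_uminus Kop_summable(2)[OF assms(2)])
  finally show ?thesis by (simp add: infsum_uminus Kop_def)
qed

text \<open>The weight at k + m falls on either k - j or j + m; in the first case it completes
  \<open>P (k - j)\<close>, in the second it cancels. Weighted bounds for \<open>Kop\<close> thus
  cost only a factor \<open>2 ^ (N + 1)\<close> over unweighted ones.\<close>

lemma weight_shift: "jap (k + m) ^ N * norm (Q (k - j)) * (1 / jap (j + m) ^ N) \<le> 2 ^ (N + 1) * P (k - j)"
proof -
  have J: "jap j ^ N > 0" for j using jap_pos by simp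
  have "jap (k + m) ^ N \<le> 2 ^ N * (jap (k - j) ^ N + jap (j + m) ^ N)"
    using jap_add_power[of "k - j" "j + m" N] by (simp add: algebra_simps)
  then have "jap (k + m) ^ N * norm (Q (k - j)) * (1 / jap (j + m) ^ N)
     \<le> 2 ^ N * (jap (k - j) ^ N + jap (j + m) ^ N) * norm (Q (k - j)) * (1 / jap (j + m) ^ N)"
    using J by (intro mult_right_mono) (auto simp: less_imp_le)
  also have "\<dots> = 2 ^ N * (P (k - j) * (1 / jap (j + m) ^ N) + norm (Q (k - j)))"
  proof -
    have "2 ^ N * (a + b) * c * (1 / b) = 2 ^ N * (a * c * (1 / b) + c)" if "b \<noteq> 0" for a b c :: real
      using that by (simp add: field_simps)
    from this[where a = "jap (k - j) ^ N" and b = "jap (j + m) ^ N" and c = "norm (Q (k - j))"]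
    show ?thesis unfolding jap_Q using jap_pos[of "j + m"] by simp
  qed
  also have "\<dots> \<le> 2 ^ N * (P (k - j) * 1 + P (k - j))"
  proof -
    have "1 / jap (j + m) ^ N \<le> 1" using jap_ge_1 J by (simp add: divide_le_eq_1_pos)
    then show ?thesis using P_nonneg Q_le_P by (intro mult_left_mono add_mono) auto
  qed
  finally show ?thesis by simp
qed

lemma Kop_weighted:
  assumes y: "\<And>j. norm (y j) \<le> B / jap (j + m) ^ N"
  shows "norm (Kop y k) \<le> 2 ^ (N + 1) * B * \<theta> / jap (k + m) ^ N"
proof -
  have J: "jap j ^ N > 0" for j using jap_pos by simp
  have B: "B \<ge> 0" using order_trans[OF norm_ge_zero y[of 0]] J by (simp add: zero_le_divide_iff) (metis J less_le_not_le)
  have t: "norm (Q (k - j) * iD j * y j) \<le> 2 ^ (N + 1) * B / jap (k + m) ^ N * (P (k - j) * wt n j)" for j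
  proof -
    note 1 = weight_shift[of k m j]
    have "norm (Q (k - j) * iD j * y j) * jap (k + m) ^ N \<le> norm (Q (k - j)) * wt n j * (B / jap (j + m) ^ N) * jap (k + m) ^ N"
      unfolding norm_mult using J iD_le y wt_nonneg by (intro mult_right_mono mult_mono) (auto simp: less_imp_le)
    also have "\<dots> = (jap (k + m) ^ N * norm (Q (k - j)) * (1 / jap (j + m) ^ N)) * (B * wt n j)" by simp
    also have "\<dots> \<le> (2 ^ (N + 1) * P (k - j)) * (B * wt n j)" using 1 B wt_nonneg by (intro mult_right_mono) auto
    finally show ?thesis using J[of "k + m"] by (simp add: field_simps)
  qed
  have "norm (Kop y k) \<le> (\<Sum>\<^sub>\<infinity>j. 2 ^ (N + 1) * B / jap (k + m) ^ N * (P (k - j) * wt n j))"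
    unfolding Kop_def by (intro norm_infsum_le_real summable_on_cmult_right conv_P t)
  also have "\<dots> = 2 ^ (N + 1) * B / jap (k + m) ^ N * (\<Sum>\<^sub>\<infinity>j. P (k - j) * wt n j)" by (rule infsum_cmult_right')
  also have "\<dots> \<le> 2 ^ (N + 1) * B / jap (k + m) ^ N * \<theta>"
    unfolding \<theta>_def using B J by (intro mult_left_mono conv_P) (auto simp: less_imp_le)
  finally show ?thesis by simp
qed

lemma fixed_point_exists:
  obtains y where "\<And>k. norm (y k) \<le> 2 * M / jap (k + m) ^ N" "\<And>k. y k = Q (k + m) + Kop y k"
proof -
  have J: "jap j ^ N \<ge> 1" for j using jap_ge_1 by simp
  \<comment> \<open>Half of the radius \<open>2 * M\<close> is taken by the source \<open>Q\<close>,
    the other half by \<open>Kop\<close>, since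
    \<open>2 ^ (N + 2) * \<theta> \<le> 1\<close>.\<close>
  define W where "W = (\<lambda>k. 2 * M / jap (k + m) ^ N)"
  have Wb: "W k \<le> 2 * M" for k
  proof -
    have "2 * M / jap (k + m) ^ N \<le> 2 * M / 1" using M_nonneg J[of "k + m"] by (intro divide_left_mono) auto
    then show ?thesis by (simp add: W_def)
  qed
  obtain y where y: "\<And>k. norm (y k) \<le> W k" "\<And>k. Q (k + m) + Kop y k = y k"
  proof (rule pointwise_contraction_fixed_point[of W "2 * M" "\<lambda>y k. Q (k + m) + Kop y k"])
    show "0 \<le> W k" for k using M_nonneg jap_pos[of "k + m"] by (simp add: W_def)
    show "W k \<le> 2 * M" for k by (rule Wb)
    fix y :: "int \<Rightarrow> complex" and k assume y: "\<And>k. norm (y k) \<le> W k"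
    have "norm (Kop y k) \<le> 2 ^ (N + 1) * (2 * M) * \<theta> / jap (k + m) ^ N"
      by (rule Kop_weighted) (use y in \<open>simp add: W_def\<close>)
    also have "\<dots> = M * (2 ^ (N + 2) * \<theta>) / jap (k + m) ^ N" by simp
    also have "\<dots> \<le> M * 1 / jap (k + m) ^ N"
      using M_nonneg \<theta>(2) J[of "k + m"] by (intro divide_right_mono mult_left_mono) auto
    finally show "norm (Q (k + m) + Kop y k) \<le> W k"
      using Q_le[of "k + m"] norm_triangle_ineq[of "Q (k + m)" "Kop y k"] by (simp add: W_def)
  next
    fix y z :: "int \<Rightarrow> complex" and d k
    assume "\<And>k. norm (y k) \<le> W k" "\<And>k. norm (z k) \<le> W k" and d: "\<And>k. norm (y k - z k) \<le> d"
    then have b: "norm (y k) \<le> 2 * M" "norm (z k) \<le> 2 * M" for k using Wb order_trans by blast+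
    have "norm (Kop y k - Kop z k) \<le> d * \<theta>" unfolding Kop_diff[OF b] by (rule Kop_bound[OF d])
    also have "\<dots> \<le> d * (1 / 2)" using \<theta> order_trans[OF norm_ge_zero d[of 0]] by (intro mult_left_mono) auto
    finally show "norm (Q (k + m) + Kop y k - (Q (k + m) + Kop z k)) \<le> d / 2" by simp
  qed blast
  show ?thesis by (rule that[of y]) (use y in \<open>auto simp: W_def\<close>)
qed

lemma Kop_no_eigenvector:
  assumes "\<And>k. norm (d k) \<le> B" "\<And>k. d k = Kop d k"
  shows "d k = 0"
proof -
  have "norm (d k) \<le> B * (1 / 2) ^ r" for r k
  proof (induction r arbitrary: k)
    case (Suc r)
    have "norm (Kop d k) \<le> (B * (1 / 2) ^ r) * \<theta>" by (rule Kop_bound[OF Suc])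
    also have "\<dots> \<le> (B * (1 / 2) ^ r) * (1 / 2)"
      using \<theta> order_trans[OF norm_ge_zero assms(1)[of 0]] by (intro mult_left_mono) auto
    finally show ?case using assms(2)[of k] by simp
  qed (use assms in simp)
  moreover have "(\<lambda>r. B * (1 / 2) ^ r) \<longlonglongrightarrow> B * 0" by (intro tendsto_intros LIMSEQ_power_zero) simp
  ultimately have "norm (d k) \<le> B * 0" by (intro LIMSEQ_le_const) auto
  then show ?thesis by simp
qed

end

section \<open>Reduction to the two resonant coefficients\<close>

lemma has_sum_single: "((\<lambda>j. if j = i then c else 0) has_sum c) UNIV" for c :: complex
  by (rule has_sum_finite_neutralI[of "{i}"]) auto

context resonance
begin

text \<open>The response \<open>D k * H k\<close> to a single unit resonant coefficient at index
  \<open>- m\<close>: \<open>m = 0\<close> belongs to \<open>H 0\<close> and \<open>m = n\<close> to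
  \<open>H (- n)\<close>.\<close>

definition shift_solution :: "int \<Rightarrow> (int \<Rightarrow> complex) \<Rightarrow> bool" where
  "shift_solution m y \<longleftrightarrow> (\<forall>k. norm (y k) \<le> 2 * M / jap (k + m) ^ N) \<and> (\<forall>k. y k = Q (k + m) + Kop y k)"

lemma shift_solution_exists: "\<exists>y. shift_solution m y"
  using fixed_point_exists[of m] unfolding shift_solution_def by metis

lemma shift_solution_bound:
  assumes "shift_solution m y" shows "norm (y k) \<le> 2 * M"
proof -
  have "2 * M / jap (k + m) ^ N \<le> 2 * M / 1"
    using M_nonneg jap_ge_1 jap_pos by (intro divide_left_mono one_le_power) auto
  moreover have "norm (y k) \<le> 2 * M / jap (k + m) ^ N" using assms unfolding shift_solution_def by blast
  ultimately show ?thesis by simp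
qed

lemma shift_solution_eq: "shift_solution m y \<Longrightarrow> y k = Q (k + m) + Kop y k"
  unfolding shift_solution_def by blast

lemma shift_solution_Kop:
  assumes "shift_solution m y" shows "norm (Kop y k) \<le> 2 ^ (N + 2) * M * \<theta> / jap (k + m) ^ N"
proof -
  have "norm (y j) \<le> 2 * M / jap (j + m) ^ N" for j using assms unfolding shift_solution_def by blast
  from Kop_weighted[OF this, of k] show ?thesis by simp
qed

lemma shift_solution_Kop':
  assumes "shift_solution m y" shows "norm (Kop y k) \<le> 2 * M * \<theta>"
  by (rule Kop_bound) (rule shift_solution_bound[OF assms])

lemma Kop_cmult: "Kop (\<lambda>j. c * y j) k = c * Kop y k"
  unfolding Kop_def by (subst infsum_cmult_right'[symmetric]) (simp add: mult_ac)

text \<open>The resonant indices \<open>0\<close> and \<open>- n\<close> are split off; all other coefficients are determined by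
  \<open>H 0\<close> and \<open>H (- n)\<close> through the contraction.\<close>

lemma two_dimensional_reduction:
  assumes H: "(\<lambda>k. norm (H k)) summable_on UNIV"
    and eq: "\<And>k. ((\<lambda>j. Q (k - j) * H j) has_sum D k * H k) UNIV"
    and y0: "shift_solution 0 y0" and yn: "shift_solution (int n) yn"
  shows "D k * H k = H 0 * y0 k + H (- int n) * yn k"
    and "k \<noteq> 0 \<Longrightarrow> k \<noteq> - int n \<Longrightarrow> H k = H 0 * (iD k * y0 k) + H (- int n) * (iD k * yn k)"
proof -
  define y where "y = (\<lambda>k. D k * H k)"
  define u v where "u = H 0" and "v = H (- int n)"
  have nn: "- int n \<noteq> 0" using n by simp
  have Hy: "H j = iD j * y j" if "j \<noteq> 0" "j \<noteq> - int n" for j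
  proof -
    have z: "j * (j + int n) \<noteq> 0" using that by auto
    have "\<bar>real_of_int (j * (j + int n))\<bar> > 0" using z by (simp only: zero_less_abs_iff of_int_eq_0_iff) simp
    then have "D j \<noteq> 0" using D_ge[OF z] by auto
    then show ?thesis using z by (simp add: y_def iD_def)
  qed
  have iDz: "iD 0 = 0" "iD (- int n) = 0" by (simp_all add: iD_def)
  define S where "S = (\<Sum>\<^sub>\<infinity>k. norm (H k))"
  have yb: "norm (y k) \<le> M * S" for k
  proof -
    have "norm (\<Sum>\<^sub>\<infinity>j. Q (k - j) * H j) \<le> (\<Sum>\<^sub>\<infinity>j. M * norm (H j))"
    proof (rule norm_infsum_le_real)
      show "(\<lambda>j. M * norm (H j)) summable_on UNIV" using H by (rule summable_on_cmult_right)
      show "norm (Q (k - j) * H j) \<le> M * norm (H j)" for j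
        unfolding norm_mult using order_trans[OF Q_le_P P_le_M] by (intro mult_right_mono) auto
    qed
    then show ?thesis using infsumI[OF eq[of k]] by (simp add: y_def S_def infsum_cmult_right')
  qed
  have yeq: "y k = u * Q k + v * Q (k + int n) + Kop y k" for k
  proof -
    have Hs: "Q (k - j) * H j = Q (k - j) * iD j * y j + ((if j = 0 then u * Q k else 0) + (if j = - int n then v * Q (k + int n) else 0))" for j
      using Hy[of j] nn iDz by (cases "j = 0 \<or> j = - int n") (auto simp: u_def v_def)
    have "((\<lambda>j. Q (k - j) * iD j * y j) has_sum Kop y k) UNIV"
      unfolding Kop_def by (rule has_sum_infsum) (rule Kop_summable(2)[OF yb])
    then have "((\<lambda>j. Q (k - j) * H j) has_sum (Kop y k + (u * Q k + v * Q (k + int n)))) UNIV"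
      unfolding Hs by (intro has_sum_add has_sum_single)
    then have "y k = Kop y k + (u * Q k + v * Q (k + int n))" using eq[of k] unfolding y_def by (metis has_sum_unique)
    then show ?thesis by simp
  qed
  \<comment> \<open>Two bounded solutions of the same inhomogeneous equation differ by a bounded
    solution of \<open>d = Kop d\<close>.\<close>
  define d where "d = (\<lambda>k. y k - (u * y0 k - - (v * yn k)))"
  have b1: "norm (u * y0 k) \<le> norm u * (2 * M)" "norm (- (v * yn k)) \<le> norm v * (2 * M)" for k
    using shift_solution_bound[OF y0, of k] shift_solution_bound[OF yn, of k] by (simp_all add: norm_mult mult_left_mono)
  have b2: "norm (u * y0 k - - (v * yn k)) \<le> norm u * (2 * M) + norm v * (2 * M)" for k
    using norm_triangle_ineq4[of "u * y0 k" "- (v * yn k)"] b1[of k] by simp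
  have b3: "norm (d k) \<le> M * S + (norm u * (2 * M) + norm v * (2 * M))" for k
    using norm_triangle_ineq4[of "y k" "u * y0 k - - (v * yn k)"] b2[of k] yb[of k] unfolding d_def by linarith
  have dK: "d k = Kop d k" for k
  proof -
    have neg: "Kop (\<lambda>j. - (v * yn j)) k = - (v * Kop yn k)" using Kop_cmult[of "- v" yn k] by simp
    have "Kop d k = Kop y k - (u * Kop y0 k - - (v * Kop yn k))"
      unfolding d_def Kop_diff[OF yb b2, symmetric] Kop_diff[OF b1, symmetric] neg Kop_cmult by simp
    moreover have "d k = u * Q k + v * Q (k + int n) + Kop y k - (u * (Q k + Kop y0 k) + v * (Q (k + int n) + Kop yn k))"
      using yeq[of k] shift_solution_eq[OF y0, of k] shift_solution_eq[OF yn, of k] by (simp add: d_def)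
    ultimately have "d k + (u * Kop y0 k + v * Kop yn k) = Kop d k + (u * Kop y0 k + v * Kop yn k)"
      by (simp add: algebra_simps)
    then show ?thesis by (simp only: add_right_cancel)
  qed
  have "d k = 0" for k by (rule Kop_no_eigenvector[OF b3 dK])
  then have sol: "y k = u * y0 k + v * yn k" for k by (simp add: d_def)
  then show "D k * H k = H 0 * y0 k + H (- int n) * yn k" by (simp add: y_def u_def v_def)
  show "k \<noteq> 0 \<Longrightarrow> k \<noteq> - int n \<Longrightarrow> H k = H 0 * (iD k * y0 k) + H (- int n) * (iD k * yn k)"
    using Hy[of k] sol[of k] by (simp add: u_def v_def algebra_simps)
qed

lemma iD_mult_summable:
  assumes "\<And>j. norm (y j) \<le> B"
  shows "(\<lambda>j. norm (iD j * y j)) summable_on UNIV" "(\<lambda>j. iD j * y j) summable_on UNIV"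
proof -
  show "(\<lambda>j. norm (iD j * y j)) summable_on UNIV"
  proof (rule summable_on_comparison_test)
    show "(\<lambda>j. wt n j * B) summable_on UNIV" by (intro summable_on_cmult_left wt_summable)
    show "norm (iD j * y j) \<le> wt n j * B" for j
      unfolding norm_mult using iD_le assms wt_nonneg by (intro mult_mono) auto
  qed simp
  then show "(\<lambda>j. iD j * y j) summable_on UNIV" by (simp add: summable_on_norm_iff_complex)
qed

text \<open>This sum is the total of the nonresonant coefficients generated by one resonant one. The
  source part pairs an l2 sequence with the weight; the \<open>Kop\<close> part is uniformly of
  order \<open>\<theta>\<close> and the weight is summable.\<close>

lemma sigma_bound:
  assumes y: "shift_solution m y"
  shows "norm (\<Sum>\<^sub>\<infinity>j. iD j * y j) \<le> \<theta> * (1 + 2 * M * zeta2)"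
proof -
  have s1: "(\<lambda>j. 2 * M * \<theta> * wt n j) summable_on UNIV" by (intro summable_on_cmult_right wt_summable)
  have "norm (\<Sum>\<^sub>\<infinity>j. iD j * y j) \<le> (\<Sum>\<^sub>\<infinity>j. P (j + m) * wt n j + 2 * M * \<theta> * wt n j)"
  proof (rule norm_infsum_le_real)
    show "(\<lambda>j. P (j + m) * wt n j + 2 * M * \<theta> * wt n j) summable_on UNIV"
      by (intro summable_on_add shift_P s1)
    fix j
    have "norm (y j) \<le> norm (Q (j + m)) + norm (Kop y j)" using shift_solution_eq[OF y, of j] norm_triangle_ineq by metis
    also have "\<dots> \<le> P (j + m) + 2 * M * \<theta>" by (intro add_mono Q_le_P shift_solution_Kop'[OF y])
    finally have "norm (iD j * y j) \<le> wt n j * (P (j + m) + 2 * M * \<theta>)"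
      unfolding norm_mult using iD_le wt_nonneg by (intro mult_mono) auto
    then show "norm (iD j * y j) \<le> P (j + m) * wt n j + 2 * M * \<theta> * wt n j" by (simp add: algebra_simps)
  qed
  also have "\<dots> = (\<Sum>\<^sub>\<infinity>j. P (j + m) * wt n j) + (\<Sum>\<^sub>\<infinity>j. 2 * M * \<theta> * wt n j)"
    by (intro infsum_add shift_P s1)
  also have "\<dots> \<le> \<theta> + 2 * M * \<theta> * zeta2"
  proof -
    have "(\<Sum>\<^sub>\<infinity>j. P (j + m) * wt n j) \<le> \<theta>" using shift_P(2)[of m] by (simp add: \<theta>_def)
    moreover have "0 \<le> 2 * M * \<theta>" using M_nonneg \<theta>(1) by simp
    ultimately show ?thesis unfolding infsum_cmult_right' using wt_infsum by (intro add_mono mult_left_mono)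
  qed
  finally show ?thesis by (simp add: algebra_simps)
qed

text \<open>The difference of the reciprocals is the difference of the divisors times both
  reciprocals. By \<open>D_reflect\<close> it contains \<open>\<kappa>\<close> times n + 2 j, and
  the latter uses up one of the two weights.\<close>

lemma iD_reflect_diff: "norm (iD j - iD (- int n - j)) \<le> 8 * pi * norm \<kappa> * wt n j"
proof (cases "j * (j + int n) = 0")
  case True
  have "(- int n - j) * (- int n - j + int n) = j * (j + int n)" by (simp add: algebra_simps)
  then have "(- int n - j) * (- int n - j + int n) = 0" using True by simp
  then have "iD (- int n - j) = 0" "iD j = 0" unfolding iD_def by (rule if_P) (rule if_P[OF True])
  then show ?thesis using wt_nonneg by simp
next
  case False
  have e: "(- int n - j) * (- int n - j + int n) = j * (j + int n)" by (simp add: algebra_simps)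
  have F': "(- int n - j) * (- int n - j + int n) \<noteq> 0" using False e by simp
  define m where "m = \<bar>real_of_int (j * (j + int n))\<bar>"
  have m: "m > 0" using False by (simp only: m_def zero_less_abs_iff of_int_eq_0_iff) simp
  have D0: "D j \<noteq> 0" "D (- int n - j) \<noteq> 0"
    using D_ge[OF False] D_ge[OF F', unfolded e] m by (auto simp: m_def)
  have "iD j - iD (- int n - j) = (D (- int n - j) - D j) * iD j * iD (- int n - j)"
    using False F' D0 by (simp add: iD_def field_simps)
  also have "D (- int n - j) - D j = - (4 * of_real pi * \<i> * \<kappa> * of_int (int n + 2 * j))" by (simp add: D_reflect)
  finally have "norm (iD j - iD (- int n - j)) = 4 * pi * norm \<kappa> * \<bar>real_of_int (int n + 2 * j)\<bar> * norm (iD j) * norm (iD (- int n - j))"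
    by (simp add: norm_mult del: of_int_add of_int_mult)
  also have "\<dots> \<le> 4 * pi * norm \<kappa> * (2 * m) * wt n j * wt n j"
  proof -
    have "real_of_int \<bar>int n + 2 * j\<bar> \<le> real_of_int (2 * \<bar>j * (j + int n)\<bar>)"
      using abs_int_resonance(1)[OF False] by (simp only: of_int_le_iff)
    then have "\<bar>real_of_int (int n + 2 * j)\<bar> \<le> 2 * m" by (simp only: m_def of_int_mult of_int_numeral of_int_abs)
    then show ?thesis using iD_le[of j] iD_le[of "- int n - j"] wt_nonneg m
      by (intro mult_mono) (auto simp: wt_reflect)
  qed
  also have "\<dots> = 8 * pi * norm \<kappa> * wt n j * (m * wt n j)" by simp
  also have "m * wt n j = 1" using m by (simp only: wt_def m_def) simp
  finally show ?thesis by simp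
qed

text \<open>Transposing the coefficient matrix \<open>Q (k - j)\<close> and reflecting \<open>j\<close> to \<open>- n - j\<close> interchanges the
  two diagonal entries up to the sign of \<open>\<kappa>\<close>, so their difference carries a factor \<open>\<kappa>\<close>.\<close>

lemma alpha_difference:
  assumes y0: "shift_solution 0 y0" and yn: "shift_solution (int n) yn"
  shows "norm (Kop y0 0 - Kop yn (- int n)) \<le> 32 * pi * M\<^sup>2 * zeta2 * norm \<kappa>"
proof -
  define a b where "a = (\<lambda>j. iD j * y0 j)" and "b = (\<lambda>j. iD j * yn j)"
  have a: "(\<lambda>j. norm (a j)) summable_on UNIV"
    unfolding a_def by (rule iD_mult_summable(1)[OF shift_solution_bound[OF y0]])
  have b: "(\<lambda>j. norm (b j)) summable_on UNIV"
    unfolding b_def by (rule iD_mult_summable(1)[OF shift_solution_bound[OF yn]])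
  have K: "Kop y0 k = (\<Sum>\<^sub>\<infinity>j. Q (k - j) * a j)" "Kop yn k = (\<Sum>\<^sub>\<infinity>j. Q (k - j) * b j)" for k
    by (simp_all add: Kop_def a_def b_def mult.assoc)
  have Qb: "norm (Q k) \<le> M" for k using Q_le_P P_le_M order_trans by blast
  have prod_sum: "(\<lambda>j. c j * z j) summable_on UNIV"
    if "(\<lambda>j. norm (c j)) summable_on UNIV" "\<And>j. norm (z j) \<le> B" for c z :: "int \<Rightarrow> complex" and B
  proof -
    have "(\<lambda>j. norm (c j * z j)) summable_on UNIV"
    proof (rule summable_on_comparison_test)
      show "(\<lambda>j. norm (c j) * B) summable_on UNIV" by (rule summable_on_cmult_left[OF that(1)])
      show "norm (c j * z j) \<le> norm (c j) * B" for j unfolding norm_mult using that(2) by (intro mult_left_mono) auto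
    qed simp
    then show ?thesis by (simp add: summable_on_norm_iff_complex)
  qed
  have Kb: "norm (Kop y0 k) \<le> 2 * M * \<theta>" "norm (Kop yn k) \<le> 2 * M * \<theta>" for k
    using shift_solution_Kop'[OF y0] shift_solution_Kop'[OF yn] by auto
  \<comment> \<open>Absolute summability of the double series, to justify exchanging the order of
    summation.\<close>
  have "(\<lambda>(j, i). a j * (Q (- int n - j - i) * b i)) summable_on UNIV \<times> UNIV"
  proof -
    have bound: "norm (a j * (Q (- int n - j - i) * b i)) \<le> (norm (a j) * M) * norm (b i)" for i j
      unfolding norm_mult using Qb[of "- int n - j - i"] by (simp add: mult_left_mono mult_right_mono mult.assoc)
    have s2: "(\<lambda>i. (norm (a j) * M) * norm (b i)) summable_on UNIV" for j by (intro summable_on_cmult_right b)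
    have inner: "(\<lambda>i. norm (a j * (Q (- int n - j - i) * b i))) summable_on UNIV" for j
      by (rule summable_on_comparison_test[OF s2 bound]) simp
    have "(\<lambda>j. \<Sum>\<^sub>\<infinity>i. norm (a j * (Q (- int n - j - i) * b i))) summable_on UNIV"
    proof (rule summable_on_comparison_test)
      show "(\<lambda>j. norm (a j) * (M * (\<Sum>\<^sub>\<infinity>i. norm (b i)))) summable_on UNIV" by (rule summable_on_cmult_left[OF a])
      show "(\<Sum>\<^sub>\<infinity>i. norm (a j * (Q (- int n - j - i) * b i))) \<le> norm (a j) * (M * (\<Sum>\<^sub>\<infinity>i. norm (b i)))" for j
        using infsum_mono[OF inner s2 bound, of j] by (simp add: infsum_cmult_right' mult.assoc)
    qed (auto intro: infsum_nonneg)
    then have "(\<lambda>x. norm ((\<lambda>(j, i). a j * (Q (- int n - j - i) * b i)) x)) summable_on UNIV \<times> UNIV"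
      unfolding Infinite_Sum.abs_summable_on_Sigma_iff using inner by (simp add: infsum_nonneg)
    then show ?thesis by (rule Infinite_Sum.abs_summable_summable)
  qed
  from infsum_swap_banach[OF this]
  have "(\<Sum>\<^sub>\<infinity>j. a j * Kop yn (- int n - j)) = (\<Sum>\<^sub>\<infinity>i. \<Sum>\<^sub>\<infinity>j. a j * (Q (- int n - j - i) * b i))"
    by (simp add: K infsum_cmult_right')
  also have "\<dots> = (\<Sum>\<^sub>\<infinity>i. \<Sum>\<^sub>\<infinity>j. b i * (Q (- int n - i - j) * a j))"
  proof (intro infsum_cong)
    fix i j
    have e: "- int n - j - i = - int n - i - j" by simp
    show "a j * (Q (- int n - j - i) * b i) = b i * (Q (- int n - i - j) * a j)"
      unfolding e by (simp only: mult_ac)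
  qed
  also have "\<dots> = (\<Sum>\<^sub>\<infinity>i. b i * Kop y0 (- int n - i))" by (simp add: K infsum_cmult_right')
  finally have swap: "(\<Sum>\<^sub>\<infinity>j. a j * Kop yn (- int n - j)) = (\<Sum>\<^sub>\<infinity>j. b j * Kop y0 (- int n - j))" .
  \<comment> \<open>The coefficient \<open>Q (- j)\<close> is expressed through the equation for
    \<open>yn\<close> at \<open>- n - j\<close>. With the analogous expression for the other entry,
    the double sums agree by \<open>swap\<close> and only single sums remain.\<close>
  have "Kop y0 0 = (\<Sum>\<^sub>\<infinity>j. a j * yn (- int n - j) + - (a j * Kop yn (- int n - j)))"
    unfolding K(1)[of 0]
  proof (rule infsum_cong)
    fix j
    have e: "Q (0 - j) = yn (- int n - j) - Kop yn (- int n - j)" using shift_solution_eq[OF yn, of "- int n - j"] by simp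
    show "Q (0 - j) * a j = a j * yn (- int n - j) + - (a j * Kop yn (- int n - j))"
      unfolding e by (simp add: algebra_simps)
  qed
  also have "\<dots> = (\<Sum>\<^sub>\<infinity>j. a j * yn (- int n - j)) + (\<Sum>\<^sub>\<infinity>j. - (a j * Kop yn (- int n - j)))"
    using prod_sum[OF a shift_solution_bound[OF yn]] prod_sum[OF a Kb(2)]
    by (intro infsum_add) (auto simp: summable_on_uminus)
  finally have A: "Kop y0 0 = (\<Sum>\<^sub>\<infinity>j. a j * yn (- int n - j)) - (\<Sum>\<^sub>\<infinity>j. a j * Kop yn (- int n - j))" by (simp add: infsum_uminus)
  have "Kop yn (- int n) = (\<Sum>\<^sub>\<infinity>j. b j * y0 (- int n - j) + - (b j * Kop y0 (- int n - j)))"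
    unfolding K(2)[of "- int n"]
  proof (rule infsum_cong)
    fix j
    have e: "Q (- int n - j) = y0 (- int n - j) - Kop y0 (- int n - j)" using shift_solution_eq[OF y0, of "- int n - j"] by simp
    show "Q (- int n - j) * b j = b j * y0 (- int n - j) + - (b j * Kop y0 (- int n - j))"
      unfolding e by (simp add: algebra_simps)
  qed
  also have "\<dots> = (\<Sum>\<^sub>\<infinity>j. b j * y0 (- int n - j)) + (\<Sum>\<^sub>\<infinity>j. - (b j * Kop y0 (- int n - j)))"
    using prod_sum[OF b shift_solution_bound[OF y0]] prod_sum[OF b Kb(1)]
    by (intro infsum_add) (auto simp: summable_on_uminus)
  finally have B: "Kop yn (- int n) = (\<Sum>\<^sub>\<infinity>j. b j * y0 (- int n - j)) - (\<Sum>\<^sub>\<infinity>j. b j * Kop y0 (- int n - j))" by (simp add: infsum_uminus)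
  \<comment> \<open>Reflecting the index gives both sums the common factor
    \<open>y0 j * yn (- n - j)\<close>, so that the reciprocals can be subtracted.\<close>
  have "(\<Sum>\<^sub>\<infinity>j. b j * y0 (- int n - j)) = (\<Sum>\<^sub>\<infinity>j. b (- int n - j) * y0 j)"
    using infsum_int_shift(2)[of "\<lambda>j. b j * y0 (- int n - j)" "- int n"] by simp
  moreover have sb: "(\<lambda>j. b (- int n - j) * y0 j) summable_on UNIV"
    using summable_on_int_shift(2)[of "\<lambda>j. b j * y0 (- int n - j)" "- int n"] prod_sum[OF b shift_solution_bound[OF y0]] by simp
  ultimately have "Kop y0 0 - Kop yn (- int n) = (\<Sum>\<^sub>\<infinity>j. a j * yn (- int n - j)) + (\<Sum>\<^sub>\<infinity>j. - (b (- int n - j) * y0 j))"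
    unfolding A B swap by (simp add: infsum_uminus)
  also have "\<dots> = (\<Sum>\<^sub>\<infinity>j. a j * yn (- int n - j) + - (b (- int n - j) * y0 j))"
    using prod_sum[OF a shift_solution_bound[OF yn]] sb by (intro infsum_add[symmetric]) (auto simp: summable_on_uminus)
  also have "\<dots> = (\<Sum>\<^sub>\<infinity>j. y0 j * yn (- int n - j) * (iD j - iD (- int n - j)))"
    by (rule infsum_cong) (simp add: a_def b_def algebra_simps)
  also have "norm \<dots> \<le> (\<Sum>\<^sub>\<infinity>j. 32 * pi * M\<^sup>2 * norm \<kappa> * wt n j)"
  proof (rule norm_infsum_le_real)
    show "(\<lambda>j. 32 * pi * M\<^sup>2 * norm \<kappa> * wt n j) summable_on UNIV" by (intro summable_on_cmult_right wt_summable)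
    fix j
    have "norm (y0 j * yn (- int n - j) * (iD j - iD (- int n - j))) \<le> (2 * M) * (2 * M) * (8 * pi * norm \<kappa> * wt n j)"
      unfolding norm_mult using shift_solution_bound[OF y0, of j] shift_solution_bound[OF yn, of "- int n - j"] iD_reflect_diff M_nonneg
      by (intro mult_mono) auto
    then show "norm (y0 j * yn (- int n - j) * (iD j - iD (- int n - j))) \<le> 32 * pi * M\<^sup>2 * norm \<kappa> * wt n j"
      by (simp add: power2_eq_square mult_ac)
  qed
  also have "\<dots> \<le> 32 * pi * M\<^sup>2 * norm \<kappa> * zeta2"
    unfolding infsum_cmult_right' using wt_infsum by (intro mult_left_mono) auto
  finally show ?thesis by (simp add: mult_ac)
qed

end

text \<open>Young's inequality: Cauchy--Schwarz with \<open>f\<close> split into two square roots,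
  then summation over the shifts. Finite sets of shifts suffice for the later square-sum
  bounds.\<close>

lemma convolution_l1_l2:
  fixes f g :: "int \<Rightarrow> real"
  assumes f: "f summable_on UNIV" "\<And>j. 0 \<le> f j" and g: "(\<lambda>j. (g j)\<^sup>2) summable_on UNIV" "\<And>j. 0 \<le> g j"
    and F: "finite F"
  shows "(\<lambda>j. f j * g (j + m)) summable_on UNIV"
    and "(\<Sum>m\<in>F. (\<Sum>\<^sub>\<infinity>j. f j * g (j + m))\<^sup>2) \<le> (\<Sum>\<^sub>\<infinity>j. f j)\<^sup>2 * (\<Sum>\<^sub>\<infinity>j. (g j)\<^sup>2)"
proof -
  define G where "G = (\<Sum>\<^sub>\<infinity>j. (g j)\<^sup>2)"
  define S where "S = (\<Sum>\<^sub>\<infinity>j. f j)"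
  have S0: "S \<ge> 0" unfolding S_def using f(2) by (intro infsum_nonneg)
  have gs: "(\<lambda>j. (g (j + m))\<^sup>2) summable_on UNIV" "(\<Sum>\<^sub>\<infinity>j. (g (j + m))\<^sup>2) = G" for m
    using g(1) summable_on_int_shift(1)[of "\<lambda>j. (g j)\<^sup>2" m] infsum_int_shift(1)[of "\<lambda>j. (g j)\<^sup>2" m] by (simp_all add: G_def)
  have gG: "(g j)\<^sup>2 \<le> G" for j using finite_sum_le_infsum[OF g(1), of "{j}"] by (simp add: G_def)
  have fg: "(\<lambda>j. f j * (g (j + m))\<^sup>2) summable_on UNIV" for m
    by (rule summable_on_comparison_test[OF summable_on_cmult_left[OF f(1), of G]])
      (use gG f in \<open>auto intro: mult_left_mono\<close>)
  have sq: "(sqrt (f j))\<^sup>2 = f j" for j using f(2) by simp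
  have s1: "(\<lambda>j. (sqrt (f j))\<^sup>2) summable_on UNIV" and s2: "(\<lambda>j. (sqrt (f j) * g (j + m))\<^sup>2) summable_on UNIV" for m
    using f(1) fg by (simp_all add: power_mult_distrib sq)
  have e: "\<bar>sqrt (f j)\<bar> * \<bar>sqrt (f j) * g (j + m)\<bar> = f j * g (j + m)" for j m
    using f(2)[of j] g(2)[of "j + m"] by (simp add: abs_mult mult.assoc[symmetric])
  show "(\<lambda>j. f j * g (j + m)) summable_on UNIV"
    using infsum_Cauchy_Schwarz(1)[OF s1 s2] by (simp only: e)
  have each: "(\<Sum>\<^sub>\<infinity>j. f j * g (j + m))\<^sup>2 \<le> S * (\<Sum>\<^sub>\<infinity>j. f j * (g (j + m))\<^sup>2)" for m
  proof -
    have "(\<Sum>\<^sub>\<infinity>j. f j * g (j + m)) \<le> sqrt S * sqrt (\<Sum>\<^sub>\<infinity>j. f j * (g (j + m))\<^sup>2)"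
      using infsum_Cauchy_Schwarz(2)[OF s1 s2, of m] by (simp only: e sq power_mult_distrib S_def)
    moreover have "0 \<le> (\<Sum>\<^sub>\<infinity>j. f j * g (j + m))" using f(2) g(2) by (intro infsum_nonneg) auto
    ultimately have "(\<Sum>\<^sub>\<infinity>j. f j * g (j + m))\<^sup>2 \<le> (sqrt S * sqrt (\<Sum>\<^sub>\<infinity>j. f j * (g (j + m))\<^sup>2))\<^sup>2"
      by (intro power_mono)
    also have "\<dots> = S * (\<Sum>\<^sub>\<infinity>j. f j * (g (j + m))\<^sup>2)"
      using S0 f(2) by (simp add: power_mult_distrib infsum_nonneg)
    finally show ?thesis .
  qed
  have fin: "(\<Sum>m\<in>F. (g (j + m))\<^sup>2) \<le> G" for j
  proof -
    have "(\<Sum>m\<in>F. (g (j + m))\<^sup>2) = (\<Sum>i\<in>(\<lambda>m. j + m) ` F. (g i)\<^sup>2)" by (subst sum.reindex) (auto simp: inj_on_def)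
    also have "\<dots> \<le> G" unfolding G_def by (rule finite_sum_le_infsum[OF g(1)]) (use F in auto)
    finally show ?thesis .
  qed
  have sumfg: "(\<lambda>j. \<Sum>m\<in>F. f j * (g (j + m))\<^sup>2) summable_on UNIV"
    by (rule summable_on_comparison_test[OF summable_on_cmult_left[OF f(1), of G]])
      (use fin f(2) in \<open>auto simp: sum_distrib_left[symmetric] intro!: mult_left_mono mult_nonneg_nonneg sum_nonneg\<close>)
  have "(\<Sum>m\<in>F. (\<Sum>\<^sub>\<infinity>j. f j * g (j + m))\<^sup>2) \<le> (\<Sum>m\<in>F. S * (\<Sum>\<^sub>\<infinity>j. f j * (g (j + m))\<^sup>2))"
    by (intro sum_mono each)
  also have "\<dots> = S * (\<Sum>m\<in>F. (\<Sum>\<^sub>\<infinity>j. f j * (g (j + m))\<^sup>2))" by (simp add: sum_distrib_left)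
  also have "(\<Sum>m\<in>F. (\<Sum>\<^sub>\<infinity>j. f j * (g (j + m))\<^sup>2)) = (\<Sum>\<^sub>\<infinity>j. \<Sum>m\<in>F. f j * (g (j + m))\<^sup>2)"
    using F
  proof (induction F)
    case (insert x F)
    have "(\<lambda>j. \<Sum>m\<in>F. f j * (g (j + m))\<^sup>2) summable_on UNIV"
      using insert.hyps(1) by (induction F) (auto intro!: summable_on_add fg)
    then show ?case using insert by (simp add: infsum_add fg)
  qed simp
  also have "\<dots> \<le> (\<Sum>\<^sub>\<infinity>j. f j * G)"
    using fin f by (intro infsum_mono sumfg summable_on_cmult_left) (auto simp: sum_distrib_left[symmetric] intro: mult_left_mono)
  also have "\<dots> = S * G" by (simp add: infsum_cmult_left' S_def)
  finally have "(\<Sum>m\<in>F. (\<Sum>\<^sub>\<infinity>j. f j * g (j + m))\<^sup>2) \<le> S * (S * G)" using S0 by (simp add: mult_left_mono)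
  then show "(\<Sum>m\<in>F. (\<Sum>\<^sub>\<infinity>j. f j * g (j + m))\<^sup>2) \<le> (\<Sum>\<^sub>\<infinity>j. f j)\<^sup>2 * (\<Sum>\<^sub>\<infinity>j. (g j)\<^sup>2)"
    by (simp add: S_def G_def power2_eq_square mult_ac)
qed

section \<open>Quadratic remainders and the estimate for kappa\<close>

context resonance
begin

text \<open>Majorant of the quadratic term of an off-diagonal entry after multiplication by n^(N+1),
  up to a constant: \<open>weight_shift\<close> has supplied the weights and \<open>wt_split\<close>
  has replaced \<open>n * wt n j\<close>.\<close>

definition pair_sum :: "int \<Rightarrow> int \<Rightarrow> real" where
  "pair_sum k m = (\<Sum>\<^sub>\<infinity>j. P (k - j) * P (j + m) * (\<bar>1 / real_of_int j\<bar> + \<bar>1 / real_of_int (j + int n)\<bar>))"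

lemma pair_sum_summable:
  "(\<lambda>j. P (k - j) * P (j + m) * (\<bar>1 / real_of_int j\<bar> + \<bar>1 / real_of_int (j + int n)\<bar>)) summable_on UNIV"
proof (rule summable_on_comparison_test)
  have s: "(\<lambda>j. (P (k - j))\<^sup>2) summable_on UNIV" "(\<lambda>j. (P (j + m))\<^sup>2) summable_on UNIV"
    using P_sq(1) summable_on_int_shift(2)[of "\<lambda>j. (P j)\<^sup>2" k] summable_on_int_shift(1)[of "\<lambda>j. (P j)\<^sup>2" m] by simp_all
  have [simp]: "\<bar>P k\<bar> = P k" for k using P_nonneg by simp
  show "(\<lambda>j. P (k - j) * P (j + m) * 2) summable_on UNIV"
    using infsum_Cauchy_Schwarz(1)[OF s] by (intro summable_on_cmult_left) simp
  have inv: "\<bar>1 / real_of_int j\<bar> \<le> 1" for j by (cases "j = 0") auto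
  show "P (k - j) * P (j + m) * (\<bar>1 / real_of_int j\<bar> + \<bar>1 / real_of_int (j + int n)\<bar>) \<le> P (k - j) * P (j + m) * 2" for j
    using inv[of j] inv[of "j + int n"] P_nonneg by (intro mult_left_mono) auto
qed (use P_nonneg in auto)

text \<open>For the pairs (0, n) and (- n, 0) these are the corrections to the off-diagonal entries.
  Inserting the equation for \<open>y\<close> once separates the quadratic part; the rest carries an
  additional \<open>\<theta>\<close>, hence 1/n.\<close>

lemma beta_bound:
  assumes y: "shift_solution m y" and km: "jap (k + m) = real n"
  shows "real n ^ (N + 1) * norm (Kop y k) \<le> 2 ^ (N + 1) * pair_sum k m + 2 ^ (2 * N + 3) * M\<^sup>2 * wt_const * \<theta>"
proof -
  define c where "c = real n * (2 ^ (N + 1) * (2 ^ (N + 2) * M * \<theta>))"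
  have c0: "c \<ge> 0" using M_nonneg \<theta>(1) by (simp add: c_def)
  define ab where "ab = (\<lambda>j. \<bar>1 / real_of_int j\<bar> + \<bar>1 / real_of_int (j + int n)\<bar>)"
  define g where "g = (\<lambda>j. 2 ^ (N + 1) * (P (k - j) * P (j + m) * ab j) + c * (P (k - j) * wt n j))"
  have gs: "g summable_on UNIV"
    unfolding g_def ab_def by (intro summable_on_add summable_on_cmult_right pair_sum_summable conv_P)
  have t: "norm (real n ^ (N + 1) * (Q (k - j) * iD j * y j)) \<le> g j" for j
  proof -
    have w: "real n ^ N * norm (Q (k - j)) * (1 / jap (j + m) ^ N) \<le> 2 ^ (N + 1) * P (k - j)"
      using weight_shift[of k m j] by (simp only: km)
    have "norm (y j) \<le> norm (Q (j + m)) + norm (Kop y j)" using shift_solution_eq[OF y, of j] norm_triangle_ineq by metis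
    also have "\<dots> \<le> P (j + m) * (1 / jap (j + m) ^ N) + 2 ^ (N + 2) * M * \<theta> * (1 / jap (j + m) ^ N)"
      using shift_solution_Kop[OF y, of j] jap_pos[of "j + m"] by (intro add_mono) (simp_all add: jap_Q[symmetric])
    also have "\<dots> = (1 / jap (j + m) ^ N) * (P (j + m) + 2 ^ (N + 2) * M * \<theta>)" by (simp add: algebra_simps)
    finally have yb: "norm (y j) \<le> (1 / jap (j + m) ^ N) * (P (j + m) + 2 ^ (N + 2) * M * \<theta>)" .
    have pos: "0 \<le> P (j + m) + 2 ^ (N + 2) * M * \<theta>" using P_nonneg M_nonneg \<theta>(1) by simp
    have "norm (real n ^ (N + 1) * (Q (k - j) * iD j * y j)) = real n ^ (N + 1) * (norm (Q (k - j)) * norm (iD j) * norm (y j))"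
      by (simp add: norm_mult norm_power)
    also have "\<dots> \<le> real n ^ (N + 1) * (norm (Q (k - j)) * wt n j * ((1 / jap (j + m) ^ N) * (P (j + m) + 2 ^ (N + 2) * M * \<theta>)))"
      using iD_le yb wt_nonneg by (intro mult_left_mono mult_mono) auto
    also have "\<dots> = (real n ^ N * norm (Q (k - j)) * (1 / jap (j + m) ^ N)) * ((real n * wt n j) * (P (j + m) + 2 ^ (N + 2) * M * \<theta>))"
      by simp
    also have "\<dots> \<le> (2 ^ (N + 1) * P (k - j)) * ((real n * wt n j) * (P (j + m) + 2 ^ (N + 2) * M * \<theta>))"
      using w pos wt_nonneg by (intro mult_right_mono) auto
    also have "\<dots> = 2 ^ (N + 1) * (P (k - j) * P (j + m) * (real n * wt n j)) + c * (P (k - j) * wt n j)"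
      by (simp add: c_def algebra_simps)
    also have "\<dots> \<le> g j"
      unfolding g_def using wt_split[OF n, of j] P_nonneg
      using c0 by (intro add_mono mult_left_mono) (auto simp: ab_def)
    finally show ?thesis .
  qed
  have "real n ^ (N + 1) * norm (Kop y k) = norm (\<Sum>\<^sub>\<infinity>j. complex_of_real (real n ^ (N + 1)) * (Q (k - j) * iD j * y j))"
    by (simp add: infsum_cmult_right' norm_mult Kop_def norm_power)
  also have "\<dots> \<le> (\<Sum>\<^sub>\<infinity>j. g j)" by (rule norm_infsum_le_real[OF gs]) (use t in simp)
  also have "\<dots> = 2 ^ (N + 1) * pair_sum k m + c * (\<Sum>\<^sub>\<infinity>j. P (k - j) * wt n j)"
    unfolding g_def ab_def pair_sum_def
    unfolding infsum_add[OF summable_on_cmult_right[OF pair_sum_summable] summable_on_cmult_right[OF conv_P(1)]]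
      infsum_cmult_right' by (rule refl)
  also have "\<dots> \<le> 2 ^ (N + 1) * pair_sum k m + c * \<theta>"
    using conv_P(2)[of k] c0 by (intro add_mono mult_left_mono) (auto simp: \<theta>_def)
  also have "c * \<theta> = 2 ^ (2 * N + 3) * M\<^sup>2 * wt_const * \<theta>"
  proof -
    have "real n * \<theta> = M * wt_const" using n by (simp add: \<theta>_def)
    then have "c = 2 ^ (N + 1) * 2 ^ (N + 2) * M * (M * wt_const)" by (simp add: c_def mult_ac)
    moreover have "(2::real) ^ (N + 1) * 2 ^ (N + 2) = 2 ^ (2 * N + 3)" by (subst power_add[symmetric]) (rule arg_cong[where f = "power 2"], simp)
    ultimately show ?thesis by (simp add: power2_eq_square mult_ac)
  qed
  finally show ?thesis .
qed

text \<open>With t = H (- n) / H 0 the resonant equations read D 0 = y0 0 + t B and D (- n) = yn (-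
  n) + A / t. Their difference gives \<kappa>, and t is close to -1. In \<open>C\<close> the first
  summand stems from the diagonal difference \<open>\<delta>\<close>, the second from t + 1 and 1/t
  + 1.\<close>

theorem resonance_estimate:
  assumes H: "(\<lambda>k. norm (H k)) summable_on UNIV" and Hsum: "(H has_sum 0) UNIV" and Hnz: "\<exists>k. H k \<noteq> 0"
    and eq: "\<And>k. ((\<lambda>j. Q (k - j) * H j) has_sum D k * H k) UNIV"
    and large: "4 * (M * wt_const * (1 + 2 * M * zeta2)) \<le> real n" "16 * M\<^sup>2 * zeta2 \<le> real n"
    and C: "C = 32 * pi * M\<^sup>2 * zeta2 + 3 * (M * wt_const * (1 + 2 * M * zeta2))"
  shows "real n ^ (N + 1) * norm (2 * pi * n * \<kappa> - (Q (- int n) - Q (int n)) / (2 * \<i>))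
    \<le> C * (P (int n) + P (- int n)) + (C + 1) * (2 ^ (N + 1) * (pair_sum 0 (int n) + pair_sum (- int n) 0)
       + 2 ^ (2 * N + 4) * M\<^sup>2 * wt_const * \<theta>)"
proof -
  obtain y0 yn where y0: "shift_solution 0 y0" and yn: "shift_solution (int n) yn"
    using shift_solution_exists by blast
  define u v where "u = H 0" and "v = H (- int n)"
  define \<sigma>a \<sigma>b where "\<sigma>a = (\<Sum>\<^sub>\<infinity>j. iD j * y0 j)" and "\<sigma>b = (\<Sum>\<^sub>\<infinity>j. iD j * yn j)"
  note red = two_dimensional_reduction[OF H eq y0 yn, folded u_def v_def]
  have nn: "- int n \<noteq> 0" using n by simp
  have iDz: "iD 0 = 0" "iD (- int n) = 0" by (simp_all add: iD_def)
  define s where "s = \<theta> * (1 + 2 * M * zeta2)"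
  have s_n: "real n * s = M * wt_const * (1 + 2 * M * zeta2)" using n by (simp add: s_def \<theta>_def)
  have s0: "s \<ge> 0" using \<theta>(1) M_nonneg zeta2_nonneg by (simp add: s_def)
  have s14: "s \<le> 1 / 4"
  proof -
    have "real n * (4 * s) \<le> real n * 1" using large(1) s_n by simp
    then show ?thesis using n by (simp only: mult_le_cancel_left_pos of_nat_0_less_iff)
  qed
  have \<sigma>: "norm \<sigma>a \<le> s" "norm \<sigma>b \<le> s"
    unfolding \<sigma>a_def \<sigma>b_def s_def by (rule sigma_bound[OF y0] sigma_bound[OF yn])+
  have ge: "3 / 4 \<le> norm (1 + \<sigma>)" if "norm \<sigma> \<le> s" for \<sigma> :: complex
    using norm_triangle_ineq4[of "1 + \<sigma>" \<sigma>] that s14 by simp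
  have nz: "1 + \<sigma>a \<noteq> 0" "1 + \<sigma>b \<noteq> 0" using ge[OF \<sigma>(1)] ge[OF \<sigma>(2)] by auto
  have Heq: "H j = u * (iD j * y0 j) + v * (iD j * yn j) + ((if j = 0 then u else 0) + (if j = - int n then v else 0))" for j
    using red(2)[of j] iDz nn by (cases "j = 0 \<or> j = - int n") (auto simp: u_def v_def)
  have hs: "((\<lambda>j. iD j * y0 j) has_sum \<sigma>a) UNIV" "((\<lambda>j. iD j * yn j) has_sum \<sigma>b) UNIV"
    unfolding \<sigma>a_def \<sigma>b_def
    by (rule has_sum_infsum, rule iD_mult_summable(2), rule shift_solution_bound, rule y0)
      (rule has_sum_infsum, rule iD_mult_summable(2), rule shift_solution_bound, rule yn)
  have "((\<lambda>j. u * (iD j * y0 j) + v * (iD j * yn j) + ((if j = 0 then u else 0) + (if j = - int n then v else 0)))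
      has_sum (u * \<sigma>a + v * \<sigma>b + (u + v))) UNIV"
    by (intro has_sum_add has_sum_cmult_right hs has_sum_single)
  then have "(H has_sum (u * \<sigma>a + v * \<sigma>b + (u + v))) UNIV" by (simp only: Heq[symmetric])
  then have "u * \<sigma>a + v * \<sigma>b + (u + v) = 0" using Hsum by (rule has_sum_unique)
  \<comment> \<open>The Dirichlet condition at 0, in the form that all coefficients sum to zero,
    fixes the ratio \<open>v / u\<close>.\<close>
  then have uv: "v * (1 + \<sigma>b) = - (u * (1 + \<sigma>a))" by (simp add: algebra_simps eq_neg_iff_add_eq_0)
  have uv0: "u \<noteq> 0" "v \<noteq> 0"
  proof -
    have "\<not> (u = 0 \<and> v = 0)" using Hnz Heq by auto
    then show "u \<noteq> 0" "v \<noteq> 0" using uv nz by auto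
  qed
  define t where "t = v / u"
  have t: "t = - (1 + \<sigma>a) / (1 + \<sigma>b)" "1 / t = - (1 + \<sigma>b) / (1 + \<sigma>a)"
  proof -
    have "t * (1 + \<sigma>b) = (v * (1 + \<sigma>b)) / u" by (simp add: t_def)
    also have "\<dots> = - (1 + \<sigma>a)" unfolding uv using uv0 by simp
    finally show *: "t = - (1 + \<sigma>a) / (1 + \<sigma>b)" using nz by (simp add: eq_divide_eq)
    have "1 / (- X / Y) = - Y / X" for X Y :: complex by simp
    then show "1 / t = - (1 + \<sigma>b) / (1 + \<sigma>a)" unfolding * .
  qed
  have t1: "norm (t + 1) \<le> 3 * s" "norm (1 / t + 1) \<le> 3 * s"
  proof -
    have *: "norm ((x - y) / (1 + z)) \<le> 3 * s" if "norm x \<le> s" "norm y \<le> s" "norm z \<le> s" for x y z :: complex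
    proof -
      have "norm (x - y) \<le> 2 * s" using norm_triangle_ineq4[of x y] that by simp
      also have "\<dots> \<le> 3 * s * (3 / 4)" using s0 by simp
      also have "\<dots> \<le> 3 * s * norm (1 + z)" using ge[OF that(3)] s0 by (intro mult_left_mono) auto
      finally show ?thesis using ge[OF that(3)] by (auto simp: norm_divide divide_le_eq)
    qed
    have "t + 1 = (\<sigma>b - \<sigma>a) / (1 + \<sigma>b)" "1 / t + 1 = (\<sigma>a - \<sigma>b) / (1 + \<sigma>a)"
    proof -
      have gen: "- X / Y + 1 = (Y - X) / Y" if "Y \<noteq> 0" for X Y :: complex using that by (simp add: field_simps)
      show "t + 1 = (\<sigma>b - \<sigma>a) / (1 + \<sigma>b)" unfolding t(1) gen[OF nz(2)] by simp
      show "1 / t + 1 = (\<sigma>a - \<sigma>b) / (1 + \<sigma>a)" unfolding t(2) gen[OF nz(1)] by simp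
    qed
    then show "norm (t + 1) \<le> 3 * s" "norm (1 / t + 1) \<le> 3 * s" using * \<sigma> by simp_all
  qed
  have t2: "norm t \<le> 2" "norm (1 / t) \<le> 2"
    using norm_triangle_ineq4[of "t + 1" 1] norm_triangle_ineq4[of "1 / t + 1" 1] t1 s14 by simp_all
  define \<delta> where "\<delta> = Kop y0 0 - Kop yn (- int n)"
  define b1 b2 where "b1 = Kop yn 0" and "b2 = Kop y0 (- int n)"
  define B A where "B = Q (int n) + b1" and "A = Q (- int n) + b2"
  have vals: "y0 0 - yn (- int n) = \<delta>" "yn 0 = B" "y0 (- int n) = A"
    using shift_solution_eq[OF y0, of 0] shift_solution_eq[OF y0, of "- int n"]
      shift_solution_eq[OF yn, of 0] shift_solution_eq[OF yn, of "- int n"]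
    by (simp_all add: \<delta>_def B_def A_def b1_def b2_def Q0)
  have D1: "D 0 = y0 0 + t * B" "D (- int n) = (1 / t) * A + yn (- int n)"
    using red(1)[of 0] red(1)[of "- int n"] uv0 unfolding u_def[symmetric] v_def[symmetric] vals
    by (simp_all add: t_def field_simps)
  have D2: "D 0 - D (- int n) = 4 * of_real pi * \<i> * \<kappa> * of_nat n" using D_reflect[of 0] by simp
  have main: "4 * of_real pi * \<i> * \<kappa> * of_nat n = \<delta> + t * B - (1 / t) * A"
    using D1 D2 vals(1) by (simp add: algebra_simps)
  have \<delta>: "norm \<delta> \<le> 32 * pi * M\<^sup>2 * zeta2 * norm \<kappa>" unfolding \<delta>_def by (rule alpha_difference[OF y0 yn])
  \<comment> \<open>A preliminary bound by absorption: \<open>\<delta>\<close> contains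
    \<open>\<kappa>\<close>, but \<open>large(2)\<close> makes its coefficient at most
    \<open>2 * pi * real n\<close>, half of the one on the left.\<close>
  have \<kappa>b: "real n * norm \<kappa> \<le> norm A + norm B"
  proof -
    have "4 * pi * norm \<kappa> * real n = norm (\<delta> + t * B - (1 / t) * A)" unfolding main[symmetric] by (simp add: norm_mult)
    also have "\<dots> \<le> norm \<delta> + norm (t * B) + norm ((1 / t) * A)"
      using norm_triangle_ineq4[of "\<delta> + t * B" "(1 / t) * A"] norm_triangle_ineq[of \<delta> "t * B"] by linarith
    also have "\<dots> \<le> 32 * pi * M\<^sup>2 * zeta2 * norm \<kappa> + 2 * norm B + 2 * norm A"
      unfolding norm_mult using \<delta> t2 by (intro add_mono mult_right_mono) auto
    also have "32 * pi * M\<^sup>2 * zeta2 * norm \<kappa> = (16 * M\<^sup>2 * zeta2) * (2 * pi * norm \<kappa>)" by simp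
    also have "\<dots> \<le> real n * (2 * pi * norm \<kappa>)" using large(2) by (intro mult_right_mono) auto
    finally have "pi * (real n * norm \<kappa>) \<le> norm A + norm B" by (simp add: algebra_simps)
    moreover have "1 * (real n * norm \<kappa>) \<le> pi * (real n * norm \<kappa>)" using pi_gt3 by (intro mult_right_mono) auto
    ultimately show ?thesis by simp
  qed
  define r where "r = 2 * pi * n * \<kappa> - (Q (- int n) - Q (int n)) / (2 * \<i>)"
  have "2 * \<i> * r = 4 * of_real pi * \<i> * \<kappa> * of_nat n - (Q (- int n) - Q (int n))" 
  proof -
    have e: "2 * \<i> * (w / (2 * \<i>)) = w" for w :: complex by simp
    have "2 * \<i> * r = 2 * \<i> * (2 * pi * n * \<kappa>) - 2 * \<i> * ((Q (- int n) - Q (int n)) / (2 * \<i>))"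
      by (simp only: r_def right_diff_distrib)
    then show ?thesis unfolding e by (simp add: mult_ac)
  qed
  \<comment> \<open>Expanding t and 1/t about -1 leaves A - B, which consists of the main term and
    \<open>b2 - b1\<close>.\<close>
  also have "\<dots> = \<delta> + (t + 1) * B - (1 / t + 1) * A - b1 + b2"
    unfolding main by (simp add: A_def B_def algebra_simps)
  finally have "2 * norm r = norm (\<delta> + (t + 1) * B - (1 / t + 1) * A - b1 + b2)"
    by (metis norm_mult norm_numeral norm_ii mult.right_neutral)
  also have "\<dots> \<le> norm \<delta> + norm ((t + 1) * B) + norm ((1 / t + 1) * A) + norm b1 + norm b2"
    using norm_triangle_ineq[of "\<delta> + (t + 1) * B - (1 / t + 1) * A - b1" b2]
      norm_triangle_ineq4[of "\<delta> + (t + 1) * B - (1 / t + 1) * A" b1]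
      norm_triangle_ineq4[of "\<delta> + (t + 1) * B" "(1 / t + 1) * A"] norm_triangle_ineq[of \<delta> "(t + 1) * B"] by linarith
  also have "\<dots> \<le> 32 * pi * M\<^sup>2 * zeta2 * norm \<kappa> + 3 * s * norm B + 3 * s * norm A + norm b1 + norm b2"
    unfolding norm_mult using \<delta> t1 by (intro add_mono mult_right_mono) auto
  finally have r2: "2 * norm r \<le> 32 * pi * M\<^sup>2 * zeta2 * norm \<kappa> + 3 * s * (norm A + norm B) + norm b1 + norm b2"
    by (simp add: algebra_simps)
  have C0: "C \<ge> 0" using M_nonneg zeta2_nonneg wt_const_nonneg unfolding C by simp
  have "real n * (2 * norm r) \<le> real n * (32 * pi * M\<^sup>2 * zeta2 * norm \<kappa> + 3 * s * (norm A + norm B) + norm b1 + norm b2)"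
    using r2 by (intro mult_left_mono) auto
  also have "\<dots> = 32 * pi * M\<^sup>2 * zeta2 * (real n * norm \<kappa>) + 3 * (real n * s) * (norm A + norm B) + real n * (norm b1 + norm b2)"
    by (simp add: algebra_simps)
  also have "\<dots> \<le> 32 * pi * M\<^sup>2 * zeta2 * (norm A + norm B) + 3 * (real n * s) * (norm A + norm B) + real n * (norm b1 + norm b2)"
    using \<kappa>b zeta2_nonneg s0 by (intro add_mono mult_left_mono) auto
  also have "\<dots> = C * (norm A + norm B) + real n * (norm b1 + norm b2)" unfolding s_n C by (simp add: algebra_simps)
  also have "\<dots> \<le> C * ((norm (Q (int n)) + norm (Q (- int n))) + real n * (norm b1 + norm b2)) + real n * (norm b1 + norm b2)"
  proof -
    have "norm A + norm B \<le> norm (Q (- int n)) + norm b2 + (norm (Q (int n)) + norm b1)"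
      unfolding A_def B_def by (intro add_mono norm_triangle_ineq)
    moreover have "1 * (norm b1 + norm b2) \<le> real n * (norm b1 + norm b2)" using n by (intro mult_right_mono) auto
    ultimately show ?thesis using C0 by (intro add_right_mono mult_left_mono) auto
  qed
  finally have "real n ^ N * (real n * (2 * norm r)) \<le> real n ^ N *
      (C * ((norm (Q (int n)) + norm (Q (- int n))) + real n * (norm b1 + norm b2)) + real n * (norm b1 + norm b2))"
    by (intro mult_left_mono) auto
  also have "\<dots> = C * (real n ^ N * norm (Q (int n)) + real n ^ N * norm (Q (- int n))) + (C + 1) * (real n ^ (N + 1) * norm b1 + real n ^ (N + 1) * norm b2)"
    by (simp add: algebra_simps)
  also have "\<dots> \<le> C * (P (int n) + P (- int n)) + (C + 1) * ((2 ^ (N + 1) * pair_sum 0 (int n) + 2 ^ (2 * N + 3) * M\<^sup>2 * wt_const * \<theta>)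
       + (2 ^ (N + 1) * pair_sum (- int n) 0 + 2 ^ (2 * N + 3) * M\<^sup>2 * wt_const * \<theta>))"
  proof -
    have j: "jap (0 + int n) = real n" "jap (- int n + 0) = real n" using n by (auto simp: jap_def)
    have "real n ^ N * norm (Q (int n)) = P (int n)" "real n ^ N * norm (Q (- int n)) = P (- int n)" by (simp_all add: P_def)
    then show ?thesis
      unfolding b1_def b2_def using C0 beta_bound[OF yn j(1)] beta_bound[OF y0 j(2)]
      by (intro add_mono mult_left_mono) auto
  qed
  finally have fin: "real n ^ N * (real n * (2 * norm r)) \<le> C * (P (int n) + P (- int n)) + (C + 1) * ((2 ^ (N + 1) * pair_sum 0 (int n) + 2 ^ (2 * N + 3) * M\<^sup>2 * wt_const * \<theta>)
       + (2 ^ (N + 1) * pair_sum (- int n) 0 + 2 ^ (2 * N + 3) * M\<^sup>2 * wt_const * \<theta>))" .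
  have "real n ^ N * (real n * (2 * norm r)) \<le> C * (P (int n) + P (- int n)) + (C + 1) * (2 ^ (N + 1) * (pair_sum 0 (int n) + pair_sum (- int n) 0)
       + 2 ^ (2 * N + 4) * M\<^sup>2 * wt_const * \<theta>)"
  proof -
    have "2 * N + 4 = Suc (2 * N + 3)" by simp
    then have "(2::real) ^ (2 * N + 4) = 2 * 2 ^ (2 * N + 3)" by (simp only: power_Suc)
    then show ?thesis using fin by (simp add: algebra_simps)
  qed
  moreover have "real n ^ (N + 1) * norm r \<le> real n ^ N * (real n * (2 * norm r))" by (simp add: mult_left_mono)
  ultimately show ?thesis unfolding r_def[symmetric] by linarith
qed

end

section \<open>The remainder sequence\<close>

text \<open>\<open>K\<close> bounds the square of the norm. Testing on finite sets yields
  summability and the bound together, with one constant for all potentials.\<close>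

definition l2_bounded :: "(nat \<Rightarrow> real) \<Rightarrow> real \<Rightarrow> bool" where
  "l2_bounded f K \<longleftrightarrow> (\<forall>F. finite F \<and> F \<subseteq> {1..} \<longrightarrow> (\<Sum>n\<in>F. (f n)\<^sup>2) \<le> K)"

lemma l2_bounded_add:
  assumes "l2_bounded f K" "l2_bounded g L"
  shows "l2_bounded (\<lambda>n. f n + g n) (2 * K + 2 * L)"
  unfolding l2_bounded_def
proof (intro allI impI)
  fix F :: "nat set" assume F: "finite F \<and> F \<subseteq> {1..}"
  have "(\<Sum>n\<in>F. (f n + g n)\<^sup>2) \<le> (\<Sum>n\<in>F. 2 * (f n)\<^sup>2 + 2 * (g n)\<^sup>2)"
  proof (rule sum_mono)
    fix n show "(f n + g n)\<^sup>2 \<le> 2 * (f n)\<^sup>2 + 2 * (g n)\<^sup>2"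
      using sum_squares_bound[of "f n" "g n"] by (simp add: power2_sum)
  qed
  also have "\<dots> = 2 * (\<Sum>n\<in>F. (f n)\<^sup>2) + 2 * (\<Sum>n\<in>F. (g n)\<^sup>2)" by (simp add: sum.distrib sum_distrib_left)
  also have "\<dots> \<le> 2 * K + 2 * L" using assms F unfolding l2_bounded_def by (intro add_mono mult_left_mono) auto
  finally show "(\<Sum>n\<in>F. (f n + g n)\<^sup>2) \<le> 2 * K + 2 * L" .
qed

lemma l2_bounded_cmult: "l2_bounded f K \<Longrightarrow> l2_bounded (\<lambda>n. c * f n) (c\<^sup>2 * K)"
  unfolding l2_bounded_def power_mult_distrib sum_distrib_left[symmetric]
  by (intro allI impI mult_left_mono) simp_all

lemma l2_bounded_mono:
  assumes g: "l2_bounded g K" and le: "\<And>n. n \<ge> 1 \<Longrightarrow> 0 \<le> f n \<and> f n \<le> g n"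
  shows "l2_bounded f K"
  unfolding l2_bounded_def
proof (intro allI impI)
  fix F :: "nat set" assume F: "finite F \<and> F \<subseteq> {1..}"
  have "(\<Sum>n\<in>F. (f n)\<^sup>2) \<le> (\<Sum>n\<in>F. (g n)\<^sup>2)"
    using F le by (intro sum_mono power_mono) auto
  also have "\<dots> \<le> K" using g F unfolding l2_bounded_def by blast
  finally show "(\<Sum>n\<in>F. (f n)\<^sup>2) \<le> K" .
qed

lemma l2_bounded_int:
  fixes \<phi> :: "int \<Rightarrow> real" and \<iota> :: "nat \<Rightarrow> int"
  assumes "inj \<iota>" "\<And>F. finite F \<Longrightarrow> (\<Sum>k\<in>F. (\<phi> k)\<^sup>2) \<le> K"
  shows "l2_bounded (\<lambda>n. \<phi> (\<iota> n)) K"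
  unfolding l2_bounded_def
proof (intro allI impI)
  fix F :: "nat set" assume "finite F \<and> F \<subseteq> {1..}"
  moreover have "(\<Sum>n\<in>F. (\<phi> (\<iota> n))\<^sup>2) = (\<Sum>k\<in>\<iota> ` F. (\<phi> k)\<^sup>2)"
    by (subst sum.reindex) (use assms(1) in \<open>auto intro: inj_on_subset\<close>)
  ultimately show "(\<Sum>n\<in>F. (\<phi> (\<iota> n))\<^sup>2) \<le> K" using assms(2) by simp
qed

lemma l2_bounded_cutoff:
  "l2_bounded (\<lambda>n. if n \<le> n1 then c else 0) (real n1 * c\<^sup>2)"
  unfolding l2_bounded_def
proof (intro allI impI)
  fix F :: "nat set" assume F: "finite F \<and> F \<subseteq> {1..}"
  have "(\<Sum>n\<in>F. (if n \<le> n1 then c else 0)\<^sup>2) = (\<Sum>n\<in>F. if n \<in> {1..n1} then c\<^sup>2 else 0)"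
    using F by (intro sum.cong) auto
  also have "\<dots> = (\<Sum>n\<in>F \<inter> {1..n1}. c\<^sup>2)" by (rule sum.inter_restrict[symmetric]) (use F in simp)
  also have "\<dots> \<le> (\<Sum>n\<in>{1..n1}. c\<^sup>2)" by (intro sum_mono2) auto
  finally show "(\<Sum>n\<in>F. (if n \<le> n1 then c else 0)\<^sup>2) \<le> real n1 * c\<^sup>2" by simp
qed

lemma l2_bounded_inverse: "l2_bounded (\<lambda>n. 1 / real n) zeta2"
proof -
  have "l2_bounded (\<lambda>n. 1 / real_of_int (int n)) zeta2"
  proof (rule l2_bounded_int)
    fix F :: "int set" assume "finite F"
    then show "(\<Sum>k\<in>F. (1 / real_of_int k)\<^sup>2) \<le> zeta2"
      unfolding zeta2_def power_divide by (simp add: finite_sum_le_infsum[OF inverse_square_int_summable])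
  qed simp
  then show ?thesis by simp
qed

lemma l2_bounded_imp_ell2:
  assumes "l2_bounded (\<lambda>n. cmod (a n)) K"
  shows "a \<in> ell2" "ell2_norm a \<le> sqrt K"
proof -
  have fin: "\<And>F. finite F \<Longrightarrow> F \<subseteq> {1..} \<Longrightarrow> (\<Sum>n\<in>F. (cmod (a n))\<^sup>2) \<le> K" using assms by (auto simp: l2_bounded_def)
  have s: "(\<lambda>n. (cmod (a n))\<^sup>2) summable_on {1..}"
    by (rule nonneg_bdd_above_summable_on) (use fin in \<open>auto intro!: bdd_aboveI2[where M = K]\<close>)
  then show "a \<in> ell2" by (simp add: ell2_def)
  show "ell2_norm a \<le> sqrt K" unfolding ell2_norm_def by (intro real_sqrt_le_mono infsum_le_finite_sums[OF s fin])
qed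

section \<open>From the resonance estimate to the remainder\<close>

lemma l2_inner_sin:
  assumes q: "q absolutely_integrable_on {0..1}"
  shows "l2_inner q (\<lambda>x. of_real (sin (2 * pi * real n * x))) = (fourier_coeff q (- int n) - fourier_coeff q (int n)) / (2 * \<i>)"
proof -
  have sin: "complex_of_real (sin (2 * pi * real n * x)) = (fexp (int n) x - fexp (- int n) x) / (2 * \<i>)" for x
    by (simp add: sin_of_real[symmetric] sin_exp_eq fexp_def exp_minus mult_ac)
  have i: "(\<lambda>x. q x * fexp k x) integrable_on {0..1}" for k
    using absolutely_integrable_mult_fexp[OF q] by (simp add: absolutely_integrable_on_def)
  have "l2_inner q (\<lambda>x. of_real (sin (2 * pi * real n * x))) = (LINT x|lebesgue_on {0..1}. q x * of_real (sin (2 * pi * real n * x)))"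
    by (simp add: l2_inner_def)
  also have "\<dots> = integral {0..1} (\<lambda>x. q x * of_real (sin (2 * pi * real n * x)))"
    by (intro lebesgue_on_integral_eq absolutely_integrable_mult_continuous q continuous_intros)
  also have "\<dots> = integral {0..1} (\<lambda>x. (q x * fexp (int n) x - q x * fexp (- int n) x) / (2 * \<i>))"
    unfolding sin by (rule integral_cong) (simp add: algebra_simps diff_divide_distrib)
  also have "\<dots> = (integral {0..1} (\<lambda>x. q x * fexp (int n) x) - integral {0..1} (\<lambda>x. q x * fexp (- int n) x)) / (2 * \<i>)"
    by (simp add: integral_diff[OF i i])
  finally show ?thesis by (simp add: fourier_coeff_eq[OF q])
qed

text \<open>The sequence is solved from the claimed expansion, so the expansion itself becomes
  algebra and all the content lies in the square-sum bound.\<close>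

definition kappa_remainder :: "nat \<Rightarrow> (real \<Rightarrow> complex) \<Rightarrow> nat \<Rightarrow> complex" where
  "kappa_remainder N q n = of_nat n ^ (N + 1) * (2 * of_real pi * of_nat n * kappa n q
     - l2_inner q (\<lambda>x. of_real (sin (2 * pi * real n * x))))"

lemma HC_weighted:
  assumes q: "q \<in> HC 0" "q \<in> HC N"
  shows "(\<lambda>k. (\<bar>real_of_int k\<bar> ^ N * norm (fourier_coeff q k))\<^sup>2) summable_on UNIV"
    and "sqrt (\<Sum>\<^sub>\<infinity>k. (\<bar>real_of_int k\<bar> ^ N * norm (fourier_coeff q k))\<^sup>2) = Hnorm N q"
    and "Hnorm 0 q \<le> Hnorm N q" and "fourier_coeff q 0 = 0"
proof -
  show Q0: "fourier_coeff q 0 = 0" using q by (simp add: HC_def)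
  have e: "(\<bar>real_of_int k\<bar> ^ N * norm (fourier_coeff q k))\<^sup>2 = \<bar>real_of_int k\<bar> ^ (2 * N) * (norm (fourier_coeff q k))\<^sup>2" for k
    by (simp add: power_mult_distrib power_mult[symmetric] mult.commute)
  have s: "(\<lambda>k. (\<bar>real_of_int k\<bar> ^ N * norm (fourier_coeff q k))\<^sup>2) summable_on {k. k \<noteq> 0}"
    using q(2) unfolding e by (simp add: HC_def)
  have u: "UNIV = insert 0 {k::int. k \<noteq> 0}" by auto
  show s1: "(\<lambda>k. (\<bar>real_of_int k\<bar> ^ N * norm (fourier_coeff q k))\<^sup>2) summable_on UNIV"
    using s u by (metis summable_on_insert_iff)
  have "(\<Sum>\<^sub>\<infinity>k. (\<bar>real_of_int k\<bar> ^ N * norm (fourier_coeff q k))\<^sup>2)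
     = (\<Sum>\<^sub>\<infinity>k\<in>{k. k \<noteq> 0}. (\<bar>real_of_int k\<bar> ^ N * norm (fourier_coeff q k))\<^sup>2)"
    by (rule infsum_cong_neutral) (use Q0 in auto)
  then show n: "sqrt (\<Sum>\<^sub>\<infinity>k. (\<bar>real_of_int k\<bar> ^ N * norm (fourier_coeff q k))\<^sup>2) = Hnorm N q"
    unfolding Hnorm_def e by simp
  have "(norm (fourier_coeff q k))\<^sup>2 \<le> (\<bar>real_of_int k\<bar> ^ N * norm (fourier_coeff q k))\<^sup>2" for k
  proof (cases "k = 0")
    case False
    then have "1 \<le> \<bar>real_of_int k\<bar> ^ N" by (intro one_le_power) linarith
    then have "1 * norm (fourier_coeff q k) \<le> \<bar>real_of_int k\<bar> ^ N * norm (fourier_coeff q k)" by (intro mult_right_mono) auto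
    then show ?thesis by (intro power_mono) auto
  qed (simp add: Q0)
  then show "Hnorm 0 q \<le> Hnorm N q"
    unfolding HC_0_Hnorm[OF q(1)] n[symmetric]
    by (intro real_sqrt_le_mono infsum_mono HC_0_coeff_summable q(1) s1) auto
qed

text \<open>Each half is brought into the form of a convolution with a factor
  \<open>P (j) / \<bar>j\<bar>\<close> or its reflection. The half with 1 / |j + n| is first shifted
  by n, which is why the argument - n appears.\<close>

lemma pair_sum_convolution:
  assumes "resonance Q n N M \<kappa> \<tau>"
  defines "P \<equiv> \<lambda>k. \<bar>real_of_int k\<bar> ^ N * norm (Q k)"
  shows "resonance.pair_sum Q n N 0 (int n)
      = (\<Sum>\<^sub>\<infinity>j. P (- j) * \<bar>1 / real_of_int j\<bar> * P (j + int n)) + (\<Sum>\<^sub>\<infinity>j. P j * \<bar>1 / real_of_int j\<bar> * P (- (j + - int n)))"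
    and "resonance.pair_sum Q n N (- int n) 0
      = (\<Sum>\<^sub>\<infinity>j. P j * \<bar>1 / real_of_int j\<bar> * P (- (j + int n))) + (\<Sum>\<^sub>\<infinity>j. P (- j) * \<bar>1 / real_of_int j\<bar> * P (j + - int n))"
proof -
  interpret R: resonance Q n N M \<kappa> \<tau> by fact
  have PP: "R.P = P" by (simp add: fun_eq_iff P_def R.P_def)
  have inv: "\<bar>1 / real_of_int j\<bar> \<le> \<bar>1 / real_of_int j\<bar> + \<bar>1 / real_of_int (j + int n)\<bar>"
    "\<bar>1 / real_of_int (j + int n)\<bar> \<le> \<bar>1 / real_of_int j\<bar> + \<bar>1 / real_of_int (j + int n)\<bar>" for j by auto
  have P0: "P k \<ge> 0" for k by (simp add: P_def)
  have s: "(\<lambda>j. P (k - j) * P (j + m) * \<bar>1 / real_of_int j\<bar>) summable_on UNIV"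
    "(\<lambda>j. P (k - j) * P (j + m) * \<bar>1 / real_of_int (j + int n)\<bar>) summable_on UNIV" for k m
    by (rule summable_on_comparison_test[OF R.pair_sum_summable[of k m, unfolded PP]];
        intro mult_left_mono mult_nonneg_nonneg inv P0 abs_ge_zero)+
  have split: "R.pair_sum k m = (\<Sum>\<^sub>\<infinity>j. P (k - j) * P (j + m) * \<bar>1 / real_of_int j\<bar>)
     + (\<Sum>\<^sub>\<infinity>j. P (k - j) * P (j + m) * \<bar>1 / real_of_int (j + int n)\<bar>)" for k m
    unfolding R.pair_sum_def PP distrib_left by (rule infsum_add[OF s])
  have "(\<Sum>\<^sub>\<infinity>j. P (0 - j) * P (j + int n) * \<bar>1 / real_of_int (j + int n)\<bar>) = (\<Sum>\<^sub>\<infinity>j. P j * \<bar>1 / real_of_int j\<bar> * P (- (j + - int n)))"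
    using infsum_int_shift(1)[of "\<lambda>j. P j * \<bar>1 / real_of_int j\<bar> * P (- (j + - int n))" "int n"] by (simp add: mult_ac)
  moreover have "(\<Sum>\<^sub>\<infinity>j. P (0 - j) * P (j + int n) * \<bar>1 / real_of_int j\<bar>) = (\<Sum>\<^sub>\<infinity>j. P (- j) * \<bar>1 / real_of_int j\<bar> * P (j + int n))"
    by (simp add: mult_ac)
  ultimately show "R.pair_sum 0 (int n)
      = (\<Sum>\<^sub>\<infinity>j. P (- j) * \<bar>1 / real_of_int j\<bar> * P (j + int n)) + (\<Sum>\<^sub>\<infinity>j. P j * \<bar>1 / real_of_int j\<bar> * P (- (j + - int n)))"
    unfolding split by simp
  have e: "- int n - j = - j - int n" for j by simp
  have "(\<Sum>\<^sub>\<infinity>j. P (- int n - j) * P (j + 0) * \<bar>1 / real_of_int (j + int n)\<bar>) = (\<Sum>\<^sub>\<infinity>j. P (- j) * \<bar>1 / real_of_int j\<bar> * P (j + - int n))"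
    using infsum_int_shift(1)[of "\<lambda>j. P (- j) * \<bar>1 / real_of_int j\<bar> * P (j + - int n)" "int n"] by (simp add: e mult_ac)
  moreover have "(\<Sum>\<^sub>\<infinity>j. P (- int n - j) * P (j + 0) * \<bar>1 / real_of_int j\<bar>) = (\<Sum>\<^sub>\<infinity>j. P j * \<bar>1 / real_of_int j\<bar> * P (- (j + int n)))"
    by (simp add: e mult_ac)
  ultimately show "R.pair_sum (- int n) 0
      = (\<Sum>\<^sub>\<infinity>j. P j * \<bar>1 / real_of_int j\<bar> * P (- (j + int n))) + (\<Sum>\<^sub>\<infinity>j. P (- j) * \<bar>1 / real_of_int j\<bar> * P (j + - int n))"
    unfolding split by simp
qed

text \<open>\<open>P j / \<bar>j\<bar>\<close> is summable by Cauchy--Schwarz, with sum at most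
  \<open>M * sqrt zeta2\<close>; Young's inequality then gives the squared bound.\<close>

lemma weighted_convolution_bound:
  fixes P :: "int \<Rightarrow> real"
  assumes P: "(\<lambda>k. (P k)\<^sup>2) summable_on UNIV" "sqrt (\<Sum>\<^sub>\<infinity>k. (P k)\<^sup>2) \<le> M" "\<And>k. 0 \<le> P k"
    and R: "(\<lambda>k. (R k)\<^sup>2) summable_on UNIV" "sqrt (\<Sum>\<^sub>\<infinity>k. (R k)\<^sup>2) \<le> M" "\<And>k. 0 \<le> R k"
    and F: "finite F"
  shows "(\<Sum>m\<in>F. (\<Sum>\<^sub>\<infinity>j. P j * \<bar>1 / real_of_int j\<bar> * R (j + m))\<^sup>2) \<le> M ^ 4 * zeta2"
proof -
  have z: "(\<lambda>k. (1 / real_of_int k)\<^sup>2) summable_on UNIV" using inverse_square_int_summable by (simp add: power_divide)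
  note CS = infsum_Cauchy_Schwarz[OF P(1) z]
  have [simp]: "\<bar>P k\<bar> = P k" for k using P(3) by simp
  define f where "f = (\<lambda>j. P j * \<bar>1 / real_of_int j\<bar>)"
  have f: "f summable_on UNIV" using CS(1) by (simp add: f_def)
  have f0: "0 \<le> f j" for j using P(3) by (simp add: f_def)
  have "(\<Sum>\<^sub>\<infinity>j. f j) \<le> sqrt (\<Sum>\<^sub>\<infinity>k. (P k)\<^sup>2) * sqrt (\<Sum>\<^sub>\<infinity>k. (1 / real_of_int k)\<^sup>2)" using CS(2) by (simp add: f_def)
  also have "(\<Sum>\<^sub>\<infinity>k. (1 / real_of_int k)\<^sup>2) = zeta2" by (simp add: zeta2_def power_divide)
  also have "sqrt (\<Sum>\<^sub>\<infinity>k. (P k)\<^sup>2) * sqrt zeta2 \<le> M * sqrt zeta2" using P(2) zeta2_nonneg by (intro mult_right_mono) auto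
  finally have "(\<Sum>\<^sub>\<infinity>j. f j)\<^sup>2 \<le> (M * sqrt zeta2)\<^sup>2" using f0 by (intro power_mono infsum_nonneg)
  then have 1: "(\<Sum>\<^sub>\<infinity>j. f j)\<^sup>2 \<le> M\<^sup>2 * zeta2" using zeta2_nonneg by (simp add: power_mult_distrib)
  have "(sqrt (\<Sum>\<^sub>\<infinity>k. (R k)\<^sup>2))\<^sup>2 \<le> M\<^sup>2" using R(2) by (intro power_mono) (auto intro: infsum_nonneg)
  then have 2: "(\<Sum>\<^sub>\<infinity>k. (R k)\<^sup>2) \<le> M\<^sup>2" by (simp add: infsum_nonneg)
  have "(\<Sum>m\<in>F. (\<Sum>\<^sub>\<infinity>j. f j * R (j + m))\<^sup>2) \<le> (\<Sum>\<^sub>\<infinity>j. f j)\<^sup>2 * (\<Sum>\<^sub>\<infinity>j. (R j)\<^sup>2)"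
    by (rule convolution_l1_l2(2)[OF f f0 R(1) R(3) F])
  also have "\<dots> \<le> (M\<^sup>2 * zeta2) * M\<^sup>2" using 1 2 zeta2_nonneg by (intro mult_mono) (auto intro: infsum_nonneg)
  finally show ?thesis by (simp add: f_def mult_ac power4_eq_xxxx power2_eq_square)
qed

text \<open>The Floquet coefficients are fed into \<open>resonance_estimate\<close>. The bound is
  written with convolutions in n alone, so that each summand is visibly an l2 sequence controlled by
  \<open>M\<close>.\<close>

lemma kappa_remainder_large_index:
  assumes qH: "q \<in> HC 0" "q \<in> HC N" and HM: "Hnorm N q \<le> M" and n: "n1 < n"
    and n1: "100 * M \<le> real n1" "2 ^ (N + 2) * M * wt_const \<le> real n1"
      "4 * (M * wt_const * (1 + 2 * M * zeta2)) \<le> real n1" "16 * M\<^sup>2 * zeta2 \<le> real n1"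
    and C: "C = 32 * pi * M\<^sup>2 * zeta2 + 3 * (M * wt_const * (1 + 2 * M * zeta2))"
    and P_eq: "P = (\<lambda>k. \<bar>real_of_int k\<bar> ^ N * norm (fourier_coeff q k))"
  shows "cmod (kappa_remainder N q n) \<le> C * (P (int n) + P (- int n))
    + (C + 1) * (2 ^ (N + 1) * (
         ((\<Sum>\<^sub>\<infinity>j. P (- j) * \<bar>1 / real_of_int j\<bar> * P (j + int n)) + (\<Sum>\<^sub>\<infinity>j. P j * \<bar>1 / real_of_int j\<bar> * P (- (j + - int n))))
       + ((\<Sum>\<^sub>\<infinity>j. P j * \<bar>1 / real_of_int j\<bar> * P (- (j + int n))) + (\<Sum>\<^sub>\<infinity>j. P (- j) * \<bar>1 / real_of_int j\<bar> * P (j + - int n))))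
     + 2 ^ (2 * N + 4) * M ^ 3 * wt_const\<^sup>2 * (1 / real n))"
proof -
  have qi: "q absolutely_integrable_on {0..1}" by (rule HC_0_absolutely_integrable[OF qH(1)])
  note W = HC_weighted[OF qH]
  have LM: "L1_norm q \<le> M" using L1_norm_le_Hnorm[OF qH(1)] W(3) HM by simp
  interpret dirichlet_counting q M n1
  proof
    have "real n1 * 1 \<le> real n1 * pi" using pi_gt3 by (intro mult_left_mono) auto
    then have "real n1 < (real n1 + 1 / 2) * pi" using pi_gt3 by (simp add: distrib_right)
    then show "100 * M < (real n1 + 1 / 2) * pi" using n1(1) by simp
  qed (use qi LM in auto)
  define Q where "Q = fourier_coeff q"
  define \<kappa> \<mu> where "\<kappa> = kappa n q" and "\<mu> = dirichlet_ev n q"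
  define \<tau> where "\<tau> = \<mu> + \<kappa>\<^sup>2 - (of_nat n * of_real pi)\<^sup>2"
  have n0: "n \<ge> 1" using n by simp
  have res: "resonance Q n N M \<kappa> \<tau>"
  proof
    show "1 \<le> n" by fact
    show "Q 0 = 0" by (simp add: Q_def W)
    show "(\<lambda>k. (\<bar>real_of_int k\<bar> ^ N * norm (Q k))\<^sup>2) summable_on UNIV" unfolding Q_def by (rule W)
    show "sqrt (\<Sum>\<^sub>\<infinity>k. (\<bar>real_of_int k\<bar> ^ N * norm (Q k))\<^sup>2) \<le> M" unfolding Q_def W(2) by (rule HM)
    show "2 ^ (N + 2) * M * wt_const \<le> real n" using n1(2) n by linarith
    show "norm \<kappa> \<le> 1" using kappa_small(1)[OF n] by (simp add: \<kappa>_def)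
    show "norm \<tau> \<le> real n" using kappa_small(2)[OF n] by (simp add: \<kappa>_def \<tau>_def \<mu>_def)
  qed
  interpret R: resonance Q n N M \<kappa> \<tau> by (rule res)
  have dir: "y2 q 1 \<mu> = 0" unfolding \<mu>_def by (rule y2_dirichlet_ev[OF n0])
  have mult: "y2' q \<mu> 1 = (-1) ^ n * exp \<kappa>"
  proof -
    have "(-1) ^ n * exp \<kappa> = ((-1) ^ n * (-1) ^ n) * y2' q \<mu> 1"
      unfolding \<kappa>_def \<mu>_def exp_kappa(2)[OF n0] by (simp only: mult.assoc)
    then show ?thesis by (simp flip: power_mult_distrib)
  qed
  obtain H where H: "(\<lambda>k. norm (H k)) summable_on UNIV" "(H has_sum 0) UNIV" "\<exists>k. H k \<noteq> 0"
    and eq: "\<And>k. ((\<lambda>j. fourier_coeff q (k - j) * H j) has_sum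
        ((\<mu> + \<kappa>\<^sup>2 - (of_nat n * of_real pi)\<^sup>2 - 4 * (of_real pi)\<^sup>2 * of_int (k * (k + int n))
          + 2 * of_real pi * \<i> * \<kappa> * of_int (int n + 2 * k)) * H k)) UNIV"
    using dirichlet_floquet_fourier[OF qi dir mult] by blast
  have eq': "((\<lambda>j. Q (k - j) * H j) has_sum R.D k * H k) UNIV" for k
    using eq[of k] unfolding R.D_def unfolding Q_def \<tau>_def .
  have l: "4 * (M * wt_const * (1 + 2 * M * zeta2)) \<le> real n" "16 * M\<^sup>2 * zeta2 \<le> real n" using n1 n by simp_all
  note est = R.resonance_estimate[OF H eq' l C]
  have PP: "R.P = P" unfolding P_eq Q_def[symmetric] by (rule ext) (rule R.P_def)
  have PQ: "\<bar>real_of_int k\<bar> ^ N * norm (Q k) = P k" for k by (simp add: P_eq Q_def)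
  note ps = pair_sum_convolution[OF res, unfolded PQ]
  have "cmod (kappa_remainder N q n) = real n ^ (N + 1) * norm (2 * pi * n * \<kappa> - (Q (- int n) - Q (int n)) / (2 * \<i>))"
    unfolding kappa_remainder_def l2_inner_sin[OF qi] Q_def[symmetric] \<kappa>_def[symmetric]
    by (simp add: norm_mult norm_power)
  also have "\<dots> \<le> C * (P (int n) + P (- int n)) + (C + 1) * (2 ^ (N + 1) * (R.pair_sum 0 (int n) + R.pair_sum (- int n) 0)
       + 2 ^ (2 * N + 4) * M\<^sup>2 * wt_const * R.\<theta>)"
    using est unfolding PP .
  also have "2 ^ (2 * N + 4) * M\<^sup>2 * wt_const * R.\<theta> = 2 ^ (2 * N + 4) * M ^ 3 * wt_const\<^sup>2 * (1 / real n)"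
    by (simp add: R.\<theta>_def power2_eq_square power3_eq_cube)
  finally show ?thesis unfolding ps .
qed

lemma kappa_remainder_small_index:
  assumes qH: "q \<in> HC 0" "q \<in> HC N" and HM: "Hnorm N q \<le> M" and n: "1 \<le> n" "n \<le> n1" and n1: "100 * M \<le> real n1"
  shows "cmod (kappa_remainder N q n) \<le> real n1 ^ (N + 1) * (2 * pi * real n1 *
     (10 * (1 + M + zero_radius n1) * exp (2 * (1 + M + zero_radius n1)) + 4) + M)"
proof -
  have qi: "q absolutely_integrable_on {0..1}" by (rule HC_0_absolutely_integrable[OF qH(1)])
  have LM: "L1_norm q \<le> M" using L1_norm_le_Hnorm[OF qH(1)] HC_weighted(3)[OF qH] HM by simp
  interpret dirichlet_counting q M n1
  proof
    have "real n1 * 1 \<le> real n1 * pi" using pi_gt3 by (intro mult_left_mono) auto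
    then have "real n1 < (real n1 + 1 / 2) * pi" using pi_gt3 by (simp add: distrib_right)
    then show "100 * M < (real n1 + 1 / 2) * pi" using n1(1) by simp
  qed (use qi LM in auto)
  define K where "K = 10 * (1 + M + zero_radius n1) * exp (2 * (1 + M + zero_radius n1)) + 4"
  have k: "cmod (kappa n q) \<le> K" unfolding K_def by (rule kappa_bounded[OF n])
  have Qb: "cmod (fourier_coeff q k) \<le> M" for k
    using fourier_coeff_bound[OF qi, of k] LM by (simp add: L1_norm_def)
  have "cmod ((fourier_coeff q (- int n) - fourier_coeff q (int n)) / (2 * \<i>)) \<le> M"
    using norm_triangle_ineq4[of "fourier_coeff q (- int n)" "fourier_coeff q (int n)"] Qb[of "int n"] Qb[of "- int n"]
    by (simp add: norm_divide norm_mult)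
  then have "cmod (2 * of_real pi * of_nat n * kappa n q - (fourier_coeff q (- int n) - fourier_coeff q (int n)) / (2 * \<i>))
     \<le> 2 * pi * real n * cmod (kappa n q) + M"
    using norm_triangle_ineq4[of "2 * of_real pi * of_nat n * kappa n q" "(fourier_coeff q (- int n) - fourier_coeff q (int n)) / (2 * \<i>)"]
    by (simp add: norm_mult)
  also have "\<dots> \<le> 2 * pi * real n1 * K + M"
    using n k by (intro add_right_mono mult_mono) auto
  finally have "cmod (kappa_remainder N q n) \<le> real n ^ (N + 1) * (2 * pi * real n1 * K + M)"
    unfolding kappa_remainder_def l2_inner_sin[OF qi] by (simp add: norm_mult norm_power mult_left_mono)
  also have "\<dots> \<le> real n1 ^ (N + 1) * (2 * pi * real n1 * K + M)"
    using n order_trans[OF norm_ge_zero k] M_nonneg by (intro mult_right_mono power_mono add_nonneg_nonneg mult_nonneg_nonneg) auto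
  finally show ?thesis by (simp add: K_def)
qed

lemma kappa_remainder_l2_bounded:
  "\<exists>K. \<forall>q \<in> HC 0 \<inter> HC N. Hnorm N q \<le> M \<longrightarrow> l2_bounded (\<lambda>n. cmod (kappa_remainder N q n)) K"
proof -
  \<comment> \<open>The thresholds serve, in this order, the localisation of the eigenvalues, the
    contraction, the closeness of the resonant ratio to -1, and the absorption of the
    \<open>\<kappa>\<close> term.\<close>
  define X where "X = max (max (100 * M) (2 ^ (N + 2) * M * wt_const))
     (max (4 * (M * wt_const * (1 + 2 * M * zeta2))) (16 * M\<^sup>2 * zeta2))"
  define n1 where "n1 = nat \<lceil>X\<rceil>"
  have X: "X \<le> real n1" by (simp add: n1_def real_nat_ceiling_ge)
  have n1: "100 * M \<le> real n1" "2 ^ (N + 2) * M * wt_const \<le> real n1"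
      "4 * (M * wt_const * (1 + 2 * M * zeta2)) \<le> real n1" "16 * M\<^sup>2 * zeta2 \<le> real n1"
    using X unfolding X_def by simp_all
  define C where "C = 32 * pi * M\<^sup>2 * zeta2 + 3 * (M * wt_const * (1 + 2 * M * zeta2))"
  define c1 where "c1 = real n1 ^ (N + 1) * (2 * pi * real n1 *
     (10 * (1 + M + zero_radius n1) * exp (2 * (1 + M + zero_radius n1)) + 4) + M)"
  define c2 where "c2 = (C + 1) * 2 ^ (N + 1)"
  define c3 where "c3 = (C + 1) * (2 ^ (2 * N + 4) * M ^ 3 * wt_const\<^sup>2)"
  define L where "L = M ^ 4 * zeta2"
  \<comment> \<open>The nesting mirrors the sum of majorants below: squared bounds double with every
    addition and take the square of every scalar.\<close>
  define K where "K = 2 * (2 * (2 * (real n1 * c1\<^sup>2) + 2 * (C\<^sup>2 * (2 * M\<^sup>2 + 2 * M\<^sup>2)))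
     + 2 * (c2\<^sup>2 * (2 * (2 * L + 2 * L) + 2 * (2 * L + 2 * L)))) + 2 * (c3\<^sup>2 * zeta2)"
  have "l2_bounded (\<lambda>n. cmod (kappa_remainder N q n)) K" if q: "q \<in> HC 0" "q \<in> HC N" and M: "Hnorm N q \<le> M" for q
  proof -
    note W = HC_weighted[OF q]
    define P where "P = (\<lambda>k. \<bar>real_of_int k\<bar> ^ N * norm (fourier_coeff q k))"
    have P: "(\<lambda>k. (P k)\<^sup>2) summable_on UNIV" "sqrt (\<Sum>\<^sub>\<infinity>k. (P k)\<^sup>2) \<le> M" "0 \<le> P k" for k
      using W(1,2) M by (simp_all add: P_def)
    have P': "(\<lambda>k. (P (- k))\<^sup>2) summable_on UNIV" "sqrt (\<Sum>\<^sub>\<infinity>k. (P (- k))\<^sup>2) \<le> M"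
      using summable_on_int_shift(2)[of "\<lambda>k. (P k)\<^sup>2" 0] infsum_int_shift(2)[of "\<lambda>k. (P k)\<^sup>2" 0] P by simp_all
    have M0: "M \<ge> 0" by (rule order_trans[OF _ P(2)]) (auto intro: infsum_nonneg)
    have C0: "C \<ge> 0" unfolding C_def using M0 wt_const_nonneg zeta2_nonneg by simp
    have P2: "(\<Sum>k\<in>F. (P k)\<^sup>2) \<le> M\<^sup>2" if "finite F" for F
    proof -
      have "(\<Sum>k\<in>F. (P k)\<^sup>2) \<le> (\<Sum>\<^sub>\<infinity>k. (P k)\<^sup>2)" by (rule finite_sum_le_infsum[OF P(1) that]) auto
      also have "\<dots> = (sqrt (\<Sum>\<^sub>\<infinity>k. (P k)\<^sup>2))\<^sup>2" by (simp add: infsum_nonneg)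
      also have "\<dots> \<le> M\<^sup>2" using P(2) by (intro power_mono) (auto intro: infsum_nonneg)
      finally show ?thesis .
    qed
    define \<phi> where "\<phi> = (\<lambda>m. \<Sum>\<^sub>\<infinity>j. P (- j) * \<bar>1 / real_of_int j\<bar> * P (j + m))"
    define \<psi> where "\<psi> = (\<lambda>m. \<Sum>\<^sub>\<infinity>j. P j * \<bar>1 / real_of_int j\<bar> * P (- (j + m)))"
    have \<phi>: "(\<Sum>m\<in>F. (\<phi> m)\<^sup>2) \<le> L" if "finite F" for F
      unfolding \<phi>_def L_def by (rule weighted_convolution_bound[OF P' P(3) P(1,2) P(3) that])
    have \<psi>: "(\<Sum>m\<in>F. (\<psi> m)\<^sup>2) \<le> L" if "finite F" for F
      unfolding \<psi>_def L_def by (rule weighted_convolution_bound[OF P P' P(3) that])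
    have inj: "inj int" "inj (\<lambda>n. - int n)" by (auto simp: inj_def)
    have pos: "0 \<le> \<phi> m" "0 \<le> \<psi> m" for m unfolding \<phi>_def \<psi>_def using P(3) by (auto intro!: infsum_nonneg)
    have "l2_bounded (\<lambda>n. (((if n \<le> n1 then c1 else 0) + C * (P (int n) + P (- int n)))
        + c2 * ((\<phi> (int n) + \<psi> (- int n)) + (\<psi> (int n) + \<phi> (- int n)))) + c3 * (1 / real n)) K"
      unfolding K_def
      by (intro l2_bounded_add l2_bounded_cmult l2_bounded_cutoff l2_bounded_inverse
          l2_bounded_int[OF inj(1) P2] l2_bounded_int[OF inj(2) P2] l2_bounded_int[OF inj(1) \<phi>]
          l2_bounded_int[OF inj(2) \<phi>] l2_bounded_int[OF inj(1) \<psi>] l2_bounded_int[OF inj(2) \<psi>])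
    then show ?thesis
    proof (rule l2_bounded_mono)
      fix n :: nat assume n: "n \<ge> 1"
      define rest where "rest = C * (P (int n) + P (- int n))
        + c2 * ((\<phi> (int n) + \<psi> (- int n)) + (\<psi> (int n) + \<phi> (- int n))) + c3 * (1 / real n)"
      have "rest \<ge> 0" unfolding rest_def c2_def c3_def using C0 P(3) pos M0 by simp
      \<comment> \<open>The cutoff constant and \<open>rest\<close> are both nonnegative, so their
        sum majorises the remainder at small and large indices alike.\<close>
      moreover have "cmod (kappa_remainder N q n) \<le> (if n \<le> n1 then c1 else rest)"
      proof (cases "n \<le> n1")
        case True
        then show ?thesis using kappa_remainder_small_index[OF q M n True n1(1)] by (simp only: if_True c1_def)
      next
        case False
        then have "n1 < n" by simp
        have \<phi>': "(\<Sum>\<^sub>\<infinity>j. P (- j) * \<bar>1 / real_of_int j\<bar> * P (j + m)) = \<phi> m"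
          and \<psi>': "(\<Sum>\<^sub>\<infinity>j. P j * \<bar>1 / real_of_int j\<bar> * P (- (j + m))) = \<psi> m" for m
          by (simp_all only: \<phi>_def \<psi>_def)
        from kappa_remainder_large_index[OF q M \<open>n1 < n\<close> n1 C_def P_def, unfolded \<phi>' \<psi>']
        have "cmod (kappa_remainder N q n) \<le> rest" unfolding rest_def c2_def c3_def by (simp only: algebra_simps)
        then show ?thesis using False by simp
      qed
      ultimately show "0 \<le> cmod (kappa_remainder N q n) \<and> cmod (kappa_remainder N q n) \<le> (((if n \<le> n1 then c1 else 0) + C * (P (int n) + P (- int n)))
        + c2 * ((\<phi> (int n) + \<psi> (- int n)) + (\<psi> (int n) + \<phi> (- int n)))) + c3 * (1 / real n)"
        unfolding rest_def by (auto split: if_splits)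
    qed
  qed
  then show ?thesis by blast
qed

theorem theorem1p1:
  fixes N :: nat and W :: "(real \<Rightarrow> complex) set"
  assumes "admissible_nbhd W"
  shows "\<exists>a :: (real \<Rightarrow> complex) \<Rightarrow> nat \<Rightarrow> complex.
    (\<forall>q \<in> W \<inter> HC N. a q \<in> ell2 \<and>
       (\<forall>n\<ge>1. kappa n q =
          1 / (2 * of_real pi * of_nat n) *
            (l2_inner q (\<lambda>x. of_real (sin (2 * pi * real n * x)))
             + 1 / of_nat n ^ (N + 1) * a q n)))
    \<and> (\<forall>B. B \<subseteq> W \<inter> HC N \<and> Hbounded N B \<longrightarrow> (\<exists>C. \<forall>q\<in>B. ell2_norm (a q) \<le> C))"
proof -
  have W: "W \<subseteq> HC 0" using assms by (simp add: admissible_nbhd_def open_in_H0_def)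
  have ell2: "kappa_remainder N q \<in> ell2" if q: "q \<in> W \<inter> HC N" for q
  proof -
    \<comment> \<open>Membership for an individual potential is the uniform statement with its own
      norm as the bound.\<close>
    obtain K where "\<forall>q' \<in> HC 0 \<inter> HC N. Hnorm N q' \<le> Hnorm N q \<longrightarrow> l2_bounded (\<lambda>n. cmod (kappa_remainder N q' n)) K"
      using kappa_remainder_l2_bounded by blast
    then have "l2_bounded (\<lambda>n. cmod (kappa_remainder N q n)) K" using q W by blast
    then show ?thesis by (rule l2_bounded_imp_ell2)
  qed
  have eq: "kappa n q = 1 / (2 * of_real pi * of_nat n) *
      (l2_inner q (\<lambda>x. of_real (sin (2 * pi * real n * x))) + 1 / of_nat n ^ (N + 1) * kappa_remainder N q n)"
    if "1 \<le> n" for n q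
    using that by (simp add: kappa_remainder_def)
  have bound: "\<exists>C. \<forall>q\<in>B. ell2_norm (kappa_remainder N q) \<le> C" if B: "B \<subseteq> W \<inter> HC N" "Hbounded N B" for B
  proof -
    obtain M where M: "\<And>q. q \<in> B \<Longrightarrow> Hnorm N q \<le> M" using B(2) by (auto simp: Hbounded_def)
    obtain K where K: "\<forall>q \<in> HC 0 \<inter> HC N. Hnorm N q \<le> M \<longrightarrow> l2_bounded (\<lambda>n. cmod (kappa_remainder N q n)) K"
      using kappa_remainder_l2_bounded by blast
    have "ell2_norm (kappa_remainder N q) \<le> sqrt K" if "q \<in> B" for q
      by (rule l2_bounded_imp_ell2(2)) (use K M[OF that] B W that in blast)
    then show ?thesis by blast
  qed
  show ?thesis
    by (intro exI[of _ "kappa_remainder N"]) (use ell2 eq bound in blast)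
qed

end
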